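(* Let $G$ be the random-free graphon (which has a computable $d_1$-name) defined by the fractal construction described in the context. Let $H$ be a graphon weakly isomorphic to $G$, and let $\mathcal{T}$ be some topology on $[0,1]$ every open set of which is a standard Borel set (i.e. a Borel subset of $[0,1]$ in the usual sense). Then $H$ is not a.e. continuous with respect to $\mathcal{T}\times\mathcal{T}$.
   Context: $\lambda$ is Lebesgue measure. A graphon is a symmetric measurable function $W\colon[0,1]^2\to[0,1]$; it is random-free if it is $\{0,1\}$-valued a.e. A graphon $W$ is a.e. continuous with respect to $\mathcal{T}\times\mathcal{T}$ (the product topology on $[0,1]^2$) if there is a set $X\subseteq[0,1]^2$ with $\lambda(X)=1$ such that $W|_X$ is continuous with respect to the subspace topology on $X$ induced by $\mathcal{T}\times\mathcal{T}$. Graphons $U,W$ are weakly isomorphic if $\inf_\varphi\sup_{S,T}\left|\int_{S\times T}(U-W^\varphi)\,dx\,dy\right|=0$, where $S,T$ range over measurable subsets of $[0,1]$, $\varphi$ ranges over measure-preserving maps of $([0,1],\lambda)$ to itself, and $W^\varphi(x,y)=W(\varphi(x),\varphi(y))$; equivalently (a known theorem), there are measure-preserving maps $\varphi,\psi\colon[0,1]\to[0,1]$ with $U^\varphi=W^\psi$ a.e. $d_1(U,W)=\int|U-W|\,d\lambda$. With $(s_i)_{i\in\mathbb{N}}$ a (straightforward) computable enumeration of the graphons that are constant with a rational value on each product of parts of a partition of $[0,1]$ into finitely many equally-sized intervals, a computable $d_1$-name of $W$ is a sequence $(s_{k_j})_j$ with $(k_j)_j$ computable, $d_1(s_{k_j},s_{k_\ell})\le2^{-j}$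 for $j<\ell$, and $d_1(s_{k_j},W)\to0$. Construction of $G$ (as a subset of $[0,1]^2$: "black" means value $1$, "white" means value $0$). Stage 1: draw a $2\times2$ square grid (products of the intervals $[0,\frac12)$ and $[\frac12,1]$) and color the 2 squares on the diagonal black. Stage 2: on each of the 2 remaining squares, draw a $4\times4$ square grid (similarly from products of half-open or closed intervals) and color its 4 diagonal squares black (8 squares in total). Stage 3: on each of the remaining 24 squares draw an $8\times8$ grid and color its diagonal squares black. Continue in this way: at stage $n$, each remaining uncolored square is divided into a $2^n\times2^n$ grid and its $2^n$ diagonal squares are colored black. $G$ is $1$ on the union of all black squares and $0$ elsewhere. Equivalently, split the binary expansion of each $x\in[0,1]$ (not eventually all ones, except that $1=0.111\ldots$) into consecutive blocks of lengths $1,2,3,\ldots$; then $G(x,y)=1$ iff for some $n\ge1$ the $n$th blocks of $x$ and $y$ agree. *)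

theory Defs
  imports "HOL-Analysis.Analysis"
begin

section \<open>Graphons\<close>

abbreviation unit_square :: "(real \<times> real) set" where
  "unit_square \<equiv> {0..1} \<times> {0..1}"

text \<open>Measurability is Lebesgue measurability, for graphons and for the maps and sets below.
  Values outside the unit square are irrelevant.\<close>

definition graphon :: "(real \<times> real \<Rightarrow> real) \<Rightarrow> bool" where
  "graphon W \<longleftrightarrow>
     W \<in> borel_measurable (lebesgue_on unit_square) \<and>
     (\<forall>x\<in>{0..1}. \<forall>y\<in>{0..1}. W (x, y) = W (y, x) \<and> 0 \<le> W (x, y) \<and> W (x, y) \<le> 1)"

definition random_free :: "(real \<times> real \<Rightarrow> real) \<Rightarrow> bool" where
  "random_free W \<longleftrightarrow> (AE z in lebesgue_on unit_square. W z \<in> {0, 1})"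

definition ae_continuous :: "real topology \<Rightarrow> (real \<times> real \<Rightarrow> real) \<Rightarrow> bool" where
  "ae_continuous T W \<longleftrightarrow>
     (\<exists>X. X \<subseteq> unit_square \<and> X \<in> sets lebesgue \<and> emeasure lebesgue X = 1 \<and>
          continuous_map (subtopology (prod_topology T T) X) euclideanreal W)"

definition measure_preserving_maps :: "(real \<Rightarrow> real) set" where
  "measure_preserving_maps =
     {\<phi>. \<phi> \<in> measurable (lebesgue_on {0..1}) (lebesgue_on {0..1}) \<and>
          distr (lebesgue_on {0..1}) (lebesgue_on {0..1}) \<phi> = lebesgue_on {0..1}}"

definition pullback :: "(real \<times> real \<Rightarrow> real) \<Rightarrow> (real \<Rightarrow> real) \<Rightarrow> real \<times> real \<Rightarrow> real" where
  "pullback W \<phi> = (\<lambda>(x, y). W (\<phi> x, \<phi> y))"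

definition measurable_subsets :: "real set set" where
  "measurable_subsets = {S. S \<in> sets lebesgue \<and> S \<subseteq> {0..1}}"

definition weakly_isomorphic ::
    "(real \<times> real \<Rightarrow> real) \<Rightarrow> (real \<times> real \<Rightarrow> real) \<Rightarrow> bool" where
  "weakly_isomorphic U W \<longleftrightarrow>
     (INF \<phi>\<in>measure_preserving_maps.
        SUP R\<in>measurable_subsets \<times> measurable_subsets.
          \<bar>\<integral>z. U z - pullback W \<phi> z \<partial>(lebesgue_on (fst R \<times> snd R))\<bar>) = 0"

definition d1 :: "(real \<times> real \<Rightarrow> real) \<Rightarrow> (real \<times> real \<Rightarrow> real) \<Rightarrow> real" where
  "d1 U W = (\<integral>z. \<bar>U z - W z\<bar> \<partial>(lebesgue_on unit_square))"


section \<open>Computable functions on the natural numbers\<close>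

text \<open>Kleene's (partial) recursive functions, as terms with a big-step evaluation relation.\<close>

datatype recf =
    Zero_rf
  | Succ_rf
  | Proj_rf nat
  | Comp_rf recf "recf list"
  | Prim_rf recf recf
  | Mu_rf recf

inductive rf_eval :: "recf \<Rightarrow> nat list \<Rightarrow> nat \<Rightarrow> bool" where
  "rf_eval Zero_rf xs 0"
| "rf_eval Succ_rf [x] (Suc x)"
| "i < length xs \<Longrightarrow> rf_eval (Proj_rf i) xs (xs ! i)"
| "list_all2 (\<lambda>g y. rf_eval g xs y) gs ys \<Longrightarrow> rf_eval f ys z \<Longrightarrow> rf_eval (Comp_rf f gs) xs z"
| "rf_eval f xs y \<Longrightarrow> rf_eval (Prim_rf f g) (0 # xs) y"
| "rf_eval (Prim_rf f g) (n # xs) y \<Longrightarrow> rf_eval g (n # y # xs) z \<Longrightarrow>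
     rf_eval (Prim_rf f g) (Suc n # xs) z"
| "rf_eval f (n # xs) 0 \<Longrightarrow> (\<forall>m<n. \<exists>k>0. rf_eval f (m # xs) k) \<Longrightarrow> rf_eval (Mu_rf f) xs n"

definition computable :: "(nat \<Rightarrow> nat) \<Rightarrow> bool" where
  "computable f \<longleftrightarrow> (\<exists>e. \<forall>n. rf_eval e [n] (f n))"


section \<open>Rational step graphons and \<open>d1\<close>-names\<close>

text \<open>The \<open>p\<close>th of \<open>n\<close> equal parts of the unit interval: half-open, except that the last part
  contains \<open>1\<close>.\<close>

definition cell :: "nat \<Rightarrow> nat \<Rightarrow> real set" where
  "cell n p =
     (if Suc p = n then {real p / real n..1} else {real p / real n..<real (Suc p) / real n})"

definition step_fun :: "nat \<Rightarrow> (nat \<Rightarrow> nat \<Rightarrow> real) \<Rightarrow> real \<times> real \<Rightarrow> real" where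
  "step_fun n a z = (\<Sum>p<n. \<Sum>q<n. a p q * indicator (cell n p \<times> cell n q) z)"

definition rat_entry :: "nat list \<Rightarrow> nat \<Rightarrow> real" where
  "rat_entry cs k = max 0 (min 1 (of_rat (nat_to_rat_surj (if k < length cs then cs ! k else 0))))"

text \<open>A number codes the number of parts (minus one) together with a list of codes of rationals;
  these rationals, clamped to the unit interval, are the values, stored row by row. Only the
  entries with row index at most the column index are read, so that the result is symmetric.
  Lemma \<open>range_step_enum\<close> below confirms that precisely the intended graphons are enumerated.\<close>

definition step_enum :: "nat \<Rightarrow> real \<times> real \<Rightarrow> real" where
  "step_enum i =
     (let n = Suc (fst (prod_decode i)); cs = list_decode (snd (prod_decode i))
      in step_fun n (\<lambda>p q. rat_entry cs (min p q * n + max p q)))"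

definition computable_d1_name :: "(real \<times> real \<Rightarrow> real) \<Rightarrow> (nat \<Rightarrow> nat) \<Rightarrow> bool" where
  "computable_d1_name W k \<longleftrightarrow>
     computable k \<and>
     (\<forall>j l. j < l \<longrightarrow> d1 (step_enum (k j)) (step_enum (k l)) \<le> 1 / 2 ^ j) \<and>
     (\<lambda>j. d1 (step_enum (k j)) W) \<longlonglongrightarrow> 0"

definition rational_step_graphons :: "(real \<times> real \<Rightarrow> real) set" where
  "rational_step_graphons =
     {step_fun n a | n a. 0 < n \<and>
        (\<forall>p<n. \<forall>q<n. a p q \<in> \<rat> \<and> 0 \<le> a p q \<and> a p q \<le> 1 \<and> a p q = a q p)}"

lemma range_step_enum: "range step_enum = rational_step_graphons"
proof (intro equalityI subsetI)
  fix W assume "W \<in> range step_enum"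
  then obtain i where W: "W = step_enum i" by auto
  define n where "n = Suc (fst (prod_decode i))"
  define cs where "cs = list_decode (snd (prod_decode i))"
  define a where "a = (\<lambda>p q. rat_entry cs (min p q * n + max p q))"
  have "W = step_fun n a" by (simp add: W step_enum_def Let_def n_def cs_def a_def)
  moreover have "rat_entry cs k \<in> \<rat> \<and> 0 \<le> rat_entry cs k \<and> rat_entry cs k \<le> 1" for k
    by (auto simp: rat_entry_def max_def min_def)
  then have "a p q \<in> \<rat> \<and> 0 \<le> a p q \<and> a p q \<le> 1 \<and> a p q = a q p" for p q
    by (simp add: a_def min.commute max.commute)
  moreover have "0 < n" by (simp add: n_def)
  ultimately show "W \<in> rational_step_graphons"
    unfolding rational_step_graphons_def by blast
next
  fix W assume "W \<in> rational_step_graphons"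
  then obtain n a where W: "W = step_fun n a" and n: "0 < n"
    and a: "\<And>p q. p < n \<Longrightarrow> q < n \<Longrightarrow> a p q \<in> \<rat> \<and> 0 \<le> a p q \<and> a p q \<le> 1 \<and> a p q = a q p"
    unfolding rational_step_graphons_def by blast
  define c where "c = (\<lambda>r. SOME m. of_rat (nat_to_rat_surj m) = (r :: real))"
  have c: "of_rat (nat_to_rat_surj (c r)) = r" if r: "r \<in> \<rat>" for r :: real
  proof -
    obtain s where "r = of_rat s" using r by (auto elim: Rats_cases)
    moreover obtain m where "s = nat_to_rat_surj m" using surj_nat_to_rat_surj by (auto elim: surjE)
    ultimately have "\<exists>m. of_rat (nat_to_rat_surj m) = r" by auto
    then show ?thesis unfolding c_def by (rule someI_ex)
  qed
  define cs where "cs = map (\<lambda>k. c (a (k div n) (k mod n))) [0..<n * n]"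
  have entry: "rat_entry cs (min p q * n + max p q) = a p q" if pq: "p < n" "q < n" for p q
  proof -
    have m: "min p q < n" "max p q < n" using pq by auto
    have "min p q * n + max p q < Suc (min p q) * n" using m by simp
    also have "\<dots> \<le> n * n" using m by (intro mult_le_mono1) simp
    finally have "min p q * n + max p q < n * n" .
    then have "rat_entry cs (min p q * n + max p q) = a (min p q) (max p q)"
      using m conjunct1[OF a[OF m]] conjunct1[OF conjunct2[OF a[OF m]]]
        conjunct1[OF conjunct2[OF conjunct2[OF a[OF m]]]]
      by (simp add: rat_entry_def cs_def c)
    also have "\<dots> = a p q" using a[OF pq] by (simp add: min_def max_def)
    finally show ?thesis .
  qed
  define i where "i = prod_encode (n - 1, list_encode cs)"
  have "step_enum i = step_fun n (\<lambda>p q. rat_entry cs (min p q * n + max p q))"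
    using n by (simp add: step_enum_def i_def Let_def)
  also have "\<dots> = W" unfolding W by (auto simp: step_fun_def entry intro!: ext sum.cong)
  finally show "W \<in> range step_enum" by blast
qed


section \<open>The fractal graphon\<close>

text \<open>After stage \<open>n\<close> every square that has been drawn but not subdivided has side length
  \<open>1 / grid n\<close>, where \<open>grid n = 2 ^ (1 + \<dots> + n)\<close>, and is written as the pair \<open>(p, q)\<close> standing for
  \<open>cell (grid n) p \<times> cell (grid n) q\<close>. Cutting \<open>cell (grid n) p\<close> into \<open>2 ^ Suc n\<close> equal parts
  gives the cells with indices \<open>p * 2 ^ Suc n + k\<close> for \<open>k < 2 ^ Suc n\<close>.\<close>

fun grid :: "nat \<Rightarrow> nat" where
  "grid 0 = 1"
| "grid (Suc n) = grid n * 2 ^ Suc n"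

fun uncolored :: "nat \<Rightarrow> (nat \<times> nat) set" where
  "uncolored 0 = {(0, 0)}"
| "uncolored (Suc n) =
     {(p * 2 ^ Suc n + k, q * 2 ^ Suc n + l) | p q k l.
        (p, q) \<in> uncolored n \<and> k < 2 ^ Suc n \<and> l < 2 ^ Suc n \<and> k \<noteq> l}"

fun blackened :: "nat \<Rightarrow> (nat \<times> nat) set" where
  "blackened 0 = {}"
| "blackened (Suc n) =
     {(p * 2 ^ Suc n + k, q * 2 ^ Suc n + k) | p q k. (p, q) \<in> uncolored n \<and> k < 2 ^ Suc n}"

definition black_region :: "(real \<times> real) set" where
  "black_region = (\<Union>n. \<Union>(p, q)\<in>blackened n. cell (grid n) p \<times> cell (grid n) q)"

definition G :: "real \<times> real \<Rightarrow> real" where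
  "G = indicator black_region"

text \<open>The description of \<open>G\<close> by blocks of binary digits: \<open>block n x\<close> is the number whose binary
  digits form the \<open>n\<close>th block (of length \<open>n\<close>) of the expansion of \<open>x\<close>.\<close>

definition cell_index :: "nat \<Rightarrow> real \<Rightarrow> nat" where
  "cell_index N x = min (N - 1) (nat \<lfloor>real N * x\<rfloor>)"

definition block :: "nat \<Rightarrow> real \<Rightarrow> nat" where
  "block n x = cell_index (grid n) x mod 2 ^ n"

lemma mem_cell_iff:
  assumes x: "x \<in> {0..1}" and p: "p < N"
  shows "x \<in> cell N p \<longleftrightarrow> cell_index N x = p"
proof -
  have N: "0 < real N" using p by simp
  have fl: "nat \<lfloor>real N * x\<rfloor> = m \<longleftrightarrow> real m \<le> real N * x \<and> real N * x < real m + 1" for m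
    using x by (simp add: nat_eq_iff floor_eq_iff)
  have ge: "m \<le> nat \<lfloor>real N * x\<rfloor> \<longleftrightarrow> real m \<le> real N * x" for m
    using x by (simp add: le_nat_iff le_floor_iff)
  show ?thesis
  proof (cases "Suc p = N")
    case True
    have "cell_index N x = p \<longleftrightarrow> p \<le> nat \<lfloor>real N * x\<rfloor>"
      using True by (auto simp: cell_index_def min_def)
    also have "\<dots> \<longleftrightarrow> x \<in> cell N p"
      unfolding ge using True x N by (auto simp: cell_def divide_le_eq mult.commute)
    finally show ?thesis by simp
  next
    case False
    have "cell_index N x = p \<longleftrightarrow> nat \<lfloor>real N * x\<rfloor> = p"
      using False p by (auto simp: cell_index_def min_def)
    also have "\<dots> \<longleftrightarrow> x \<in> cell N p"
      unfolding fl using False N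
      by (auto simp: cell_def divide_le_eq less_divide_eq mult.commute add.commute)
    finally show ?thesis by simp
  qed
qed

lemma grid_pos: "0 < grid n"
  by (induction n) auto

lemma cell_index_less: "0 < N \<Longrightarrow> cell_index N x < N"
  by (auto simp: cell_index_def min_def)

lemma cell_index_div:
  assumes x: "x \<in> {0..1}" and N: "0 < N" and M: "0 < M"
  shows "cell_index (N * M) x div M = cell_index N x"
proof -
  have 1: "nat \<lfloor>real (N * M) * x\<rfloor> div M = nat \<lfloor>real N * x\<rfloor>"
  proof -
    have "\<lfloor>real (N * M) * x\<rfloor> div int M = \<lfloor>real (N * M) * x / real M\<rfloor>"
      using floor_divide_real_eq_div[of "int M" "real (N * M) * x"] by simp
    also have "\<dots> = \<lfloor>real N * x\<rfloor>" using M by simp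
    finally have "nat (\<lfloor>real (N * M) * x\<rfloor> div int M) = nat \<lfloor>real N * x\<rfloor>" by simp
    then show ?thesis using x by (simp add: nat_div_distrib)
  qed
  have 2: "(N * M - 1) div M = N - 1"
  proof -
    have "N * M - 1 = (N - 1) * M + (M - 1)" using N M by (cases N; cases M) auto
    moreover have "((N - 1) * M + (M - 1)) div M = N - 1" using M by (subst div_mult_self3) auto
    ultimately show ?thesis by (simp only:)
  qed
  have "min a b div M = min (a div M) (b div M)" for a b :: nat
    using div_le_mono[of a b M] div_le_mono[of b a M] by (cases "a \<le> b") (simp_all add: min_absorb1 min_absorb2)
  then show ?thesis unfolding cell_index_def by (simp only: 1 2)
qed

lemma cell_index_grid_Suc:
  assumes "x \<in> {0..1}"
  shows "cell_index (grid (Suc n)) x = cell_index (grid n) x * 2 ^ Suc n + block (Suc n) x"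
proof -
  have "cell_index (grid (Suc n)) x div 2 ^ Suc n = cell_index (grid n) x"
    using cell_index_div[OF assms grid_pos, of "2 ^ Suc n" n] by simp
  then show ?thesis unfolding block_def by (metis div_mult_mod_eq)
qed

lemma digits_unique:
  "k < M \<Longrightarrow> k' < M \<Longrightarrow> p * M + k = p' * M + k' \<longleftrightarrow> p = p' \<and> k = k'" for k k' M p p' :: nat
proof -
  assume k: "k < M" "k' < M"
  have "(p * M + k) div M = p" "(p' * M + k') div M = p'" using k by (auto simp: div_mult_self3)
  then show ?thesis by auto
qed

lemma digits_mem:
  fixes M k l p q :: nat
  assumes "k < M" "l < M"
  shows "(p * M + k, q * M + l) \<in>
            {(p * M + k, q * M + l) | p q k l. (p, q) \<in> S \<and> k < M \<and> l < M \<and> k \<noteq> l} \<longleftrightarrow>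
          (p, q) \<in> S \<and> k \<noteq> l" (is ?A)
    and "(p * M + k, q * M + l) \<in> {(p * M + k, q * M + k) | p q k. (p, q) \<in> S \<and> k < M} \<longleftrightarrow>
          (p, q) \<in> S \<and> k = l" (is ?B)
proof -
  have eq: "p = p' \<and> k = k' \<and> q = q' \<and> l = l'"
    if "k' < M" "l' < M" "p * M + k = p' * M + k'" "q * M + l = q' * M + l'" for p' k' q' l'
    using digits_unique[of k M k' p p'] digits_unique[of l M l' q q'] assms that by blast
  show ?A using eq assms unfolding mem_Collect_eq Pair_inject by blast
  show ?B using eq assms unfolding mem_Collect_eq Pair_inject by blast
qed

lemma block_less: "block n x < 2 ^ n"
  by (simp add: block_def)

lemma uncolored_iff:
  assumes x: "x \<in> {0..1}" and y: "y \<in> {0..1}"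
  shows "(cell_index (grid n) x, cell_index (grid n) y) \<in> uncolored n \<longleftrightarrow>
           (\<forall>m\<in>{1..n}. block m x \<noteq> block m y)"
proof (induction n)
  case 0
  then show ?case by (simp add: cell_index_def)
next
  case (Suc n)
  have "(cell_index (grid (Suc n)) x, cell_index (grid (Suc n)) y) \<in> uncolored (Suc n) \<longleftrightarrow>
          (cell_index (grid n) x, cell_index (grid n) y) \<in> uncolored n \<and>
          block (Suc n) x \<noteq> block (Suc n) y"
    unfolding cell_index_grid_Suc[OF x] cell_index_grid_Suc[OF y] uncolored.simps
    by (rule digits_mem(1)[OF block_less block_less])
  moreover have "{1..Suc n} = insert (Suc n) {1..n}" by auto
  ultimately show ?case using Suc.IH by (simp only: ball_simps) blast
qed

lemma blackened_Suc_iff: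
  assumes x: "x \<in> {0..1}" and y: "y \<in> {0..1}"
  shows "(cell_index (grid (Suc n)) x, cell_index (grid (Suc n)) y) \<in> blackened (Suc n) \<longleftrightarrow>
           (\<forall>m\<in>{1..n}. block m x \<noteq> block m y) \<and> block (Suc n) x = block (Suc n) y"
  unfolding uncolored_iff[OF x y, symmetric]
    cell_index_grid_Suc[OF x] cell_index_grid_Suc[OF y] blackened.simps
  by (rule digits_mem(2)[OF block_less block_less])

lemma digits_less: "p * M + k < g * M" if "p < g" "k < M" for p k g M :: nat
proof -
  have "p * M + k < Suc p * M" using that by simp
  also have "\<dots> \<le> g * M" using that by (intro mult_le_mono1) simp
  finally show ?thesis .
qed

lemma uncolored_less: "(p, q) \<in> uncolored n \<Longrightarrow> p < grid n \<and> q < grid n"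
  by (induction n arbitrary: p q) (auto simp del: power_Suc simp: digits_less)

lemma blackened_less: "(p, q) \<in> blackened n \<Longrightarrow> p < grid n \<and> q < grid n"
  using uncolored_less by (cases n) (auto simp del: power_Suc simp: digits_less)

lemma G_eq_1_iff:
  assumes x: "x \<in> {0..1}" and y: "y \<in> {0..1}"
  shows "G (x, y) = 1 \<longleftrightarrow> (\<exists>n\<ge>1. block n x = block n y)"
proof -
  have "G (x, y) = 1 \<longleftrightarrow> (\<exists>n. \<exists>(p, q)\<in>blackened n. x \<in> cell (grid n) p \<and> y \<in> cell (grid n) q)"
    by (auto simp: G_def black_region_def indicator_def)
  also have "\<dots> \<longleftrightarrow> (\<exists>n. (cell_index (grid n) x, cell_index (grid n) y) \<in> blackened n)"
    proof (intro ex_cong1)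
    fix n
    have "(p, q) \<in> blackened n \<and> x \<in> cell (grid n) p \<and> y \<in> cell (grid n) q \<longleftrightarrow>
        (p, q) \<in> blackened n \<and> cell_index (grid n) x = p \<and> cell_index (grid n) y = q" for p q
      using blackened_less[of p q n] mem_cell_iff[OF x, of p "grid n"]
        mem_cell_iff[OF y, of q "grid n"] by blast
    then show "(\<exists>(p, q)\<in>blackened n. x \<in> cell (grid n) p \<and> y \<in> cell (grid n) q) \<longleftrightarrow>
        (cell_index (grid n) x, cell_index (grid n) y) \<in> blackened n"
      unfolding Bex_def case_prod_beta split_paired_Ex fst_conv snd_conv by simp
  qed
  also have "\<dots> \<longleftrightarrow> (\<exists>n. (cell_index (grid (Suc n)) x, cell_index (grid (Suc n)) y) \<in> blackened (Suc n))"
    by (metis blackened.simps(1) empty_iff not0_implies_Suc)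
  also have "\<dots> \<longleftrightarrow> (\<exists>n\<ge>1. block n x = block n y)"
  proof
    assume "\<exists>n\<ge>1. block n x = block n y"
    define n where "n = (LEAST n. 1 \<le> n \<and> block n x = block n y)"
    have n: "1 \<le> n \<and> block n x = block n y"
      unfolding n_def using \<open>\<exists>n\<ge>1. block n x = block n y\<close> by (rule LeastI_ex)
    moreover have "block m x \<noteq> block m y" if "1 \<le> m" "m < n" for m
      using that not_less_Least[of m "\<lambda>n. 1 \<le> n \<and> block n x = block n y"] by (auto simp: n_def)
    ultimately show "\<exists>n. (cell_index (grid (Suc n)) x, cell_index (grid (Suc n)) y) \<in> blackened (Suc n)"
      unfolding blackened_Suc_iff[OF x y] by (intro exI[of _ "n - 1"]) auto
  next
    assume "\<exists>n. (cell_index (grid (Suc n)) x, cell_index (grid (Suc n)) y) \<in> blackened (Suc n)"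
    then show "\<exists>n\<ge>1. block n x = block n y"
      unfolding blackened_Suc_iff[OF x y] by (metis le_add1 plus_1_eq_Suc)
  qed
  finally show ?thesis .
qed

end

theory Submission
  imports Defs "HOL-Probability.Probability"
begin

text \<open>If \<open>H\<close> is continuous on a conull set \<open>X\<close>, a pair \<open>(x, y) \<in> X\<close> with \<open>H (x, y) < c\<close> provides
  a \<open>T\<close>-open neighbourhood of \<open>y\<close> that contains no \<open>y'\<close> with \<open>(x, y') \<in> X\<close> and \<open>H (x, y') > c\<close>.
  It therefore suffices to find points \<open>x t, y t\<close> (\<open>0 \<le> t < 1\<close>), with \<open>y\<close> a Borel function, such
  that all pairs \<open>(x t, y t')\<close> lie in \<open>X\<close> and \<open>H < c\<close> holds on the diagonal \<open>t = t'\<close> while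
  \<open>H > c\<close> holds off it: the family \<open>y\<close> is then discrete in \<open>T\<close>, so every subset \<open>V\<close> of the unit
  interval is the preimage under \<open>y\<close> of an open, hence Borel, set, whereas some \<open>V\<close> is not measurable.

  The points are the limits along the branches of a binary tree. At every level finitely many
  points are chosen at random so that, with positive probability, each pair is well inside a
  compact subset of the prescribed region. The two children of a node must be black crosswise
  although their surroundings are almost white; this is possible because the black
  set contains, in every rectangle of positive measure, a subset with nearly uniform marginals
  (agreement in the \<open>n\<close>th block, for a suitable \<open>n\<close>). That property is robust enough to pass
  from the pullbacks of \<open>G\<close> to their limit \<open>H\<close> in the cut norm, so that no representation of \<open>H\<close>
  as a pullback is needed.\<close>

section \<open>Recursive functions and the code of the stages\<close>

text \<open>Near a white density point black may have tiny relative measure, so independent uniform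
  points would not be black crosswise with any useful probability. Each new point is therefore drawn
  from the uniform distribution on a black set \<open>E\<close> whose measure is not controlled; the
  estimates for all other pairs use only that its marginals are dominated by a multiple of Lebesgue
  measure. This is why the constant in \<open>spreading\<close> must be the same for all rectangles.
  The cut norm controls integrals over rectangles only. This suffices because the useful part of
  \<open>agree n\<close> is a union of at most \<open>2 ^ n\<close> rectangles, and \<open>n\<close>
  is bounded by a number \<open>N\<close> that depends on the measures of the two sides alone; so
  the accuracy \<open>\<delta>\<close> can be fixed before the pullback is known. As
  \<open>H\<close> is only close to pullbacks of \<open>G\<close>, black means above 127/128: a
  pullback has integral at most 63/64, which leaves room for a set of positive measure where
  \<open>H\<close> is below the threshold.\<close>

definition rec_fun :: "nat \<Rightarrow> (nat list \<Rightarrow> nat) \<Rightarrow> bool" where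
  "rec_fun n F \<longleftrightarrow> (\<exists>e. \<forall>xs. length xs = n \<longrightarrow> rf_eval e xs (F xs))"

lemma rec_fun_cong:
  assumes "rec_fun n F" "\<And>xs. length xs = n \<Longrightarrow> F xs = K xs"
  shows "rec_fun n K"
proof -
  obtain e where "\<And>xs. length xs = n \<Longrightarrow> rf_eval e xs (F xs)"
    using assms(1) unfolding rec_fun_def by blast
  then show ?thesis unfolding rec_fun_def by (intro exI[of _ e]) (simp add: assms(2))
qed

lemma rec_fun_proj: "i < n \<Longrightarrow> rec_fun n (\<lambda>xs. xs ! i)"
  unfolding rec_fun_def by (intro exI[of _ "Proj_rf i"]) (auto intro: rf_eval.intros)

lemma rec_fun_comp:
  assumes "rec_fun (length Gs) F" "\<And>G. G \<in> set Gs \<Longrightarrow> rec_fun n G"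
  shows "rec_fun n (\<lambda>xs. F (map (\<lambda>G. G xs) Gs))"
proof -
  obtain e where e: "\<And>xs. length xs = length Gs \<Longrightarrow> rf_eval e xs (F xs)"
    using assms(1) unfolding rec_fun_def by blast
  have "\<forall>G\<in>set Gs. \<exists>e. \<forall>xs. length xs = n \<longrightarrow> rf_eval e xs (G xs)"
    using assms(2) unfolding rec_fun_def by blast
  then obtain c where c: "\<And>G xs. G \<in> set Gs \<Longrightarrow> length xs = n \<Longrightarrow> rf_eval (c G) xs (G xs)"
    by metis
  have "rf_eval (Comp_rf e (map c Gs)) xs (F (map (\<lambda>G. G xs) Gs))" if "length xs = n" for xs
  proof (rule rf_eval.intros(4))
    show "list_all2 (\<lambda>g y. rf_eval g xs y) (map c Gs) (map (\<lambda>G. G xs) Gs)"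
      using c that by (auto simp: list_all2_conv_all_nth)
    show "rf_eval e (map (\<lambda>G. G xs) Gs) (F (map (\<lambda>G. G xs) Gs))"
      using e by simp
  qed
  then show ?thesis unfolding rec_fun_def by blast
qed

lemma rec_fun_Suc: "rec_fun n F \<Longrightarrow> rec_fun n (\<lambda>xs. Suc (F xs))"
proof -
  assume F: "rec_fun n F"
  have "rf_eval Succ_rf xs (Suc (hd xs))" if "length xs = 1" for xs
    using that rf_eval.intros(2) by (cases xs) auto
  then have "rec_fun 1 (\<lambda>xs. Suc (hd xs))" unfolding rec_fun_def by blast
  then show ?thesis using rec_fun_comp[of "[F]" "\<lambda>xs. Suc (hd xs)" n] F by simp
qed

lemma rec_fun_const: "rec_fun n (\<lambda>_. c)"
proof (induction c)
  case 0
  show ?case unfolding rec_fun_def by (intro exI[of _ Zero_rf]) (auto intro: rf_eval.intros)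
qed (rule rec_fun_Suc)

text \<open>The step function of a primitive recursion receives counter, accumulator and parameters
  in one list, so functions of the parameters occur there behind \<open>tl (tl ys)\<close>.\<close>

lemma rec_fun_tl_tl: "rec_fun n F \<Longrightarrow> rec_fun (Suc (Suc n)) (\<lambda>ys. F (tl (tl ys)))"
proof -
  assume F: "rec_fun n F"
  let ?Gs = "map (\<lambda>i ys. ys ! (Suc (Suc i))) [0..<n]"
  have "rec_fun (Suc (Suc n)) (\<lambda>ys. F (map (\<lambda>G. G ys) ?Gs))"
    by (rule rec_fun_comp) (use F in \<open>auto intro!: rec_fun_proj\<close>)
  then show ?thesis
  proof (rule rec_fun_cong)
    fix ys :: "nat list" assume "length ys = Suc (Suc n)"
    then have "map (\<lambda>G. G ys) ?Gs = tl (tl ys)" by (intro nth_equalityI) (auto simp: nth_tl)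
    then show "F (map (\<lambda>G. G ys) ?Gs) = F (tl (tl ys))" by simp
  qed
qed

lemma rec_fun_prim:
  assumes N: "rec_fun n N" and F: "rec_fun n F"
    and S: "rec_fun (Suc (Suc n)) (\<lambda>ys. S (ys ! 0) (ys ! 1) (tl (tl ys)))"
  shows "rec_fun n (\<lambda>xs. rec_nat (F xs) (\<lambda>i acc. S i acc xs) (N xs))"
proof -
  obtain f where f: "\<And>xs. length xs = n \<Longrightarrow> rf_eval f xs (F xs)"
    using F unfolding rec_fun_def by blast
  obtain s where s: "\<And>xs. length xs = Suc (Suc n) \<Longrightarrow> rf_eval s xs (S (xs ! 0) (xs ! 1) (tl (tl xs)))"
    using S unfolding rec_fun_def by blast
  have "rf_eval (Prim_rf f s) (m # xs) (rec_nat (F xs) (\<lambda>i acc. S i acc xs) m)"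
    if "length xs = n" for m xs
  proof (induction m)
    case 0
    show ?case using f that by (auto intro: rf_eval.intros)
  next
    case (Suc m)
    then show ?case using s[of "m # rec_nat (F xs) (\<lambda>i acc. S i acc xs) m # xs"] that
      by (auto intro: rf_eval.intros)
  qed
  then have "rf_eval (Prim_rf f s) zs (rec_nat (F (tl zs)) (\<lambda>i acc. S i acc (tl zs)) (hd zs))"
    if "length zs = Suc n" for zs
    using that by (cases zs) auto
  then have 1: "rec_fun (Suc n) (\<lambda>zs. rec_nat (F (tl zs)) (\<lambda>i acc. S i acc (tl zs)) (hd zs))"
    unfolding rec_fun_def by blast
  \<comment> \<open>\<open>Prim_rf\<close> recurses on the head of its argument list; composing with
    \<open>N\<close> and all projections puts the computed bound there, followed by the
    parameters.\<close>
  let ?Gs = "N # map (\<lambda>i xs. xs ! i) [0..<n]"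
  let ?R = "\<lambda>zs. rec_nat (F (tl zs)) (\<lambda>i acc. S i acc (tl zs)) (hd zs)"
  have "rec_fun n (\<lambda>xs. ?R (map (\<lambda>G. G xs) ?Gs))"
    by (rule rec_fun_comp) (use 1 N in \<open>auto intro!: rec_fun_proj\<close>)
  then show ?thesis
  proof (rule rec_fun_cong)
    fix xs :: "nat list" assume "length xs = n"
    then have "map (\<lambda>G. G xs) ?Gs = N xs # xs" by (auto intro: nth_equalityI)
    then show "?R (map (\<lambda>G. G xs) ?Gs) = rec_nat (F xs) (\<lambda>i acc. S i acc xs) (N xs)" by simp
  qed
qed

lemma rec_fun_add:
  assumes F: "rec_fun n F" and K: "rec_fun n K"
  shows "rec_fun n (\<lambda>xs. F xs + K xs)"
proof -
  have eq: "rec_nat a (\<lambda>i. Suc) b = a + b" for a b by (induction b) auto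
  have "rec_fun n (\<lambda>xs. rec_nat (F xs) (\<lambda>i acc. Suc acc) (K xs))"
    by (intro rec_fun_prim rec_fun_Suc rec_fun_proj F K; simp)
  then show ?thesis unfolding eq .
qed

lemma rec_fun_mult:
  assumes F: "rec_fun n F" and K: "rec_fun n K"
  shows "rec_fun n (\<lambda>xs. F xs * K xs)"
proof -
  have eq: "rec_nat 0 (\<lambda>i acc. acc + a) b = a * b" for a b :: nat by (induction b) auto
  have "rec_fun n (\<lambda>xs. rec_nat 0 (\<lambda>i acc. acc + F xs) (K xs))"
    by (intro rec_fun_prim rec_fun_add rec_fun_const rec_fun_tl_tl rec_fun_proj F K; simp)
  then show ?thesis unfolding eq .
qed

lemma rec_fun_diff:
  assumes F: "rec_fun n F" and K: "rec_fun n K"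
  shows "rec_fun n (\<lambda>xs. F xs - K xs)"
proof -
  \<comment> \<open>A recursion that returns its counter is the predecessor function; iterating it
    gives truncated subtraction.\<close>
  have "rec_nat 0 (\<lambda>i _. i) m = m - 1" for m :: nat by (cases m) auto
  then have eq: "rec_nat a (\<lambda>_ acc. rec_nat 0 (\<lambda>i _. i) acc) b = a - b" for a b :: nat
    by (induction b) auto
  have "rec_fun n (\<lambda>xs. rec_nat (F xs) (\<lambda>_ acc. rec_nat 0 (\<lambda>i _. i) acc) (K xs))"
    by (intro rec_fun_prim rec_fun_const rec_fun_proj F K; simp)
  then show ?thesis unfolding eq .
qed

lemma rec_fun_le:
  assumes F: "rec_fun n F" and K: "rec_fun n K"
  shows "rec_fun n (\<lambda>xs. of_bool (F xs \<le> K xs))"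
proof -
  have eq: "1 - (a - b) = of_bool (a \<le> b)" for a b :: nat by auto
  have "rec_fun n (\<lambda>xs. 1 - (F xs - K xs))"
    by (intro rec_fun_diff rec_fun_const F K; simp)
  then show ?thesis unfolding eq .
qed

lemma rec_fun_eq:
  assumes F: "rec_fun n F" and K: "rec_fun n K"
  shows "rec_fun n (\<lambda>xs. of_bool (F xs = K xs))"
proof -
  have eq: "of_bool (a \<le> b) * of_bool (b \<le> a) = (of_bool (a = b) :: nat)" for a b :: nat by auto
  have "rec_fun n (\<lambda>xs. of_bool (F xs \<le> K xs) * of_bool (K xs \<le> F xs))"
    by (intro rec_fun_mult rec_fun_le F K; simp)
  then show ?thesis unfolding eq .
qed

lemma rec_fun_div:
  assumes F: "rec_fun n F" and K: "rec_fun n K"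
  shows "rec_fun n (\<lambda>xs. F xs div K xs)"
proof -
  \<comment> \<open>The quotient counts the positive multiples of \<open>b\<close> up to
    \<open>a\<close>. The factor testing \<open>1 \<le> b\<close> makes the count zero for
    \<open>b = 0\<close>, in accordance with \<open>a div 0 = 0\<close>.\<close>
  have "rec_nat 0 (\<lambda>i acc. acc + of_bool (1 \<le> b) * of_bool (Suc i * b \<le> a)) m = min m (a div b)"
    for a b m :: nat
  proof (induction m)
    case (Suc m)
    have "Suc m * b \<le> a \<longleftrightarrow> Suc m \<le> a div b" if "1 \<le> b"
      using that by (simp add: less_eq_div_iff_mult_less_eq del: mult_Suc)
    with Suc show ?case by (cases "b = 0") (auto simp: min_def simp del: mult_Suc)
  qed simp
  then have eq: "rec_nat 0 (\<lambda>i acc. acc + of_bool (1 \<le> b) * of_bool (Suc i * b \<le> a)) a = a div b"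
    for a b :: nat by (simp add: min_absorb2)
  have "rec_fun n (\<lambda>xs. rec_nat 0 (\<lambda>i acc. acc + of_bool (1 \<le> K xs) * of_bool (Suc i * K xs \<le> F xs)) (F xs))"
    by (intro rec_fun_prim rec_fun_add rec_fun_mult rec_fun_le rec_fun_const rec_fun_Suc rec_fun_tl_tl
        rec_fun_proj F K; simp)
  then show ?thesis unfolding eq .
qed

lemma rec_fun_mod:
  assumes F: "rec_fun n F" and K: "rec_fun n K"
  shows "rec_fun n (\<lambda>xs. F xs mod K xs)"
proof -

  have "rec_fun n (\<lambda>xs. F xs - K xs * (F xs div K xs))"
    by (intro rec_fun_mult rec_fun_diff rec_fun_div F K; simp)
  then show ?thesis unfolding minus_mult_div_eq_mod .
qed

lemma rec_fun_power2:
  assumes F: "rec_fun n F"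
  shows "rec_fun n (\<lambda>xs. 2 ^ F xs)"
proof -
  have eq: "rec_nat 1 (\<lambda>i acc. acc * 2) m = (2::nat) ^ m" for m :: nat by (induction m) auto
  have "rec_fun n (\<lambda>xs. rec_nat 1 (\<lambda>i acc. acc * 2) (F xs))"
    by (intro rec_fun_prim rec_fun_mult rec_fun_const rec_fun_proj F; simp)
  then show ?thesis unfolding eq .
qed

lemma rec_fun_grid:
  assumes F: "rec_fun n F"
  shows "rec_fun n (\<lambda>xs. grid (F xs))"
proof -
  have eq: "rec_nat 1 (\<lambda>i acc. acc * 2 ^ Suc i) m = grid m" for m by (induction m) auto
  have "rec_fun n (\<lambda>xs. rec_nat 1 (\<lambda>i acc. acc * 2 ^ Suc i) (F xs))"
    by (intro rec_fun_prim rec_fun_mult rec_fun_power2 rec_fun_Suc rec_fun_const rec_fun_proj F; simp)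
  then show ?thesis unfolding eq .
qed

lemma rec_fun_prod_encode:
  "rec_fun n F \<Longrightarrow> rec_fun n K \<Longrightarrow> rec_fun n (\<lambda>xs. prod_encode (F xs, K xs))"
  unfolding prod_encode_def triangle_def prod.case
  by (intro rec_fun_add rec_fun_div rec_fun_mult rec_fun_Suc rec_fun_const)

lemmas rec_fun_intros = rec_fun_add rec_fun_mult rec_fun_diff rec_fun_le rec_fun_eq rec_fun_div
  rec_fun_mod rec_fun_power2 rec_fun_grid rec_fun_prod_encode rec_fun_const rec_fun_Suc

lemma rec_fun_list_encode:
  assumes N: "rec_fun n N"
    and f: "rec_fun (Suc (Suc n)) (\<lambda>ys. f (tl (tl ys)) (N (tl (tl ys)) - Suc (ys ! 0)))"
  shows "rec_fun n (\<lambda>xs. list_encode (map (f xs) [0..<N xs]))"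
proof -
  \<comment> \<open>A list code grows from the last entry backwards, so the step with counter
    \<open>i\<close> prepends the entry with index \<open>N xs - Suc i\<close>.\<close>
  have 1: "rec_nat 0 (\<lambda>i acc. Suc (prod_encode (f xs (N xs - Suc i), acc))) m =
      list_encode (map (f xs) [N xs - m..<N xs])" if "m \<le> N xs" for m xs
    using that
  proof (induction m)
    case (Suc m)
    then have "[N xs - Suc m..<N xs] = (N xs - Suc m) # [N xs - m..<N xs]"
      by (subst upt_conv_Cons) (auto simp: Suc_diff_Suc)
    with Suc show ?case by simp
  qed simp
  have eq: "rec_nat 0 (\<lambda>i acc. Suc (prod_encode (f xs (N xs - Suc i), acc))) (N xs) =
      list_encode (map (f xs) [0..<N xs])" for xs
    using 1[of "N xs" xs] by simp
  have "rec_fun n (\<lambda>xs. rec_nat 0 (\<lambda>i acc. Suc (prod_encode (f xs (N xs - Suc i), acc))) (N xs))"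
    by (intro rec_fun_prim rec_fun_Suc rec_fun_prod_encode rec_fun_const rec_fun_proj N f) simp
  then show ?thesis unfolding eq .
qed

text \<open>Reads the \<open>m\<close>th block off a cell index of stage \<open>j\<close>: the
  division discards the blocks after it, the remainder those before it.\<close>

definition grid_block :: "nat \<Rightarrow> nat \<Rightarrow> nat \<Rightarrow> nat" where
  "grid_block j m p = p div (grid j div grid m) mod 2 ^ m"

text \<open>A count takes the place of a bounded existential quantifier, because a sum is directly
  primitive recursive; \<open>stage_entry\<close> compares it with 1.\<close>

definition agreements :: "nat \<Rightarrow> nat \<Rightarrow> nat \<Rightarrow> nat" where
  "agreements j p q = rec_nat 0 (\<lambda>i acc. acc + of_bool (grid_block j (Suc i) p = grid_block j (Suc i) q)) j"

text \<open>The constant \<open>(2, 2)\<close> encodes the rational number \<open>1 / 1\<close>.\<close>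

definition stage_entry :: "nat \<Rightarrow> nat \<Rightarrow> nat" where
  "stage_entry j i = of_bool (1 \<le> agreements j (i div grid j) (i mod grid j)) * prod_encode (2, 2)"

text \<open>The approximation of \<open>G\<close> by what is black after stage \<open>j\<close>. The
  first component is \<open>grid j - 1\<close> because \<open>step_enum\<close> adds one to
  it.\<close>

definition stage_code :: "nat \<Rightarrow> nat" where
  "stage_code j =
     prod_encode (grid j - 1, list_encode (map (stage_entry j) [0..<grid j * grid j]))"

lemma rec_fun_agreements:
  assumes "rec_fun n J" "rec_fun n P" "rec_fun n Q"
  shows "rec_fun n (\<lambda>xs. agreements (J xs) (P xs) (Q xs))"
  unfolding agreements_def grid_block_def
  by (rule rec_fun_prim; (intro rec_fun_intros rec_fun_proj assms
      rec_fun_tl_tl[OF assms(1)] rec_fun_tl_tl[OF assms(2)] rec_fun_tl_tl[OF assms(3)])?; simp)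

lemma computable_stage_code: "computable stage_code"
proof -
  have j: "rec_fun 1 (\<lambda>xs. xs ! 0)" by (rule rec_fun_proj) simp
  have "rec_fun 1 (\<lambda>xs. list_encode (map (stage_entry (xs ! 0)) [0..<grid (xs ! 0) * grid (xs ! 0)]))"
    unfolding stage_entry_def
    by (rule rec_fun_list_encode; (intro rec_fun_intros rec_fun_agreements rec_fun_proj
          rec_fun_tl_tl[OF j] j)?; simp)
  then have "rec_fun 1 (\<lambda>xs. stage_code (xs ! 0))"
    unfolding stage_code_def by (intro rec_fun_intros j)
  then obtain e where "\<And>xs. length xs = 1 \<Longrightarrow> rf_eval e xs (stage_code (xs ! 0))"
    unfolding rec_fun_def by blast
  from this[of "[n]" for n] show ?thesis unfolding computable_def by auto
qed

section \<open>Block systems\<close>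

lemma emeasure_lebesgue_borel: "A \<in> sets borel \<Longrightarrow> emeasure lebesgue A = emeasure lborel A"
  using emeasure_completion[of A lborel] main_part_sets[of A lborel]
  by (simp del: emeasure_completion)

text \<open>Products of Lebesgue sets are handled by enclosing each factor between Borel sets with
  null difference, for which the product formula of \<open>lborel\<close> is available.\<close>

lemma lebesgue_borel_sandwich:
  fixes S :: "'a::euclidean_space set"
  assumes "S \<in> sets lebesgue"
  obtains A B where "A \<in> sets borel" "B \<in> sets borel" "A \<subseteq> S" "S \<subseteq> B"
    "emeasure lborel A = emeasure lebesgue S" "emeasure lborel B = emeasure lebesgue S"
    "emeasure lborel (B - A) = 0"
proof -
  obtain A N N' where S: "S = A \<union> N" "N \<subseteq> N'" "N' \<in> null_sets lborel" "A \<in> sets lborel"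
    using assms by (auto elim: sets_completionE)
  have e: "emeasure lborel (A \<union> N') = emeasure lborel A"
    using S by (simp add: emeasure_Un_null_set)
  have m: "A \<in> sets lborel" "A \<union> N' \<in> sets lborel" using S by auto
  have "emeasure lebesgue A \<le> emeasure lebesgue S" using S assms by (intro emeasure_mono) blast+
  moreover have "emeasure lebesgue S \<le> emeasure lebesgue (A \<union> N')"
    using S m by (intro emeasure_mono sets_completionI_sets) blast+
  moreover have "emeasure lebesgue A = emeasure lborel A"
    "emeasure lebesgue (A \<union> N') = emeasure lborel A"
    using m e by (simp_all add: emeasure_lebesgue_borel del: emeasure_completion)
  ultimately have s: "emeasure lebesgue S = emeasure lborel A" by (metis antisym)
  have "emeasure lborel (A \<union> N' - A) \<le> emeasure lborel N'"
    using S by (intro emeasure_mono) auto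
  then have "emeasure lborel (A \<union> N' - A) = 0" using S by auto
  moreover have "A \<subseteq> S" "S \<subseteq> A \<union> N'" "A \<in> sets borel" "A \<union> N' \<in> sets borel"
    using S m by auto
  ultimately show ?thesis using that[of A "A \<union> N'"] e s by simp
qed

lemma emeasure_lborel_Times:
  fixes A B :: "real set"
  assumes "A \<in> sets borel" "B \<in> sets borel"
  shows "emeasure lborel (A \<times> B) = emeasure lborel A * emeasure lborel B"
  using lborel.emeasure_pair_measure_Times[of A lborel B] assms by (simp add: lborel_prod)

lemma lebesgue_Times:
  fixes S T :: "real set"
  assumes S: "S \<in> sets lebesgue" and T: "T \<in> sets lebesgue"
  shows "S \<times> T \<in> sets lebesgue"
    and "emeasure lebesgue (S \<times> T) = emeasure lebesgue S * emeasure lebesgue T"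
proof -
  obtain A A' where A: "A \<in> sets borel" "A' \<in> sets borel" "A \<subseteq> S" "S \<subseteq> A'"
    "emeasure lborel A = emeasure lebesgue S" "emeasure lborel A' = emeasure lebesgue S"
    "emeasure lborel (A' - A) = 0"
    using lebesgue_borel_sandwich[OF S] .
  obtain B B' where B: "B \<in> sets borel" "B' \<in> sets borel" "B \<subseteq> T" "T \<subseteq> B'"
    "emeasure lborel B = emeasure lebesgue T" "emeasure lborel B' = emeasure lebesgue T"
    "emeasure lborel (B' - B) = 0"
    using lebesgue_borel_sandwich[OF T] .
  \<comment> \<open>What \<open>S \<times> T\<close> has outside \<open>A \<times> B\<close> lies in
    two strips over null sets. The strips are unbounded, but their measure is zero times infinity,
    which is zero.\<close>
  let ?N = "(A' - A) \<times> UNIV \<union> UNIV \<times> (B' - B)"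
  have "(A' - A) \<times> (UNIV :: real set) \<in> null_sets lborel" "(UNIV :: real set) \<times> (B' - B) \<in> null_sets lborel"
    using A B emeasure_lborel_Times[of "A' - A" UNIV] emeasure_lborel_Times[of UNIV "B' - B"]
    by (auto intro!: null_setsI simp: borel_Times)
  then have N: "?N \<in> null_sets lborel" by (rule null_sets.Un)
  have "S \<times> T - A \<times> B \<subseteq> ?N" using A B by auto
  then have "S \<times> T - A \<times> B \<in> null_sets lebesgue"
    using N by (intro null_sets_completion_subset[OF _ null_sets_completionI])
  moreover have "A \<times> B \<in> sets lebesgue" using A B by (simp add: borel_Times)
  ultimately have "A \<times> B \<union> (S \<times> T - A \<times> B) \<in> sets lebesgue" by blast
  moreover have "A \<times> B \<union> (S \<times> T - A \<times> B) = S \<times> T" using A B by auto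
  ultimately show 1: "S \<times> T \<in> sets lebesgue" by simp
  have AB: "A \<times> B \<in> sets borel" "A' \<times> B' \<in> sets borel"
    using A B by (simp_all add: borel_Times)
  have "emeasure lebesgue (A \<times> B) \<le> emeasure lebesgue (S \<times> T)"
    using A B by (intro emeasure_mono 1 Sigma_mono)
  moreover have "emeasure lebesgue (S \<times> T) \<le> emeasure lebesgue (A' \<times> B')"
    using A B AB by (intro emeasure_mono Sigma_mono sets_completionI_sets) simp_all
  ultimately show "emeasure lebesgue (S \<times> T) = emeasure lebesgue S * emeasure lebesgue T"
    unfolding emeasure_lebesgue_borel[OF AB(1)] emeasure_lebesgue_borel[OF AB(2)]
      emeasure_lborel_Times[OF A(1) B(1)] emeasure_lborel_Times[OF A(2) B(2)] A B by (rule antisym[rotated])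
qed

lemma measure_lebesgue_Times:
  fixes S T :: "real set"
  assumes S: "S \<in> sets lebesgue" and T: "T \<in> sets lebesgue"
  shows "measure lebesgue (S \<times> T) = measure lebesgue S * measure lebesgue T"
  using lebesgue_Times(2)[OF assms] by (simp add: measure_def enn2real_mult)

lemma fmeasurable_subset_unit:
  "S \<in> sets lebesgue \<Longrightarrow> S \<subseteq> {0..1::real} \<Longrightarrow> S \<in> lmeasurable"
  by (rule fmeasurableI2[of "{0..1}"]) auto

lemma unit_square_lmeasurable: "unit_square \<in> lmeasurable" 
  "measure lebesgue unit_square = 1"
proof -
  show "measure lebesgue unit_square = 1" by (subst measure_lebesgue_Times) auto
  show "unit_square \<in> lmeasurable"
    using lebesgue_Times[of "{0..1}" "{0..1}"] by (auto simp: fmeasurable_def)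
qed

lemma fmeasurable_subset_unit_square:
  "S \<in> sets lebesgue \<Longrightarrow> S \<subseteq> unit_square \<Longrightarrow> S \<in> lmeasurable"
  by (rule fmeasurableI2[OF unit_square_lmeasurable(1)])

text \<open>Isolates what the argument uses of the digit blocks: each is uniformly distributed and
  any two are independent. Both properties survive composition with a measure-preserving map, so all
  pullbacks of \<open>G\<close> are treated at once.\<close>

locale block_system =
  fixes \<beta> :: "nat \<Rightarrow> real \<Rightarrow> nat"
  assumes less: "x \<in> {0..1} \<Longrightarrow> \<beta> n x < 2 ^ n"
    and sets: "{x \<in> {0..1}. \<beta> n x = c} \<in> sets lebesgue"
    and measure_part: "c < 2 ^ n \<Longrightarrow> measure lebesgue {x \<in> {0..1}. \<beta> n x = c} = 1 / 2 ^ n"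
    and measure_Int: "m \<noteq> n \<Longrightarrow> c < 2 ^ m \<Longrightarrow> d < 2 ^ n \<Longrightarrow>
      measure lebesgue ({x \<in> {0..1}. \<beta> m x = c} \<inter> {x \<in> {0..1}. \<beta> n x = d}) = 1 / 2 ^ m * (1 / 2 ^ n)"
begin

definition part :: "nat \<Rightarrow> nat \<Rightarrow> real set" where
  "part n c = {x \<in> {0..1}. \<beta> n x = c}"

definition agree :: "nat \<Rightarrow> (real \<times> real) set" where
  "agree n = {z \<in> unit_square. \<beta> n (fst z) = \<beta> n (snd z)}"

lemma part_sets [measurable, simp]: "part n c \<in> sets lebesgue"
  unfolding part_def by (rule sets)

lemma measure_part_eq: "c < 2 ^ n \<Longrightarrow> measure lebesgue (part n c) = 1 / 2 ^ n"
  unfolding part_def by (rule measure_part)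

lemma measure_part_Int: "m \<noteq> n \<Longrightarrow> c < 2 ^ m \<Longrightarrow> d < 2 ^ n \<Longrightarrow>
    measure lebesgue (part m c \<inter> part n d) = 1 / 2 ^ m * (1 / 2 ^ n)"
  unfolding part_def by (rule measure_Int)

lemma part_subset: "part n c \<subseteq> {0..1}"
  by (auto simp: part_def)

lemma part_disjoint: "c \<noteq> d \<Longrightarrow> part n c \<inter> part n d = {}"
  by (auto simp: part_def)

lemma part_UN: "(\<Union>c<2 ^ n. part n c) = {0..1}"
  using less by (auto simp: part_def)

lemma agree_eq: "agree n = (\<Union>c<2 ^ n. part n c \<times> part n c)"
  using less by (auto simp: part_def agree_def)

lemma agree_sets [measurable, simp]: "agree n \<in> sets lebesgue"
  unfolding agree_eq by (intro sets.finite_UN lebesgue_Times part_sets) auto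

lemma agree_lmeasurable: "agree n \<in> lmeasurable"
  by (intro fmeasurable_subset_unit_square agree_sets) (auto simp: agree_def)

lemma measure_agree: "measure lebesgue (agree n) = 1 / 2 ^ n"
proof -
  have "measure lebesgue (agree n) = (\<Sum>c<2 ^ n. measure lebesgue (part n c \<times> part n c))"
    unfolding agree_eq
  proof (rule measure_finite_Union)
    show "disjoint_family_on (\<lambda>c. part n c \<times> part n c) {..<2 ^ n}"
      using part_disjoint by (fastforce simp: disjoint_family_on_def)
    show "emeasure lebesgue (part n c \<times> part n c) \<noteq> \<infinity>" for c
    proof -
      have "part n c \<times> part n c \<in> lmeasurable"
        using part_subset by (intro fmeasurable_subset_unit_square lebesgue_Times) auto
      then show ?thesis by (auto simp: fmeasurable_def)
    qed
  qed (auto intro: lebesgue_Times)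
  also have "\<dots> = (\<Sum>c<(2::nat) ^ n. 1 / 2 ^ n * (1 / 2 ^ n))"
    by (intro sum.cong) (auto simp: measure_lebesgue_Times measure_part_eq)
  finally show ?thesis by simp
qed

text \<open>A geometric series bounds what later blocks can add after stage \<open>j\<close>; it
  serves both the computable name and the estimate of the total black area.\<close>

lemma measure_agree_tail:
  "(\<Union>i. agree (Suc (j + i))) \<in> sets lebesgue"
  "measure lebesgue (\<Union>i. agree (Suc (j + i))) \<le> 1 / 2 ^ j"
proof -
  show s: "(\<Union>i. agree (Suc (j + i))) \<in> sets lebesgue" by auto
  have sums: "(\<lambda>i. 1 / 2 ^ Suc (j + i) :: real) sums (1 / 2 ^ j)"
  proof -
    have "(\<lambda>i. 1 / 2 ^ Suc j * (1 / 2) ^ i :: real) sums (1 / 2 ^ Suc j * (1 / (1 - 1 / 2)))"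
      by (intro sums_mult geometric_sums) auto
    then show ?thesis by (simp add: power_add power_one_over field_simps)
  qed
  have "emeasure lebesgue (\<Union>i. agree (Suc (j + i))) \<le> (\<Sum>i. emeasure lebesgue (agree (Suc (j + i))))"
    by (rule emeasure_subadditive_countably) auto
  also have "\<dots> = (\<Sum>i. ennreal (1 / 2 ^ Suc (j + i)))"
    using agree_lmeasurable measure_agree by (simp add: emeasure_eq_measure2)
  also have "\<dots> = ennreal (1 / 2 ^ j)"
    using sums by (subst suminf_ennreal2) (auto simp: sums_iff)
  finally show "measure lebesgue (\<Union>i. agree (Suc (j + i))) \<le> 1 / 2 ^ j"
    by (simp add: measure_def enn2real_leI)
qed

text \<open>The plain union bound 1/2 + 1/4 + 1/8 + ... only gives 1. The gain comes from the
  overlap of \<open>agree 1\<close> and \<open>agree 2\<close>, which contains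
  \<open>?Q \<times> ?Q\<close> for a set \<open>?Q\<close> of measure 1/8 and so has measure at
  least 1/64.\<close>

lemma measure_agree_Un_less_1: "measure lebesgue (\<Union>n. agree (Suc n)) \<le> 63 / 64"
proof -
  have eq: "(\<Union>n. agree (Suc n)) = (agree 1 \<union> agree 2) \<union> (\<Union>i. agree (Suc (2 + i)))"
  proof (intro equalityI subsetI)
    fix z assume "z \<in> (\<Union>n. agree (Suc n))"
    then obtain n where n: "z \<in> agree (Suc n)" by blast
    consider "n = 0" | "n = 1" | "n \<ge> 2" by linarith
    then show "z \<in> (agree 1 \<union> agree 2) \<union> (\<Union>i. agree (Suc (2 + i)))"
    proof cases
      case 3
      then have "Suc (2 + (n - 2)) = Suc n" by simp
      with n show ?thesis by (metis UN_I UNIV_I UnCI)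
    qed (use n in \<open>auto simp: numeral_2_eq_2\<close>)
  next
    fix z assume z: "z \<in> (agree 1 \<union> agree 2) \<union> (\<Union>i. agree (Suc (2 + i)))"
    have "agree 1 = agree (Suc 0)" "agree 2 = agree (Suc 1)" by (simp_all add: numeral_2_eq_2)
    with z show "z \<in> (\<Union>n. agree (Suc n))" by blast
  qed
  let ?Q = "part 1 0 \<inter> part 2 0"
  have "measure lebesgue ?Q = 1 / 8" using measure_part_Int[of 1 2 0 0] by simp
  then have Q: "measure lebesgue (?Q \<times> ?Q) = 1 / 64"
    by (simp only: measure_lebesgue_Times part_sets sets.Int)
  have "?Q \<times> ?Q \<subseteq> agree 1 \<inter> agree 2" by (auto simp: part_def agree_def)
  then have "1 / 64 \<le> measure lebesgue (agree 1 \<inter> agree 2)"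
    using agree_lmeasurable unfolding Q[symmetric]
    by (intro measure_mono_fmeasurable) (auto intro!: lebesgue_Times)
  then have "measure lebesgue (agree 1 \<union> agree 2) \<le> 3 / 4 - 1 / 64"
    using measure_Un3[OF agree_lmeasurable agree_lmeasurable, of 1 2] measure_agree[of 1] measure_agree[of 2]
    by simp
  moreover have "measure lebesgue (\<Union>n. agree (Suc n)) \<le>
      measure lebesgue (agree 1 \<union> agree 2) + measure lebesgue (\<Union>i. agree (Suc (2 + i)))"
    unfolding eq by (rule measure_Un_le) (auto simp: measure_agree_tail)
  ultimately show ?thesis using measure_agree_tail(2)[of 2] by simp
qed

text \<open>The conditional measure of \<open>S\<close> given the part, whose size is
  \<open>1 / 2 ^ n\<close>, minus its mean.\<close>

definition deviation :: "real set \<Rightarrow> nat \<Rightarrow> nat \<Rightarrow> real" where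
  "deviation S n c = 2 ^ n * measure lebesgue (S \<inter> part n c) - measure lebesgue S"

text \<open>Bessel's inequality: the conditional expectations of the indicator of \<open>S\<close> on the different
  blocks are orthogonal after centring.\<close>

lemma sum_deviation_le:
  assumes S: "S \<in> sets lebesgue" "S \<subseteq> {0..1}"
  shows "(\<Sum>n\<in>{1..N}. (\<Sum>c<2 ^ n. (deviation S n c)\<^sup>2) / 2 ^ n) \<le> measure lebesgue S"
proof -
  let ?M = "lebesgue_on {0..1::real}"
  interpret finite_measure ?M by (rule finite_measure_lebesgue_on) auto
  \<comment> \<open>\<open>h n\<close> is the centred conditional expectation of the indicator of
    \<open>S\<close> given the \<open>n\<close>th block.\<close>
  define h where "h n x = (\<Sum>c<2 ^ n. deviation S n c * indicator (part n c) x)" for n x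
  define f where "f = (indicator S :: real \<Rightarrow> real)"
  have int_ind: "integrable ?M (indicator A :: real \<Rightarrow> real)" 
    and integral_ind: "(\<integral>x. indicator A x \<partial>?M) = measure lebesgue A"
    if "A \<in> sets lebesgue" "A \<subseteq> {0..1}" for A
    using that by (auto simp: sets_restrict_space_iff emeasure_restrict_space measure_restrict_space
      intro!: integrable_real_indicator fmeasurableD2[OF fmeasurable_subset_unit] simp: top.not_eq_extremum[symmetric] Int_absorb1 Int_absorb2)
  \<comment> \<open>The parts partition the interval, so \<open>h n\<close> has mean zero. Together
    with independence this makes \<open>h m\<close> and \<open>h n\<close> orthogonal for
    \<open>m \<noteq> n\<close>.\<close>
  have sumdev: "(\<Sum>c<2 ^ n. deviation S n c) = 0" for n
  proof -
    have "measure lebesgue S = (\<Sum>c<2 ^ n. measure lebesgue (S \<inter> part n c))"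
    proof -
      have "S = (\<Union>c<2 ^ n. S \<inter> part n c)" using S part_UN[of n] by blast
      also have "measure lebesgue \<dots> = (\<Sum>c<2 ^ n. measure lebesgue (S \<inter> part n c))"
      proof (rule measure_finite_Union)
        show "disjoint_family_on (\<lambda>c. S \<inter> part n c) {..<2 ^ n}"
          using part_disjoint by (fastforce simp: disjoint_family_on_def)
        show "emeasure lebesgue (S \<inter> part n c) \<noteq> \<infinity>" for c
          using S by (intro fmeasurableD2[OF fmeasurable_subset_unit, unfolded infinity_ennreal_def[symmetric]]) auto
      qed (use S in auto)
      finally show ?thesis .
    qed
    then show ?thesis by (simp add: deviation_def sum_subtractf sum_distrib_left[symmetric])
  qed
  have fh: "f x * h n x = (\<Sum>c<2 ^ n. deviation S n c * indicator (S \<inter> part n c) x)" for n x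
    unfolding f_def h_def sum_distrib_left by (intro sum.cong refl) (simp add: indicator_def)
  have hh: "h m x * h n x = (\<Sum>c<2 ^ m. \<Sum>d<2 ^ n. deviation S m c * deviation S n d *
      indicator (part m c \<inter> part n d) x)" for m n x
    unfolding h_def sum_product by (intro sum.cong refl) (simp add: indicator_def)
  have part_S: "S \<inter> part n c \<subseteq> {0..1}" "part m d \<inter> part n c \<subseteq> {0..1}" for m n c d
    using part_subset by auto
  have ifh: "integrable ?M (\<lambda>x. f x * h n x)" for n
    unfolding fh using S part_S
    by (intro Bochner_Integration.integrable_sum integrable_mult_right int_ind) auto
  have ihh: "integrable ?M (\<lambda>x. h m x * h n x)" for m n
    unfolding hh using S part_S
    by (intro Bochner_Integration.integrable_sum integrable_mult_right int_ind) auto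
  have ik: "integrable ?M (\<lambda>x. k * indicator A x)"
    and Ik: "(\<integral>x. k * indicator A x \<partial>?M) = k * measure lebesgue A"
    if "A \<in> sets lebesgue" "A \<subseteq> {0..1}" for A and k :: real
    using int_ind[OF that] integral_ind[OF that] by simp_all
  have Spart: "S \<inter> part n c \<in> sets lebesgue" "part m d \<inter> part n c \<in> sets lebesgue" for m n c d
    using S by auto
  note integral_simps = Bochner_Integration.integral_sum Bochner_Integration.integrable_sum ik Ik
    Spart part_S
  define v where "v n = (\<Sum>c<2 ^ n. (deviation S n c)\<^sup>2) / 2 ^ n" for n
  have vfh: "(\<integral>x. f x * h n x \<partial>?M) = v n" for n
  proof -
    have "(\<integral>x. f x * h n x \<partial>?M) = (\<Sum>c<2 ^ n. deviation S n c * measure lebesgue (S \<inter> part n c))"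
      unfolding fh by (simp only: integral_simps)
    \<comment> \<open>Substitutes \<open>(deviation S n c + measure lebesgue S) / 2 ^ n\<close> for
      the measure of the intersection; the constant part then drops out by
      \<open>sumdev\<close>.\<close>
    also have "\<dots> = (\<Sum>c<2 ^ n. (deviation S n c)\<^sup>2 / 2 ^ n + deviation S n c * (measure lebesgue S / 2 ^ n))"
      by (intro sum.cong) (auto simp: deviation_def field_simps power2_eq_square)
    also have "\<dots> = v n"
      unfolding sum.distrib sum_distrib_right[symmetric] sumdev
      by (simp add: v_def sum_divide_distrib)
    finally show ?thesis .
  qed
  have vhh: "(\<integral>x. h m x * h n x \<partial>?M) = (if m = n then v n else 0)" for m n
  proof -
    have "(\<integral>x. h m x * h n x \<partial>?M) = (\<Sum>c<2 ^ m. \<Sum>d<2 ^ n. deviation S m c * deviation S n d *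
      measure lebesgue (part m c \<inter> part n d))"
      unfolding hh by (simp only: integral_simps)
    also have "\<dots> = (if m = n then v n else 0)"
    proof (cases "m = n")
      case True
      have "measure lebesgue (part n c \<inter> part n d) = (if d = c then 1 / 2 ^ n else 0)" if "c < 2 ^ n" for c d
        using measure_part_eq[OF that] part_disjoint[of c d n] by auto
      then have "(\<Sum>c<2 ^ n. \<Sum>d<2 ^ n. deviation S n c * deviation S n d * measure lebesgue (part n c \<inter> part n d))
        = (\<Sum>c<2 ^ n. \<Sum>d<2 ^ n. if d = c then (deviation S n c)\<^sup>2 / 2 ^ n else 0)"
        by (intro sum.cong refl) (auto simp: power2_eq_square)
      then show ?thesis unfolding True by (simp add: v_def sum_divide_distrib)
    next
      case False
      have "(\<Sum>c<2 ^ m. \<Sum>d<2 ^ n. deviation S m c * deviation S n d * measure lebesgue (part m c \<inter> part n d))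
        = (\<Sum>c<2 ^ m. \<Sum>d<2 ^ n. deviation S m c * deviation S n d * (1 / 2 ^ m * (1 / 2 ^ n)))"
        using measure_part_Int[OF False] by (intro sum.cong) auto
      also have "\<dots> = ((\<Sum>c<2 ^ m. deviation S m c) * (\<Sum>d<2 ^ n. deviation S n d)) * (1 / 2 ^ m * (1 / 2 ^ n))"
        by (simp only: sum_product) (simp only: sum_distrib_right)
      finally show ?thesis using False sumdev by simp
    qed
    finally show ?thesis .
  qed
  have ff: "f x * f x = f x" for x by (simp add: f_def indicator_def)
  \<comment> \<open>The squared distance from \<open>f\<close> to the sum of all \<open>h n\<close>
    is nonnegative. The inner product of \<open>h n\<close> with \<open>f\<close> and that with
    itself are both \<open>v n\<close>, so this distance is the measure of \<open>S\<close> minus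
    the sum of the \<open>v n\<close>.\<close>
  have "0 \<le> (\<integral>x. (f x - (\<Sum>n\<in>{1..N}. h n x))\<^sup>2 \<partial>?M)" by simp
  also have "(\<lambda>x. (f x - (\<Sum>n\<in>{1..N}. h n x))\<^sup>2) =
      (\<lambda>x. f x - 2 * (\<Sum>n\<in>{1..N}. f x * h n x) + (\<Sum>m\<in>{1..N}. \<Sum>n\<in>{1..N}. h m x * h n x))"
    by (simp add: power2_eq_square algebra_simps ff sum_product sum_distrib_left fun_eq_iff)
  also have "(\<integral>x. f x - 2 * (\<Sum>n\<in>{1..N}. f x * h n x) + (\<Sum>m\<in>{1..N}. \<Sum>n\<in>{1..N}. h m x * h n x) \<partial>?M) =
     measure lebesgue S - 2 * (\<Sum>n\<in>{1..N}. v n) + (\<Sum>m\<in>{1..N}. \<Sum>n\<in>{1..N}. if m = n then v n else 0)"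
    using int_ind[OF S] integral_ind[OF S] ifh ihh vfh vhh
    by (simp add: f_def[symmetric] Bochner_Integration.integral_sum)
  also have "(\<Sum>m\<in>{1..N}. \<Sum>n\<in>{1..N}. if m = n then v n else 0) = (\<Sum>n\<in>{1..N}. v n)"
    by simp
  finally show ?thesis unfolding v_def by simp
qed

definition balanced :: "real set \<Rightarrow> nat \<Rightarrow> nat \<Rightarrow> bool" where
  "balanced S n c \<longleftrightarrow> \<bar>deviation S n c\<bar> \<le> measure lebesgue S / 2"

text \<open>Chebyshev's inequality: the squared deviation of an unbalanced part exceeds a quarter of
  the squared measure of \<open>S\<close>, four times the permitted average, so at most a quarter of
  the parts can be unbalanced.\<close>

lemma card_unbalanced:
  assumes a: "0 < measure lebesgue S"
    and v: "(\<Sum>c<2 ^ n. (deviation S n c)\<^sup>2) / 2 ^ n \<le> (measure lebesgue S)\<^sup>2 / 16"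
  shows "real (card {c \<in> {..<2 ^ n}. \<not> balanced S n c}) \<le> 2 ^ n / 4"
proof -
  let ?U = "{c \<in> {..<2 ^ n}. \<not> balanced S n c}" and ?a = "measure lebesgue S"
  have "real (card ?U) * (?a / 2)\<^sup>2 = (\<Sum>c\<in>?U. (?a / 2)\<^sup>2)" by simp
  also have "\<dots> \<le> (\<Sum>c\<in>?U. (deviation S n c)\<^sup>2)"
  proof (rule sum_mono)
    fix c assume "c \<in> ?U"
    then have "?a / 2 \<le> \<bar>deviation S n c\<bar>" by (auto simp: balanced_def)
    then show "(?a / 2)\<^sup>2 \<le> (deviation S n c)\<^sup>2" using a abs_le_square_iff[of "?a / 2" "deviation S n c"] by simp
  qed
  also have "\<dots> \<le> (\<Sum>c<2 ^ n. (deviation S n c)\<^sup>2)" by (rule sum_mono2) auto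
  also have "\<dots> \<le> 2 ^ n * (?a\<^sup>2 / 16)" using v by (simp add: field_simps)
  finally have "real (card ?U) * ?a\<^sup>2 \<le> (2 ^ n / 4) * ?a\<^sup>2" by (simp add: power_divide field_simps)
  then show ?thesis using a by simp
qed

text \<open>Pigeonhole over the blocks: normalised by the squared measures, the variances of
  \<open>A\<close> and \<open>B\<close> sum to at most the two reciprocal measures, so one of the
  first \<open>N\<close> blocks has both variances at most 1/16. Each set then spoils at most a
  quarter of the parts. The bound \<open>N\<close> is the same for all block systems, hence for all
  pullbacks.\<close>

lemma exists_balanced:
  assumes A: "A \<in> sets lebesgue" "A \<subseteq> {0..1}" "0 < measure lebesgue A"
    and B: "B \<in> sets lebesgue" "B \<subseteq> {0..1}" "0 < measure lebesgue B"
    and N: "16 * (1 / measure lebesgue A + 1 / measure lebesgue B) \<le> real N"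
  obtains n where "1 \<le> n" "n \<le> N"
    "2 ^ n / 2 \<le> real (card {c \<in> {..<2 ^ n}. balanced A n c \<and> balanced B n c})"
proof -
  let ?a = "measure lebesgue A" and ?b = "measure lebesgue B"
  define v where "v S n = (\<Sum>c<2 ^ n. (deviation S n c)\<^sup>2) / 2 ^ n" for S n
  have "\<exists>n\<in>{1..N}. v A n \<le> ?a\<^sup>2 / 16 \<and> v B n \<le> ?b\<^sup>2 / 16"
  proof (rule ccontr)
    assume neg: "\<not> ?thesis"
    have v0: "0 \<le> v S n" for S n unfolding v_def by (intro divide_nonneg_nonneg sum_nonneg) auto
    have "1 / 16 < v A n / ?a\<^sup>2 + v B n / ?b\<^sup>2" if "n \<in> {1..N}" for n
    proof -
      have "?a\<^sup>2 / 16 < v A n \<or> ?b\<^sup>2 / 16 < v B n" using neg that by force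
      then have "1 / 16 < v A n / ?a\<^sup>2 \<or> 1 / 16 < v B n / ?b\<^sup>2" using A B by (auto simp: field_simps)
      moreover have "0 \<le> v A n / ?a\<^sup>2" "0 \<le> v B n / ?b\<^sup>2" using v0 by auto
      ultimately show ?thesis by linarith
    qed
    moreover have "0 < real N" using N A B by (smt (verit) divide_pos_pos)
    then have "{1..N} \<noteq> {}" by auto
    ultimately have "(\<Sum>n\<in>{1..N}. 1 / 16) < (\<Sum>n\<in>{1..N}. v A n / ?a\<^sup>2 + v B n / ?b\<^sup>2)"
      by (intro sum_strict_mono) auto
    also have "\<dots> = (\<Sum>n\<in>{1..N}. v A n) / ?a\<^sup>2 + (\<Sum>n\<in>{1..N}. v B n) / ?b\<^sup>2"
      by (simp add: sum.distrib sum_divide_distrib)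
    also have "\<dots> \<le> ?a / ?a\<^sup>2 + ?b / ?b\<^sup>2"
      using sum_deviation_le[of A N] sum_deviation_le[of B N] A B unfolding v_def
      by (intro add_mono divide_right_mono) auto
    also have "\<dots> = 1 / ?a + 1 / ?b" using A B by (simp add: power2_eq_square)
    finally show False using N by simp
  qed
  then obtain n where n: "n \<in> {1..N}" "v A n \<le> ?a\<^sup>2 / 16" "v B n \<le> ?b\<^sup>2 / 16" by blast
  let ?g = "{c \<in> {..<2 ^ n}. balanced A n c \<and> balanced B n c}"
  let ?U = "\<lambda>S. {c \<in> {..<2 ^ n}. \<not> balanced S n c}"
  have "(2::nat) ^ n = card {..<2 ^ n :: nat}" by simp
  also have "\<dots> \<le> card (?g \<union> (?U A \<union> ?U B))" by (rule card_mono) auto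
  also have "\<dots> \<le> card ?g + (card (?U A) + card (?U B))"
    by (rule order_trans[OF card_Un_le add_left_mono[OF card_Un_le]])
  finally have "real (2 ^ n) \<le> real (card ?g) + (real (card (?U A)) + real (card (?U B)))"
    by linarith
  moreover have "real (card (?U A)) \<le> 2 ^ n / 4" "real (card (?U B)) \<le> 2 ^ n / 4"
    using card_unbalanced[of A n] card_unbalanced[of B n] A B n unfolding v_def by auto
  ultimately have "2 ^ n / 2 \<le> real (card ?g)" by simp
  then show ?thesis using that n by auto
qed

end

section \<open>Cells, and the digit blocks as a block system\<close>

lemma measure_cell:
  assumes "p < N"
  shows "cell N p \<in> sets lebesgue" "cell N p \<subseteq> {0..1}" "measure lebesgue (cell N p) = 1 / real N"
proof -
  have "real p / N \<le> 1" "real (Suc p) / N \<le> 1" "real p / N \<le> real (Suc p) / N"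
    using assms by (auto intro!: divide_right_mono)
  moreover have "1 - real p / N = 1 / N" if "Suc p = N" using that assms by (auto simp: field_simps)
  moreover have "real (Suc p) / N - real p / N = 1 / N" by (simp add: diff_divide_distrib[symmetric])
  ultimately show "measure lebesgue (cell N p) = 1 / real N"
    by (auto simp: cell_def)
  show "cell N p \<in> sets lebesgue" by (auto simp: cell_def)
  show "cell N p \<subseteq> {0..1}"
  proof
    fix x assume "x \<in> cell N p"
    then have "real p / N \<le> x" "x \<le> 1"
      using \<open>real (Suc p) / N \<le> 1\<close> by (auto simp: cell_def split: if_splits)
    moreover have "0 \<le> real p / N" by simp
    ultimately show "x \<in> {0..1}" by (meson atLeastAtMost_iff order_trans)
  qed
qed

text \<open>Reduces the distribution of the blocks to counting cell indices.\<close>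

lemma cell_index_vimage:
  assumes N: "0 < N"
  shows "{x \<in> {0..1}. Q (cell_index N x)} \<in> sets lebesgue"
    and "measure lebesgue {x \<in> {0..1}. Q (cell_index N x)} = real (card {p. p < N \<and> Q p}) / real N"
proof -
  let ?R = "{p. p < N \<and> Q p}"
  have mem: "x \<in> {0..1} \<Longrightarrow> p < N \<Longrightarrow> x \<in> cell N p \<longleftrightarrow> cell_index N x = p" for x p
    by (rule mem_cell_iff)
  have eq: "{x \<in> {0..1}. Q (cell_index N x)} = (\<Union>p\<in>?R. cell N p)"
  proof (intro equalityI subsetI)
    fix x assume "x \<in> {x \<in> {0..1}. Q (cell_index N x)}"
    then have "x \<in> cell N (cell_index N x)" "cell_index N x \<in> ?R"
      using mem[of x "cell_index N x"] cell_index_less[OF N, of x] by auto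
    then show "x \<in> (\<Union>p\<in>?R. cell N p)" by blast
  next
    fix x assume "x \<in> (\<Union>p\<in>?R. cell N p)"
    then obtain p where p: "p < N" "Q p" "x \<in> cell N p" by blast
    moreover have "x \<in> {0..1}" using measure_cell(2)[OF p(1)] p by blast
    ultimately show "x \<in> {x \<in> {0..1}. Q (cell_index N x)}" using mem[of x p] by blast
  qed
  show "{x \<in> {0..1}. Q (cell_index N x)} \<in> sets lebesgue"
    unfolding eq using measure_cell by (intro sets.finite_UN) auto
  have "measure lebesgue (\<Union>p\<in>?R. cell N p) = (\<Sum>p\<in>?R. measure lebesgue (cell N p))"
  proof (rule measure_finite_Union)
    show "disjoint_family_on (cell N) ?R"
      unfolding disjoint_family_on_def
    proof (intro ballI impI)
      fix p q assume pq: "p \<in> ?R" "q \<in> ?R" "p \<noteq> q"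
      show "cell N p \<inter> cell N q = {}"
      proof (rule ccontr)
        assume "cell N p \<inter> cell N q \<noteq> {}"
        then obtain x where x: "x \<in> cell N p" "x \<in> cell N q" by blast
        then have "x \<in> {0..1}" using measure_cell(2)[of p N] pq by blast
        then show False using mem[of x p] mem[of x q] x pq by auto
      qed
    qed
    show "emeasure lebesgue (cell N p) \<noteq> \<infinity>" if "p \<in> ?R" for p
      using that measure_cell[of p N] by (intro fmeasurableD2[OF fmeasurable_subset_unit, unfolded infinity_ennreal_def[symmetric]]) auto
  qed (use measure_cell in auto)
  then show "measure lebesgue {x \<in> {0..1}. Q (cell_index N x)} = real (card ?R) / real N"
    unfolding eq using measure_cell(3) by simp
qed

text \<open>Prescribing the last digit to base \<open>M\<close> leaves the leading part free below
  \<open>g\<close>. This is the counting form of the independence of a block from the earlier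
  ones.\<close>

lemma card_digits:
  fixes M :: nat
  assumes d: "d < M"
  shows "card {r. r < g * M \<and> Q (r div M) \<and> r mod M = d} = card {q. q < g \<and> Q q}"
proof -
  have "bij_betw (\<lambda>q. q * M + d) {q. q < g \<and> Q q} {r. r < g * M \<and> Q (r div M) \<and> r mod M = d}"
  proof (rule bij_betw_byWitness[where f' = "\<lambda>r. r div M"])
    show "\<forall>r\<in>{r. r < g * M \<and> Q (r div M) \<and> r mod M = d}. r div M * M + d = r"
      by (auto simp: div_mult_mod_eq)
    show "(\<lambda>q. q * M + d) ` {q. q < g \<and> Q q} \<subseteq> {r. r < g * M \<and> Q (r div M) \<and> r mod M = d}"
      using d digits_less by auto
    show "(\<lambda>r. r div M) ` {r. r < g * M \<and> Q (r div M) \<and> r mod M = d} \<subseteq> {q. q < g \<and> Q q}"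
      using d by (auto simp: less_mult_imp_div_less)
  qed (use d in auto)
  then show ?thesis by (simp add: bij_betw_same_card)
qed

lemma grid_dvd: "m \<le> n \<Longrightarrow> grid m dvd grid n"
  by (induction n) (auto simp: le_Suc_eq)

lemma grid_block_cell_index:
  assumes "x \<in> {0..1}" "m \<le> j"
  shows "grid_block j m (cell_index (grid j) x) = block m x"
proof -
  define M where "M = grid j div grid m"
  have M: "grid j = grid m * M" using grid_dvd[OF assms(2)] by (simp add: M_def)
  then have "0 < M" using grid_pos[of j] by (metis bot_nat_0.not_eq_extremum mult_0_right)
  then show ?thesis
    using cell_index_div[OF assms(1) grid_pos[of m], of M] M
    unfolding grid_block_def block_def M_def[symmetric] by simp
qed

text \<open>In a cell index of stage \<open>n\<close>, block \<open>n\<close> is the last digit to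
  base \<open>2 ^ n\<close> and every earlier block is a function of the leading part, so
  \<open>card_digits\<close> yields uniformity as well as independence.\<close>

lemma block_system_block: "block_system block"
proof
  show "block n x < 2 ^ n" for n x by (rule block_less)
  show s: "{x \<in> {0..1}. block n x = c} \<in> sets lebesgue" for n c
    unfolding block_def using cell_index_vimage(1)[OF grid_pos, of "\<lambda>r. r mod 2 ^ n = c"] .
  show m: "measure lebesgue {x \<in> {0..1}. block n x = c} = 1 / 2 ^ n" if c: "c < 2 ^ n" for n c
  proof (cases n)
    case 0
    then have "{x \<in> {0..1}. block n x = c} = {0..1}" using c by (auto simp: block_def)
    then show ?thesis using 0 by simp
  next
    case (Suc k)
    have "card {r. r < grid k * 2 ^ n \<and> True \<and> r mod 2 ^ n = c} = grid k"
      using card_digits[OF c, of "grid k" "\<lambda>_. True"] by simp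
    then have "card {r. r < grid n \<and> r mod 2 ^ n = c} = grid k" by (simp add: Suc)
    then show ?thesis
      unfolding block_def cell_index_vimage(2)[OF grid_pos, of "\<lambda>r. r mod 2 ^ n = c" n]
      using grid_pos[of k] by (simp add: Suc)
  qed
  have less: "measure lebesgue ({x \<in> {0..1}. block m x = c} \<inter> {x \<in> {0..1}. block n x = d}) = 1 / 2 ^ m * (1 / 2 ^ n)"
    if mn: "m < n" and cd: "c < 2 ^ m" "d < 2 ^ n" for m n c d
  proof -
    obtain k where k: "n = Suc k" using mn by (cases n) auto
    let ?Q = "\<lambda>q. grid_block k m q = c"
    have dv: "cell_index (grid n) x div 2 ^ n = cell_index (grid k) x" if "x \<in> {0..1}" for x
      using cell_index_div[OF that grid_pos[of k], of "2 ^ n"] k by simp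
    have bm: "block m x = grid_block k m (cell_index (grid n) x div 2 ^ n)" if "x \<in> {0..1}" for x
      using grid_block_cell_index[OF that, of m k] dv[OF that] mn k by simp
    have "{x \<in> {0..1}. block m x = c} = {x \<in> {0..1}. ?Q (cell_index (grid k) x)}"
      using grid_block_cell_index[of _ m k] mn k by auto
    then have "real (card {q. q < grid k \<and> ?Q q}) / grid k = 1 / 2 ^ m"
      using cell_index_vimage(2)[OF grid_pos, of ?Q k] m[OF cd(1)] by simp
    moreover have "card {r. r < grid n \<and> (?Q (r div 2 ^ n) \<and> r mod 2 ^ n = d)} = card {q. q < grid k \<and> ?Q q}"
      using card_digits[OF cd(2), of "grid k" ?Q] by (simp add: k)
    moreover have "{x \<in> {0..1}. block m x = c} \<inter> {x \<in> {0..1}. block n x = d} =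
        {x \<in> {0..1}. ?Q (cell_index (grid n) x div 2 ^ n) \<and> cell_index (grid n) x mod 2 ^ n = d}"
      using bm by (auto simp: block_def[of n])
    ultimately show ?thesis
      using cell_index_vimage(2)[OF grid_pos, of "\<lambda>r. ?Q (r div 2 ^ n) \<and> r mod 2 ^ n = d" n]
        grid_pos[of k] by (simp add: k divide_divide_eq_left[symmetric] del: divide_divide_eq_left)
  qed
  show "measure lebesgue ({x \<in> {0..1}. block m x = c} \<inter> {x \<in> {0..1}. block n x = d}) = 1 / 2 ^ m * (1 / 2 ^ n)"
    if "m \<noteq> n" "c < 2 ^ m" "d < 2 ^ n" for m n c d
  proof (cases "m < n")
    case False
    then have "n < m" using that by simp
    from less[OF this that(3,2)] show ?thesis
      unfolding Int_commute[of "{x \<in> {0..1}. block m x = c}"] mult.commute[of "1 / 2 ^ m"] .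
  next
    case True
    from less[OF this that(2,3)] show ?thesis .
  qed
qed

section \<open>Pullbacks of \<open>G\<close> along measure-preserving maps\<close>

lemma measure_preserving_vimage:
  assumes phi: "\<phi> \<in> measure_preserving_maps" and S: "S \<in> sets lebesgue" "S \<subseteq> {0..1}"
  shows "{x \<in> {0..1}. \<phi> x \<in> S} \<in> sets lebesgue"
    and "measure lebesgue {x \<in> {0..1}. \<phi> x \<in> S} = measure lebesgue S"
proof -
  let ?M = "lebesgue_on {0..1::real}"
  have m: "\<phi> \<in> measurable ?M ?M" and d: "distr ?M ?M \<phi> = ?M"
    using phi by (auto simp: measure_preserving_maps_def)
  have SM: "S \<in> sets ?M" using S by (auto simp: sets_restrict_space_iff)
  have eq: "\<phi> -` S \<inter> space ?M = {x \<in> {0..1}. \<phi> x \<in> S}" by auto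
  have "{x \<in> {0..1}. \<phi> x \<in> S} \<in> sets ?M" using measurable_sets[OF m SM] unfolding eq .
  then show s: "{x \<in> {0..1}. \<phi> x \<in> S} \<in> sets lebesgue" by (simp add: sets_restrict_space_iff)
  have "measure ?M S = measure ?M {x \<in> {0..1}. \<phi> x \<in> S}"
    using measure_distr[OF m SM] unfolding d eq .
  then show "measure lebesgue {x \<in> {0..1}. \<phi> x \<in> S} = measure lebesgue S"
    using S measure_restrict_space[of "{0..1}" lebesgue S]
      measure_restrict_space[of "{0..1}" lebesgue "{x \<in> {0..1}. \<phi> x \<in> S}"]
    by (simp del: atLeastAtMost_iff add: subset_iff)
qed

lemma measure_preserving_range:
  assumes "\<phi> \<in> measure_preserving_maps" "x \<in> {0..1}"
  shows "\<phi> x \<in> {0..1}"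
  using assms measurable_space[of \<phi> "lebesgue_on {0..1}" "lebesgue_on {0..1}" x]
  by (auto simp: measure_preserving_maps_def)

lemma block_system_pullback:
  assumes phi: "\<phi> \<in> measure_preserving_maps" and b: "block_system \<beta>"
  shows "block_system (\<lambda>n x. \<beta> n (\<phi> x))"
proof -
  interpret block_system \<beta> by (rule b)
  have eq: "{x \<in> {0..1}. \<beta> n (\<phi> x) = c} = {x \<in> {0..1}. \<phi> x \<in> part n c}" for n c
    using measure_preserving_range[OF phi] by (auto simp: part_def)
  show ?thesis
  proof
    show "\<beta> n (\<phi> x) < 2 ^ n" if "x \<in> {0..1}" for n x
      using less measure_preserving_range[OF phi that] by blast
    show "{x \<in> {0..1}. \<beta> n (\<phi> x) = c} \<in> sets lebesgue" for n c
      unfolding eq using measure_preserving_vimage[OF phi] part_subset by auto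
    show "measure lebesgue {x \<in> {0..1}. \<beta> n (\<phi> x) = c} = 1 / 2 ^ n" if "c < 2 ^ n" for n c
      unfolding eq using measure_preserving_vimage[OF phi _ part_subset] measure_part_eq[OF that] by simp
    show "measure lebesgue ({x \<in> {0..1}. \<beta> m (\<phi> x) = c} \<inter> {x \<in> {0..1}. \<beta> n (\<phi> x) = d}) = 1 / 2 ^ m * (1 / 2 ^ n)"
      if "m \<noteq> n" "c < 2 ^ m" "d < 2 ^ n" for m n c d
    proof -
      have "{x \<in> {0..1}. \<beta> m (\<phi> x) = c} \<inter> {x \<in> {0..1}. \<beta> n (\<phi> x) = d} =
          {x \<in> {0..1}. \<phi> x \<in> part m c \<inter> part n d}" unfolding eq by auto
      then show ?thesis
        using measure_preserving_vimage(2)[OF phi, of "part m c \<inter> part n d"] measure_part_Int[OF that]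
          part_subset by (simp add: le_infI1)
    qed
  qed
qed

text \<open>Every pullback of \<open>G\<close> is governed by its own block system. The index
  \<open>Suc n\<close> skips block 0, which is constant, so that all points agree in it.\<close>

lemma pullback_G_eq:
  assumes phi: "\<phi> \<in> measure_preserving_maps" and z: "z \<in> unit_square"
  shows "pullback G \<phi> z = indicator (\<Union>n. block_system.agree (\<lambda>n x. block n (\<phi> x)) (Suc n)) z"
proof -
  interpret block_system "\<lambda>n x. block n (\<phi> x)"
    by (rule block_system_pullback[OF phi block_system_block])
  obtain x y where xy: "z = (x, y)" "x \<in> {0..1}" "y \<in> {0..1}" using z by auto
  have r: "\<phi> x \<in> {0..1}" "\<phi> y \<in> {0..1}" using measure_preserving_range[OF phi] xy by blast+
  have "G (\<phi> x, \<phi> y) = 0 \<or> G (\<phi> x, \<phi> y) = 1" by (simp add: G_def indicator_def)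
  moreover have "z \<in> (\<Union>n. agree (Suc n)) \<longleftrightarrow> (\<exists>n\<ge>1. block n (\<phi> x) = block n (\<phi> y))"
  proof
    assume "\<exists>n\<ge>1. block n (\<phi> x) = block n (\<phi> y)"
    then obtain n where "1 \<le> n" "block n (\<phi> x) = block n (\<phi> y)" by blast
    then have "z \<in> agree (Suc (n - 1))" using xy by (simp add: agree_def)
    then show "z \<in> (\<Union>n. agree (Suc n))" by blast
  next
    assume "z \<in> (\<Union>n. agree (Suc n))"
    then obtain n where "z \<in> agree (Suc n)" by blast
    then have "block (Suc n) (\<phi> x) = block (Suc n) (\<phi> y)" using xy by (simp add: agree_def)
    then show "\<exists>n\<ge>1. block n (\<phi> x) = block n (\<phi> y)" by (intro exI[of _ "Suc n"]) simp
  qed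
  ultimately show ?thesis
    using G_eq_1_iff[OF r] xy by (auto simp: pullback_def indicator_def)
qed

lemma id_measure_preserving: "(\<lambda>x. x) \<in> measure_preserving_maps"
  by (auto simp: measure_preserving_maps_def distr_id)

lemma pullback_G_measurable:
  assumes phi: "\<phi> \<in> measure_preserving_maps" and S: "S \<subseteq> unit_square"
  shows "pullback G \<phi> \<in> borel_measurable (lebesgue_on S)"
proof -
  interpret block_system "\<lambda>n x. block n (\<phi> x)"
    by (rule block_system_pullback[OF phi block_system_block])
  have "(indicator (\<Union>n. agree (Suc n)) :: _ \<Rightarrow> real) \<in> borel_measurable lebesgue"
    by (rule borel_measurable_indicator) auto
  then have "(indicator (\<Union>n. agree (Suc n)) :: _ \<Rightarrow> real) \<in> borel_measurable (lebesgue_on S)"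
    by (rule measurable_restrict_space1)
  then show ?thesis
    by (rule measurable_cong[THEN iffD1, rotated]) (use pullback_G_eq[OF phi] S in \<open>auto simp: subset_iff\<close>)
qed

lemma graphon_G: "graphon G"
proof -
  have "pullback G (\<lambda>x. x) = G" by (auto simp: pullback_def)
  then have "G \<in> borel_measurable (lebesgue_on unit_square)"
    using pullback_G_measurable[OF id_measure_preserving order_refl] by simp
  moreover have "G (x, y) = G (y, x)" if "x \<in> {0..1}" "y \<in> {0..1}" for x y
  proof -
    have "G (x, y) = 1 \<longleftrightarrow> G (y, x) = 1"
      unfolding G_eq_1_iff[OF that] G_eq_1_iff[OF that(2,1)] by metis
    then show ?thesis by (auto simp: G_def indicator_def)
  qed
  ultimately show ?thesis by (auto simp: graphon_def) (auto simp: G_def)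
qed

lemma random_free_G: "random_free G"
  by (auto simp: random_free_def G_def indicator_def)

section \<open>Integrals over rectangles and the cut norm\<close>

lemma rectangle_subset: "S \<in> measurable_subsets \<Longrightarrow> T \<in> measurable_subsets \<Longrightarrow>
    S \<times> T \<in> lmeasurable \<and> S \<times> T \<subseteq> unit_square \<and> measure lebesgue (S \<times> T) \<le> 1"
proof -
  assume S: "S \<in> measurable_subsets" and T: "T \<in> measurable_subsets"
  have 1: "S \<times> T \<subseteq> unit_square" "S \<times> T \<in> lmeasurable"
    using S T by (auto simp: measurable_subsets_def intro!: fmeasurable_subset_unit_square lebesgue_Times)
  then have "measure lebesgue (S \<times> T) \<le> measure lebesgue unit_square"
    using unit_square_lmeasurable by (intro measure_mono_fmeasurable) auto
  then show ?thesis using 1 unit_square_lmeasurable by simp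
qed

lemma graphon_measurable: "graphon W \<Longrightarrow> S \<subseteq> unit_square \<Longrightarrow> W \<in> borel_measurable (lebesgue_on S)"
  unfolding graphon_def using measurable_restrict_mono by blast

lemma integrable_bounded_on:
  fixes f :: "real \<times> real \<Rightarrow> real"
  assumes "f \<in> borel_measurable (lebesgue_on S)" "S \<in> lmeasurable" "\<And>z. z \<in> S \<Longrightarrow> \<bar>f z\<bar> \<le> B"
  shows "integrable (lebesgue_on S) f" "\<bar>\<integral>z. f z \<partial>(lebesgue_on S)\<bar> \<le> B * measure lebesgue S"
proof -
  interpret finite_measure "lebesgue_on S" using assms(2) by (rule finite_measure_lebesgue_on)
  show i: "integrable (lebesgue_on S) f"
    using assms by (intro integrable_const_bound[of _ B]) auto
  have "\<bar>\<integral>z. f z \<partial>(lebesgue_on S)\<bar> \<le> (\<integral>z. \<bar>f z\<bar> \<partial>(lebesgue_on S))" by simp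
  also have "\<dots> \<le> (\<integral>z. B \<partial>(lebesgue_on S))"
    using assms i by (intro integral_mono) auto
  also have "\<dots> = B * measure lebesgue S"
    using assms(2) by (simp add: measure_restrict_space fmeasurableD)
  finally show "\<bar>\<integral>z. f z \<partial>(lebesgue_on S)\<bar> \<le> B * measure lebesgue S" .
qed

lemma cut_norm_approximation:
  assumes H: "graphon H" and w: "weakly_isomorphic H G" and d: "0 < \<delta>"
  obtains \<phi> where "\<phi> \<in> measure_preserving_maps"
    "\<And>S T. S \<in> measurable_subsets \<Longrightarrow> T \<in> measurable_subsets \<Longrightarrow>
      \<bar>\<integral>z. H z - pullback G \<phi> z \<partial>(lebesgue_on (S \<times> T))\<bar> < \<delta>"
proof -
  let ?I = "\<lambda>\<phi> R. \<bar>\<integral>z. H z - pullback G \<phi> z \<partial>(lebesgue_on (fst R \<times> snd R))\<bar>"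
  let ?R = "measurable_subsets \<times> measurable_subsets"
  have "(INF \<phi>\<in>measure_preserving_maps. SUP R\<in>?R. ?I \<phi> R) < \<delta>"
    using w d unfolding weakly_isomorphic_def by simp
  then obtain \<phi> where phi: "\<phi> \<in> measure_preserving_maps" "(SUP R\<in>?R. ?I \<phi> R) < \<delta>"
    using id_measure_preserving cInf_lessD[of "(\<lambda>\<phi>. SUP R\<in>?R. ?I \<phi> R) ` measure_preserving_maps" \<delta>]
    by blast
  \<comment> \<open>A real supremum bounds its family only if the family is bounded above; here both
    functions take values in the unit interval and rectangles have measure at most 1.\<close>
  have "?I \<phi> (S, T) \<le> 1" if ST: "S \<in> measurable_subsets" "T \<in> measurable_subsets" for S T
  proof -
    have b: "\<bar>H z - pullback G \<phi> z\<bar> \<le> 1" if "z \<in> S \<times> T" for z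
    proof -
      have "z \<in> unit_square" using rectangle_subset[OF ST] that by blast
      then have "0 \<le> H z" "H z \<le> 1" using H by (auto simp: graphon_def)
      moreover have "pullback G \<phi> z \<in> {0, 1}" by (auto simp: pullback_def G_def indicator_def split: prod.splits)
      ultimately show ?thesis by auto
    qed
    have "(\<lambda>z. H z - pullback G \<phi> z) \<in> borel_measurable (lebesgue_on (S \<times> T))"
      using graphon_measurable[OF H] pullback_G_measurable[OF phi(1)] rectangle_subset[OF ST]
      by (intro borel_measurable_diff) auto
    from integrable_bounded_on(2)[OF this _ b] show ?thesis
      using rectangle_subset[OF ST] by simp
  qed
  then have "bdd_above (?I \<phi> ` ?R)" by (intro bdd_aboveI[of _ 1]) auto
  then have "?I \<phi> (S, T) \<le> (SUP R\<in>?R. ?I \<phi> R)"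
    if "S \<in> measurable_subsets" "T \<in> measurable_subsets" for S T
    using that by (intro cSUP_upper) auto
  then show ?thesis using that[of \<phi>] phi by fastforce
qed

text \<open>Origin of the threshold: a pullback of \<open>G\<close> has integral at most 63/64, that
  is 126/128, and some pullback is closer to \<open>H\<close> than 1/128 in the cut norm, so the
  integral of \<open>H\<close> is below 127/128 and \<open>H\<close> cannot be at least that large
  almost everywhere.\<close>

lemma measure_white_pos:
  assumes H: "graphon H" and w: "weakly_isomorphic H G"
  shows "0 < measure lebesgue {z \<in> unit_square. H z < 127 / 128}"
proof (rule ccontr)
  let ?W = "{z \<in> unit_square. H z < 127 / 128}"
  assume "\<not> ?thesis"
  then have 0: "measure lebesgue ?W = 0" by (simp add: zero_less_measure_iff)
  obtain \<phi> where phi: "\<phi> \<in> measure_preserving_maps"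
    "\<And>S T. S \<in> measurable_subsets \<Longrightarrow> T \<in> measurable_subsets \<Longrightarrow>
      \<bar>\<integral>z. H z - pullback G \<phi> z \<partial>(lebesgue_on (S \<times> T))\<bar> < 1 / 128"
    using cut_norm_approximation[OF H w, of "1 / 128"] by auto
  interpret block_system "\<lambda>n x. block n (\<phi> x)"
    by (rule block_system_pullback[OF phi(1) block_system_block])
  let ?L = "lebesgue_on unit_square"
  let ?U = "\<Union>n. agree (Suc n)"
  have Hm: "H \<in> borel_measurable ?L" using graphon_measurable[OF H] by blast
  have Hi: "integrable ?L H"
    using H by (intro integrable_bounded_on(1)[OF Hm unit_square_lmeasurable(1), of 1]) (auto simp: graphon_def)
  have Gi: "integrable ?L (pullback G \<phi>)"
    by (rule integrable_bounded_on(1)[OF pullback_G_measurable[OF phi(1)] unit_square_lmeasurable(1), of 1])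
       (auto simp: pullback_def G_def indicator_def)
  have Us: "?U \<in> sets lebesgue" by auto
  have U: "?U \<subseteq> unit_square" by (auto simp: agree_def)
  have "(\<integral>z. pullback G \<phi> z \<partial>?L) = (\<integral>z. indicator ?U z \<partial>?L)"
    by (rule Bochner_Integration.integral_cong) (use pullback_G_eq[OF phi(1)] in auto)
  also have "\<dots> = measure ?L (?U \<inter> space ?L)" by (rule Bochner_Integration.integral_indicator)
  also have "\<dots> = measure lebesgue ?U"
    using U unit_square_lmeasurable by (simp add: Int_absorb2 measure_restrict_space fmeasurableD)
  finally have G1: "(\<integral>z. pullback G \<phi> z \<partial>?L) \<le> 63 / 64" using measure_agree_Un_less_1 by simp
  have Wm: "?W \<in> sets lebesgue"
    using measurable_sets[OF Hm, of "{..<127 / 128}"]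
    by (simp add: vimage_def Int_def conj_commute sets_restrict_space_iff fmeasurableD[OF unit_square_lmeasurable(1)])
  have "?W \<in> null_sets lebesgue"
    using 0 Wm fmeasurable_subset_unit_square[OF Wm] by (auto simp: null_sets_def emeasure_eq_measure2)
  then have "AE z in lebesgue. z \<notin> ?W" by (rule AE_not_in)
  then have "AE z in ?L. 127 / 128 \<le> H z"
    by (subst AE_restrict_space_iff) (auto elim!: eventually_mono simp: fmeasurableD[OF unit_square_lmeasurable(1)])
  then have "(\<integral>z. 127 / 128 \<partial>?L) \<le> (\<integral>z. H z \<partial>?L)"
    using Hi integrable_bounded_on(1)[of "\<lambda>_. 127 / 128" unit_square "127 / 128"] unit_square_lmeasurable
    by (intro integral_mono_AE) auto
  then have "127 / 128 \<le> (\<integral>z. H z \<partial>?L)"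
    using unit_square_lmeasurable by (simp add: measure_restrict_space fmeasurableD)
  moreover have "(\<integral>z. H z - pullback G \<phi> z \<partial>?L) < 1 / 128"
    using phi(2)[of "{0..1}" "{0..1}"] by (auto simp: measurable_subsets_def)
  ultimately show False using G1 Hi Gi by simp
qed

section \<open>The computable name\<close>

lemma agreements_pos_iff:
  "1 \<le> agreements j p q \<longleftrightarrow> (\<exists>i<j. grid_block j (Suc i) p = grid_block j (Suc i) q)"
proof -
  have "1 \<le> (rec_nat 0 (\<lambda>i acc. acc + of_bool (f i)) m :: nat) \<longleftrightarrow> (\<exists>i<m. f i)" for f m
    by (induction m) (auto simp: less_Suc_eq)
  then show ?thesis unfolding agreements_def .
qed

lemma step_fun_eq:
  assumes x: "x \<in> {0..1}" and y: "y \<in> {0..1}" and n: "0 < n"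
  shows "step_fun n a (x, y) = a (cell_index n x) (cell_index n y)"
proof -
  have i: "indicator (cell n p \<times> cell n q) (x, y) = (if p = cell_index n x then if q = cell_index n y then 1 else 0 else (0::real))"
    if "p < n" "q < n" for p q
    using mem_cell_iff[OF x that(1)] mem_cell_iff[OF y that(2)] by (auto simp: indicator_def)
  have "step_fun n a (x, y) =
      (\<Sum>p<n. \<Sum>q<n. if p = cell_index n x then if q = cell_index n y then a p q else 0 else 0)"
    unfolding step_fun_def by (intro sum.cong refl) (simp add: i)
  also have "\<dots> = (\<Sum>p<n. if p = cell_index n x then (\<Sum>q<n. if q = cell_index n y then a p q else 0) else 0)"
    by (intro sum.cong refl) auto
  also have "\<dots> = a (cell_index n x) (cell_index n y)"
    using cell_index_less[OF n] by simp
  finally show ?thesis .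
qed

lemma nat_to_rat_surj_prod_encode_2_2: "nat_to_rat_surj (prod_encode (2, 2)) = 1"
proof -
  have "int_decode 2 = 1" by (simp add: int_decode_def sum_decode_def)
  then show ?thesis by (simp add: nat_to_rat_surj_def One_rat_def)
qed

text \<open>The code 0 stands for the degenerate fraction with numerator and denominator 0, whose
  value is 0; a zero \<open>stage_entry\<close> therefore means white.\<close>

lemma nat_to_rat_surj_0: "nat_to_rat_surj 0 = 0"
proof -
  have "prod_decode 0 = (0, 0)" by (simp add: prod_decode_def prod_decode_aux.simps)
  moreover have "int_decode 0 = 0" by (simp add: int_decode_def sum_decode_def)
  ultimately show ?thesis by (simp add: nat_to_rat_surj_def rat_number_collapse)
qed

lemma step_enum_stage_code:
  assumes z: "z \<in> unit_square"
  shows "step_enum (stage_code j) z = indicator (\<Union>i<j. block_system.agree block (Suc i)) z"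
proof -
  interpret block_system block by (rule block_system_block)
  obtain x y where xy: "z = (x, y)" and x: "x \<in> {0..1}" and y: "y \<in> {0..1}" using z by auto
  define n where "n = grid j"
  have n: "0 < n" unfolding n_def by (rule grid_pos)
  define cs where "cs = map (stage_entry j) [0..<n * n]"
  define p q where "p = cell_index n x" and "q = cell_index n y"
  have pq: "p < n" "q < n" unfolding p_def q_def using cell_index_less[OF n] by auto
  \<comment> \<open>\<open>step_enum\<close> reads only entries whose row index is at most the
    column index; agreement of blocks is symmetric, so sorting the two indices is harmless.\<close>
  define s t where "s = min p q" and "t = max p q"
  have st: "s < n" "t < n" using pq by (auto simp: s_def t_def)
  have "step_enum (stage_code j) z = step_fun n (\<lambda>p q. rat_entry cs (min p q * n + max p q)) (x, y)"
    using n unfolding step_enum_def stage_code_def Let_def n_def[symmetric] cs_def xy by simp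
  also have "\<dots> = rat_entry cs (s * n + t)"
    unfolding step_fun_eq[OF x y n] p_def[symmetric] q_def[symmetric] s_def t_def ..
  also have "\<dots> = max 0 (min 1 (of_rat (nat_to_rat_surj (stage_entry j (s * n + t)))))"
    using digits_less[OF st] by (simp add: rat_entry_def cs_def)
  also have "\<dots> = of_bool (1 \<le> agreements j s t)"
    using st by (auto simp: stage_entry_def n_def[symmetric] nat_to_rat_surj_0 nat_to_rat_surj_prod_encode_2_2)
  also have "1 \<le> agreements j s t \<longleftrightarrow> (\<exists>i<j. grid_block j (Suc i) p = grid_block j (Suc i) q)"
    unfolding agreements_pos_iff s_def t_def min_def max_def by (cases "p \<le> q") (auto simp: eq_commute)
  also have "\<dots> \<longleftrightarrow> (\<exists>i<j. block (Suc i) x = block (Suc i) y)"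
    using grid_block_cell_index[OF x, of "Suc _" j] grid_block_cell_index[OF y, of "Suc _" j]
    unfolding p_def q_def n_def by (metis Suc_leI)
  also have "\<dots> \<longleftrightarrow> z \<in> (\<Union>i<j. agree (Suc i))"
    using x y by (auto simp: agree_def xy)
  finally show ?thesis by (simp add: indicator_def)
qed

lemma d1_indicators_le:
  assumes f: "\<And>z. z \<in> unit_square \<Longrightarrow> f z = indicator U z"
    and g: "\<And>z. z \<in> unit_square \<Longrightarrow> g z = indicator V z"
    and UV: "(U - V) \<union> (V - U) \<subseteq> W" and W: "W \<in> sets lebesgue" "W \<subseteq> unit_square"
  shows "d1 f g \<le> measure lebesgue W"
proof -
  let ?L = "lebesgue_on unit_square"
  have m: "measure ?L W = measure lebesgue W"
    using W unit_square_lmeasurable by (intro measure_restrict_space) (auto simp: fmeasurableD)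
  have Ws: "W \<in> sets ?L"
    using W unit_square_lmeasurable by (auto simp: sets_restrict_space_iff fmeasurableD)
  have i: "integrable ?L (indicator W :: _ \<Rightarrow> real)"
  proof -
    interpret finite_measure ?L using unit_square_lmeasurable by (intro finite_measure_lebesgue_on) auto
    show ?thesis using Ws by (intro integrable_real_indicator) (auto simp: emeasure_finite less_top[symmetric])
  qed
  have "d1 f g \<le> (\<integral>z. indicator W z \<partial>?L)"
    unfolding d1_def
  proof (rule integral_mono'[OF i])
    fix z assume "z \<in> space ?L"
    then have "z \<in> unit_square" by simp
    then show "\<bar>f z - g z\<bar> \<le> indicator W z" using f g UV by (auto simp: indicator_def)
  qed simp
  also have "\<dots> = measure lebesgue W"
  proof -
    have "W \<inter> space ?L = W" using W by auto
    then show ?thesis using m by (simp only: Bochner_Integration.integral_indicator)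
  qed
  finally show ?thesis .
qed

text \<open>Stage \<open>j\<close> differs from every later stage and from \<open>G\<close> only
  where some block after the \<open>j\<close>th agrees, a set of measure at most
  \<open>1 / 2 ^ j\<close>. This bounds both distances in the definition of a name.\<close>

lemma computable_d1_name_stage_code: "computable_d1_name G stage_code"
  unfolding computable_d1_name_def
proof (intro conjI allI impI)
  interpret block_system block by (rule block_system_block)
  let ?W = "\<lambda>j. \<Union>i. agree (Suc (j + i))"
  have W: "?W j \<in> sets lebesgue" "?W j \<subseteq> unit_square" "measure lebesgue (?W j) \<le> 1 / 2 ^ j" for j
    using measure_agree_tail[of j] by (auto simp: agree_def)
  have mem: "z \<in> ?W j" if "z \<in> agree (Suc i)" "j \<le> i" for z i j
    using that by (intro UN_I[of "i - j"]) auto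
  show "computable stage_code" by (rule computable_stage_code)
  show "d1 (step_enum (stage_code j)) (step_enum (stage_code l)) \<le> 1 / 2 ^ j" if "j < l" for j l
  proof -
    have "d1 (step_enum (stage_code j)) (step_enum (stage_code l)) \<le> measure lebesgue (?W j)"
    proof (rule d1_indicators_le[OF step_enum_stage_code step_enum_stage_code])
      show "(\<Union>i<j. agree (Suc i)) - (\<Union>i<l. agree (Suc i)) \<union> ((\<Union>i<l. agree (Suc i)) - (\<Union>i<j. agree (Suc i))) \<subseteq> ?W j"
      proof
        fix z assume "z \<in> (\<Union>i<j. agree (Suc i)) - (\<Union>i<l. agree (Suc i)) \<union> ((\<Union>i<l. agree (Suc i)) - (\<Union>i<j. agree (Suc i)))"
        then obtain i where "z \<in> agree (Suc i)" "\<not> i < j"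
          using \<open>j < l\<close> by (blast dest: order.strict_trans intro: lessThan_iff[THEN iffD2])
        then show "z \<in> ?W j" using mem[of z i j] by simp
      qed
    qed (use W in auto)
    then show ?thesis using W(3)[of j] by linarith
  qed
  have le: "d1 (step_enum (stage_code j)) G \<le> 1 / 2 ^ j" for j
  proof -
    have "d1 (step_enum (stage_code j)) G \<le> measure lebesgue (?W j)"
    proof (rule d1_indicators_le[OF step_enum_stage_code])
      show "G z = indicator (\<Union>n. agree (Suc n)) z" if "z \<in> unit_square" for z
        using pullback_G_eq[OF id_measure_preserving that] by (cases z) (simp add: pullback_def)
      show "(\<Union>i<j. agree (Suc i)) - (\<Union>n. agree (Suc n)) \<union> ((\<Union>n. agree (Suc n)) - (\<Union>i<j. agree (Suc i))) \<subseteq> ?W j"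
      proof
        fix z assume "z \<in> (\<Union>i<j. agree (Suc i)) - (\<Union>n. agree (Suc n)) \<union> ((\<Union>n. agree (Suc n)) - (\<Union>i<j. agree (Suc i)))"
        then obtain i where "z \<in> agree (Suc i)" "\<not> i < j" by blast
        then show "z \<in> ?W j" using mem[of z i j] by simp
      qed
    qed (use W in auto)
    then show ?thesis using W(3)[of j] by linarith
  qed
  have "(\<lambda>j. 1 / 2 ^ j :: real) \<longlonglongrightarrow> 0"
    using LIMSEQ_power_zero[of "1 / 2 :: real"] by (simp add: power_one_over)
  then show "(\<lambda>j. d1 (step_enum (stage_code j)) G) \<longlonglongrightarrow> 0"
  proof (rule tendsto_sandwich[OF always_eventually always_eventually tendsto_const, rotated 2])
    show "\<forall>j. 0 \<le> d1 (step_enum (stage_code j)) G" by (simp add: d1_def)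
    show "\<forall>j. d1 (step_enum (stage_code j)) G \<le> 1 / 2 ^ j" using le by blast
  qed
qed

section \<open>The black part of a weakly isomorphic graphon\<close>

text \<open>The uniform distribution on \<open>E\<close> has marginals whose densities are at most \<open>C\<close> times those of the
  uniform distributions on \<open>A\<close> and \<open>B\<close>.\<close>

definition spreading :: "real \<Rightarrow> (real \<times> real) set \<Rightarrow> bool" where
  "spreading C F \<longleftrightarrow> (\<forall>A\<in>sets borel. \<forall>B\<in>sets borel. A \<subseteq> {0..1} \<longrightarrow> B \<subseteq> {0..1} \<longrightarrow>
     0 < measure lborel A \<longrightarrow> 0 < measure lborel B \<longrightarrow>
     (\<exists>E. compact E \<and> E \<subseteq> F \<inter> A \<times> B \<and> 0 < measure lborel E \<and>
        (\<forall>x. measure lborel (Pair x -` E) \<le> C * measure lborel E / measure lborel A) \<and>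
        (\<forall>y. measure lborel ((\<lambda>x. (x, y)) -` E) \<le> C * measure lborel E / measure lborel B)))"

text \<open>Markov's inequality for \<open>1 - H\<close>. Since the pullback is constantly 1 on the
  rectangle and \<open>H\<close> is at most 1, nothing cancels in the integral of the difference, so
  closeness in the cut norm is closeness in the mean there.\<close>

lemma measure_low_values:
  assumes H: "graphon H" and phi: "\<phi> \<in> measure_preserving_maps"
    and ST: "S \<in> measurable_subsets" "T \<in> measurable_subsets"
    and one: "\<And>z. z \<in> S \<times> T \<Longrightarrow> pullback G \<phi> z = 1"
    and d: "\<bar>\<integral>z. H z - pullback G \<phi> z \<partial>(lebesgue_on (S \<times> T))\<bar> < \<delta>"
  shows "{z \<in> S \<times> T. H z \<le> 127 / 128} \<in> lmeasurable"
    and "measure lebesgue {z \<in> S \<times> T. H z \<le> 127 / 128} \<le> 128 * \<delta>"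
proof -
  let ?L = "lebesgue_on (S \<times> T)" and ?B = "{z \<in> S \<times> T. H z \<le> 127 / 128}"
  have R: "S \<times> T \<in> lmeasurable" "S \<times> T \<subseteq> unit_square" using rectangle_subset[OF ST] by auto
  have Hm: "H \<in> borel_measurable ?L" using graphon_measurable[OF H R(2)] .
  have Hb: "0 \<le> H z" "H z \<le> 1" if "z \<in> S \<times> T" for z
    using that R(2) H by (auto simp: graphon_def)
  have "?B \<in> sets ?L"
    using measurable_sets[OF Hm, of "{..127 / 128}"] by (simp add: vimage_def Int_def conj_commute)
  then have Bs: "?B \<in> sets lebesgue"
    using R by (simp add: sets_restrict_space_iff fmeasurableD)
  then show Bm: "?B \<in> lmeasurable" using R by (intro fmeasurable_subset_unit_square) auto
  have i1: "integrable ?L (\<lambda>z. 1 - H z)"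
    using Hm Hb by (intro integrable_bounded_on(1)[OF _ R(1), of _ 1] borel_measurable_diff) auto
  have i2: "integrable ?L (\<lambda>z. 1 / 128 * (indicator ?B z :: real))"
    using \<open>?B \<in> sets ?L\<close>
    by (intro integrable_bounded_on(1)[OF _ R(1), of _ 1] borel_measurable_times borel_measurable_indicator) (auto simp: indicator_def)
  have "1 / 128 * measure lebesgue ?B = (\<integral>z. 1 / 128 * indicator ?B z \<partial>?L)"
  proof -
    have "?B \<inter> space ?L = ?B" by auto
    moreover have "measure ?L ?B = measure lebesgue ?B"
      using R by (intro measure_restrict_space) (auto simp: fmeasurableD)
    ultimately show ?thesis by (simp only: integral_mult_right_zero Bochner_Integration.integral_indicator)
  qed
  also have "\<dots> \<le> (\<integral>z. 1 - H z \<partial>?L)"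
    by (rule integral_mono[OF i2 i1]) (use Hb in \<open>auto simp: indicator_def\<close>)
  also have "(\<integral>z. 1 - H z \<partial>?L) = - (\<integral>z. H z - pullback G \<phi> z \<partial>?L)"
  proof -
    have "(\<integral>z. 1 - H z \<partial>?L) = (\<integral>z. - (H z - pullback G \<phi> z) \<partial>?L)"
      by (rule Bochner_Integration.integral_cong) (auto simp: one)
    then show ?thesis by (simp only: Bochner_Integration.integral_minus)
  qed
  also have "\<dots> < \<delta>" using d by linarith
  finally show "measure lebesgue ?B \<le> 128 * \<delta>" by simp
qed

text \<open>The set \<open>E\<close> comes from the rectangles over those parts of one block that
  are balanced for both \<open>A\<close> and \<open>B\<close>. A point lies over only one of them,
  so its section has measure of order \<open>b / 2 ^ n\<close>, while their union has measure of
  order \<open>a * b / 2 ^ n\<close>; the unknown factor \<open>2 ^ n\<close> cancels in the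
  quotient.\<close>

lemma spreading_black:
  assumes H: "graphon H" and w: "weakly_isomorphic H G"
    and F: "F \<in> sets lebesgue" "{z \<in> unit_square. 127 / 128 < H z} - F \<in> null_sets lebesgue"
  shows "spreading 48 F"
  unfolding spreading_def
proof (intro ballI impI)
  fix A B :: "real set"
  assume AB: "A \<in> sets borel" "B \<in> sets borel" "A \<subseteq> {0..1}" "B \<subseteq> {0..1}"
    and pos: "0 < measure lborel A" "0 < measure lborel B"
  define a b where "a = measure lborel A" and "b = measure lborel B"
  have ab: "0 < a" "0 < b" "measure lebesgue A = a" "measure lebesgue B = b"
    using pos AB by (simp_all add: a_def b_def)
  have Al: "A \<in> sets lebesgue" "B \<in> sets lebesgue" using AB by simp_all
  obtain N :: nat where N: "16 * (1 / a + 1 / b) \<le> real N" using real_arch_simple by blast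
  \<comment> \<open>Each of the at most \<open>2 ^ n\<close> rectangles loses at most
    \<open>128 * \<delta>\<close> to low values of \<open>H\<close>; the total loss may be
    \<open>a * b / (16 * 2 ^ n)\<close>, half of the lower bound for \<open>E0\<close>. As only
    \<open>n \<le> N\<close> is known in advance, \<open>4 ^ N\<close> stands in for
    \<open>4 ^ n\<close>.\<close>
  define \<delta> where "\<delta> = a * b / (2048 * 4 ^ N)"
  have "0 < \<delta>" using ab by (simp add: \<delta>_def)
  then obtain \<phi> where phi: "\<phi> \<in> measure_preserving_maps"
    "\<And>S T. S \<in> measurable_subsets \<Longrightarrow> T \<in> measurable_subsets \<Longrightarrow>
      \<bar>\<integral>z. H z - pullback G \<phi> z \<partial>(lebesgue_on (S \<times> T))\<bar> < \<delta>"
    using cut_norm_approximation[OF H w] by metis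
  interpret block_system "\<lambda>n x. block n (\<phi> x)"
    by (rule block_system_pullback[OF phi(1) block_system_block])
  obtain n where n: "1 \<le> n" "n \<le> N"
    "2 ^ n / 2 \<le> real (card {c \<in> {..<2 ^ n}. balanced A n c \<and> balanced B n c})"
    by (rule exists_balanced[OF Al(1) AB(3) _ Al(2) AB(4), of N, unfolded ab(3,4), OF ab(1,2) N])
  define Cg where "Cg = {c \<in> {..<2 ^ n}. balanced A n c \<and> balanced B n c}"
  have Cg: "finite Cg" "Cg \<subseteq> {..<2 ^ n}" by (auto simp: Cg_def)
  define S T where "S c = A \<inter> part n c" and "T c = B \<inter> part n c" for c
  have ST: "S c \<in> measurable_subsets" "T c \<in> measurable_subsets" for c
    using AB Al by (auto simp: S_def T_def measurable_subsets_def)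
  have size: "a / 2 / 2 ^ n \<le> measure lebesgue (S c)" "measure lebesgue (S c) \<le> 3 / 2 * a / 2 ^ n"
    "b / 2 / 2 ^ n \<le> measure lebesgue (T c)" "measure lebesgue (T c) \<le> 3 / 2 * b / 2 ^ n" if "c \<in> Cg" for c
  proof -
    have "x / 2 / 2 ^ n \<le> m \<and> m \<le> 3 / 2 * x / 2 ^ n" if "\<bar>2 ^ n * m - x\<bar> \<le> x / 2" for x m :: real
      using that unfolding abs_diff_le_iff by (simp add: field_simps)
    from this[of "measure lebesgue (S c)" a] this[of "measure lebesgue (T c)" b]
    show "a / 2 / 2 ^ n \<le> measure lebesgue (S c)" "measure lebesgue (S c) \<le> 3 / 2 * a / 2 ^ n"
      "b / 2 / 2 ^ n \<le> measure lebesgue (T c)" "measure lebesgue (T c) \<le> 3 / 2 * b / 2 ^ n"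
      using that by (simp_all only: Cg_def mem_Collect_eq balanced_def deviation_def S_def T_def ab simp_thms)
  qed
  define E0 where "E0 = (\<Union>c\<in>Cg. S c \<times> T c)"
  have R: "S c \<times> T c \<in> lmeasurable" "S c \<times> T c \<subseteq> unit_square" for c
    using rectangle_subset[OF ST] by auto
  have E0: "E0 \<in> lmeasurable" "E0 \<subseteq> A \<times> B" "E0 \<subseteq> unit_square"
    unfolding E0_def using R Cg by (auto simp: S_def T_def)
  have "a * b / (8 * 2 ^ n) \<le> measure lebesgue E0"
  proof -
    have "a * b / (8 * 2 ^ n) = 2 ^ n / 2 * ((a / 2 / 2 ^ n) * (b / 2 / 2 ^ n))" by (simp add: field_simps)
    also have "\<dots> \<le> card Cg * ((a / 2 / 2 ^ n) * (b / 2 / 2 ^ n))"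
      using n(3) ab unfolding Cg_def[symmetric] by (intro mult_right_mono) auto
    also have "\<dots> = (\<Sum>c\<in>Cg. (a / 2 / 2 ^ n) * (b / 2 / 2 ^ n))" by simp
    also have "\<dots> \<le> (\<Sum>c\<in>Cg. measure lebesgue (S c \<times> T c))"
    proof (rule sum_mono)
      fix c assume "c \<in> Cg"
      have "S c \<in> sets lebesgue" "T c \<in> sets lebesgue" using ST by (auto simp: measurable_subsets_def)
      then show "(a / 2 / 2 ^ n) * (b / 2 / 2 ^ n) \<le> measure lebesgue (S c \<times> T c)"
        unfolding measure_lebesgue_Times[OF \<open>S c \<in> sets lebesgue\<close> \<open>T c \<in> sets lebesgue\<close>]
        using size[OF \<open>c \<in> Cg\<close>] ab by (intro mult_mono) auto
    qed
    also have "\<dots> = measure lebesgue E0"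
      unfolding E0_def
    proof (rule measure_finite_Union[symmetric])
      show "disjoint_family_on (\<lambda>c. S c \<times> T c) Cg"
        unfolding disjoint_family_on_def S_def T_def using part_disjoint by blast
      show "emeasure lebesgue (S c \<times> T c) \<noteq> \<infinity>" for c
        using fmeasurableD2[OF R(1)] by (simp add: infinity_ennreal_def)
    qed (use R Cg in \<open>auto intro: fmeasurableD\<close>)
    finally show ?thesis .
  qed
  define Bad where "Bad c = {z \<in> S c \<times> T c. H z \<le> 127 / 128}" for c
  have Bad: "Bad c \<in> lmeasurable" "measure lebesgue (Bad c) \<le> 128 * \<delta>" for c
  proof -
    have one: "pullback G \<phi> z = 1" if "z \<in> S c \<times> T c" for z
    proof -
      have "z \<in> agree (Suc (n - 1))" using that n(1) by (auto simp: S_def T_def part_def agree_def)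
      moreover have "z \<in> unit_square" using that R(2) by blast
      ultimately show ?thesis using pullback_G_eq[OF phi(1)] by (metis UN_I UNIV_I indicator_simps(1))
    qed
    show "Bad c \<in> lmeasurable" "measure lebesgue (Bad c) \<le> 128 * \<delta>"
      unfolding Bad_def using measure_low_values[OF H phi(1) ST one phi(2)[OF ST]] by auto
  qed
  define E1 where "E1 = E0 \<inter> F"
  have E1: "E1 \<in> lmeasurable" unfolding E1_def using E0 F by (simp add: fmeasurable_Int_fmeasurable)
  let ?Z = "{z \<in> unit_square. 127 / 128 < H z} - F"
  have BadU: "(\<Union>c\<in>Cg. Bad c) \<in> lmeasurable" using Bad Cg by auto
  have "measure lebesgue (\<Union>c\<in>Cg. Bad c) \<le> (\<Sum>c\<in>Cg. measure lebesgue (Bad c))"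
    using Bad Cg by (intro measure_UNION_le) (auto intro: fmeasurableD)
  also have "\<dots> \<le> (\<Sum>c\<in>Cg. 128 * \<delta>)" by (intro sum_mono Bad)
  also have "\<dots> = card Cg * (128 * \<delta>)" by simp
  also have "\<dots> \<le> 2 ^ n * (128 * \<delta>)"
  proof -
    have "card Cg \<le> 2 ^ n" using card_mono[OF _ Cg(2)] by simp
    then have "real (card Cg) \<le> 2 ^ n" by (metis of_nat_le_iff of_nat_numeral of_nat_power)
    then show ?thesis using \<open>0 < \<delta>\<close> by (intro mult_right_mono) auto
  qed
  also have "\<dots> \<le> a * b / (16 * 2 ^ n)"
  proof -
    have "(4::real) ^ n \<le> 4 ^ N" using n by simp
    then have "2 ^ n * (128 * \<delta>) \<le> 2 ^ n * (128 * (a * b / (2048 * 4 ^ n)))"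
      unfolding \<delta>_def using ab by (intro mult_left_mono divide_left_mono mult_pos_pos) auto
    also have "\<dots> = a * b / (16 * 2 ^ n)"
      using power_mult_distrib[of 2 "2 :: real" n] by (simp add: field_simps)
    finally show ?thesis .
  qed
  finally have badsum: "measure lebesgue (\<Union>c\<in>Cg. Bad c) \<le> a * b / (16 * 2 ^ n)" .
  have "measure lebesgue E0 \<le> measure lebesgue (E1 \<union> (\<Union>c\<in>Cg. Bad c) \<union> ?Z)"
  proof (rule measure_mono_fmeasurable)
    show "E0 \<subseteq> E1 \<union> (\<Union>c\<in>Cg. Bad c) \<union> ?Z"
    proof
      fix z assume z: "z \<in> E0"
      then obtain c where c: "c \<in> Cg" "z \<in> S c \<times> T c" unfolding E0_def by blast
      consider "z \<in> F" | "H z \<le> 127 / 128" | "z \<notin> F" "127 / 128 < H z" by linarith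
      then show "z \<in> E1 \<union> (\<Union>c\<in>Cg. Bad c) \<union> ?Z"
      proof cases
        case 1
        then show ?thesis using z unfolding E1_def by blast
      next
        case 2
        then have "z \<in> Bad c" using c unfolding Bad_def by blast
        then show ?thesis using c by blast
      next
        case 3
        then show ?thesis using z E0(3) by blast
      qed
    qed
    show "E0 \<in> sets lebesgue" using E0 by (simp add: fmeasurableD)
    show "E1 \<union> (\<Union>c\<in>Cg. Bad c) \<union> ?Z \<in> lmeasurable"
      using E1 BadU F(2) by (intro fmeasurable.Un) (auto simp: fmeasurable_def null_sets_def)
  qed
  also have "\<dots> = measure lebesgue (E1 \<union> (\<Union>c\<in>Cg. Bad c))"
    using F(2) E1 BadU by (intro measure_Un_null_set) (auto simp: fmeasurableD)
  also have "\<dots> \<le> measure lebesgue E1 + measure lebesgue (\<Union>c\<in>Cg. Bad c)"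
    using E1 BadU by (intro measure_Un_le) (auto simp: fmeasurableD)
  finally have E1m: "a * b / (16 * 2 ^ n) \<le> measure lebesgue E1"
    using badsum \<open>a * b / (8 * 2 ^ n) \<le> measure lebesgue E0\<close> by simp
  \<comment> \<open>Passing to a compact subset costs less than half of the lower bound for
    \<open>E1\<close>.\<close>
  obtain E where E: "closed E" "E \<subseteq> E1" "E1 - E \<in> lmeasurable"
    "emeasure lebesgue (E1 - E) < ennreal (a * b / (32 * 2 ^ n))"
    using sets_lebesgue_inner_closed[OF fmeasurableD[OF E1], of "a * b / (32 * 2 ^ n)"] ab by auto
  have cE: "compact E"
  proof -
    have "bounded unit_square" by (intro bounded_Times) auto
    then show ?thesis
      using E E0(3) unfolding E1_def compact_eq_bounded_closed by (meson bounded_subset le_infI1 order_trans)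
  qed
  have Em: "E \<in> lmeasurable" using cE by (rule lmeasurable_compact)
  have "measure lebesgue (E1 - E) < a * b / (32 * 2 ^ n)"
    using E(3,4) ab by (simp add: emeasure_eq_measure2 ennreal_less_iff)
  moreover have "measure lebesgue E1 = measure lebesgue E + measure lebesgue (E1 - E)"
    using measure_Un2[OF Em E1] E(2) by (simp add: Un_absorb1)
  ultimately have mE: "a * b / (32 * 2 ^ n) \<le> measure lborel E"
    using E1m Em cE by (simp add: compact_imp_closed)
  \<comment> \<open>Origin of 48: a section has measure at most 3/2 of \<open>b / 2 ^ n\<close>,
    respectively \<open>a / 2 ^ n\<close>, and \<open>E\<close> has measure at least
    \<open>a * b / (32 * 2 ^ n)\<close>; 3/2 times 32 is 48.\<close>
  have sec: "3 / 2 * b / 2 ^ n \<le> 48 * measure lborel E / a" "3 / 2 * a / 2 ^ n \<le> 48 * measure lborel E / b"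
    using mE ab by (auto simp: field_simps)
  show "\<exists>E. compact E \<and> E \<subseteq> F \<inter> A \<times> B \<and> 0 < measure lborel E \<and>
        (\<forall>x. measure lborel (Pair x -` E) \<le> 48 * measure lborel E / measure lborel A) \<and>
        (\<forall>y. measure lborel ((\<lambda>x. (x, y)) -` E) \<le> 48 * measure lborel E / measure lborel B)"
  proof (intro exI[of _ E] conjI allI)
    show "compact E" by (rule cE)
    show "E \<subseteq> F \<inter> A \<times> B" using E E0 by (auto simp: E1_def)
    have "0 < a * b / (32 * 2 ^ n)" using ab by simp
    then show "0 < measure lborel E" using mE by linarith
    fix x
    show "measure lborel (Pair x -` E) \<le> 48 * measure lborel E / measure lborel A"
    proof (cases "block n (\<phi> x) \<in> Cg")
      case False
      then have "Pair x -` E = {}" using E by (auto simp: E1_def E0_def S_def part_def)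
      then show ?thesis by simp
    next
      case True
      let ?c = "block n (\<phi> x)"
      have c: "closed (Pair x -` E)" by (intro closed_vimage E continuous_intros)
      have "Pair x -` E \<subseteq> T ?c" using E by (auto simp: E1_def E0_def S_def T_def part_def)
      then have "measure lebesgue (Pair x -` E) \<le> measure lebesgue (T ?c)"
        using c ST by (intro measure_mono_fmeasurable fmeasurable_subset_unit) (auto simp: measurable_subsets_def)
      then show ?thesis using size(4)[OF True] sec c by (simp add: a_def)
    qed
  next
    fix y
    show "measure lborel ((\<lambda>x. (x, y)) -` E) \<le> 48 * measure lborel E / measure lborel B"
    proof (cases "block n (\<phi> y) \<in> Cg")
      case False
      then have "(\<lambda>x. (x, y)) -` E = {}" using E by (auto simp: E1_def E0_def T_def part_def)
      then show ?thesis by simp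
    next
      case True
      let ?c = "block n (\<phi> y)"
      have c: "closed ((\<lambda>x. (x, y)) -` E)" by (intro closed_vimage E continuous_intros)
      have "(\<lambda>x. (x, y)) -` E \<subseteq> S ?c" using E by (auto simp: E1_def E0_def S_def T_def part_def)
      then have "measure lebesgue ((\<lambda>x. (x, y)) -` E) \<le> measure lebesgue (S ?c)"
        using c ST by (intro measure_mono_fmeasurable fmeasurable_subset_unit) (auto simp: measurable_subsets_def)
      then show ?thesis using size(2)[OF True] sec c by (simp add: b_def)
    qed
  qed
qed

section \<open>A perfect family of points\<close>

definition dyad :: "nat \<Rightarrow> real \<Rightarrow> real set" where
  "dyad n x = {y. \<lfloor>2 ^ n * y\<rfloor> = \<lfloor>2 ^ n * x\<rfloor>}"

lemma dyad_eq: "dyad n x = {\<lfloor>2 ^ n * x\<rfloor> / 2 ^ n..<(\<lfloor>2 ^ n * x\<rfloor> + 1) / 2 ^ n}"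
  by (auto simp: dyad_def floor_eq_iff field_simps)

lemma dyad_borel [measurable, simp]: "dyad n x \<in> sets borel"
  unfolding dyad_eq by simp

lemma measure_dyad: "measure lborel (dyad n x) = 1 / 2 ^ n"
  unfolding dyad_eq by (simp add: divide_right_mono diff_divide_distrib[symmetric])

lemma self_mem_dyad: "x \<in> dyad n x"
  by (simp add: dyad_def)

lemma dyad_dist: "y \<in> dyad n x \<Longrightarrow> \<bar>y - x\<bar> \<le> 1 / 2 ^ n"
  using self_mem_dyad[of x n] unfolding dyad_eq by (auto simp: add_divide_distrib abs_le_iff)

lemma dyad_subset: assumes "x \<in> {0..<1}" shows "dyad n x \<subseteq> {0..<1}"
proof
  fix y assume y: "y \<in> dyad n x"
  let ?i = "\<lfloor>2 ^ n * x\<rfloor>"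
  have "0 \<le> ?i" "?i < 2 ^ n" using assms by (auto simp: floor_less_iff)
  then have "?i + 1 \<le> 2 ^ n" by simp
  then have "real_of_int (?i + 1) \<le> real_of_int (2 ^ n)" by (rule of_int_le_iff[THEN iffD2])
  then have "real_of_int (?i + 1) / 2 ^ n \<le> 1" by simp
  moreover have "0 \<le> real_of_int ?i / 2 ^ n" using \<open>0 \<le> ?i\<close> by simp
  moreover have "real_of_int ?i / 2 ^ n \<le> y" "y < real_of_int (?i + 1) / 2 ^ n"
    using y unfolding dyad_eq by simp_all
  ultimately show "y \<in> {0..<1}" unfolding atLeastLessThan_iff by linarith
qed

definition dyad_square :: "nat \<Rightarrow> real \<times> real \<Rightarrow> (real \<times> real) set" where
  "dyad_square n z = dyad n (fst z) \<times> dyad n (snd z)"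

lemma dyad_square_borel [measurable, simp]: "dyad_square n z \<in> sets borel"
  unfolding dyad_square_def by (simp add: borel_Times)

lemma emeasure_dyad_square: "emeasure lborel (dyad_square n z) = ennreal (1 / 4 ^ n)"
proof -
  have "emeasure lborel (dyad n x) = ennreal (1 / 2 ^ n)" for x
    unfolding dyad_eq
    by (subst emeasure_lborel_Ico) (auto simp: divide_right_mono diff_divide_distrib[symmetric])
  then show ?thesis
    unfolding dyad_square_def by (simp add: emeasure_lborel_Times ennreal_mult'[symmetric] power_mult_distrib[symmetric])
qed

text \<open>An elementary density theorem that holds at all large scales, so that finitely many
  compact sets can share one. Small squares around points of \<open>K\<close> lie in an open set
  \<open>U\<close> with \<open>U - K\<close> smaller than \<open>\<eta> * \<epsilon>\<close>; a bad
  square has at least the proportion \<open>\<eta>\<close> of its area in \<open>U - K\<close>, so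
  the bad squares together have area less than \<open>\<epsilon>\<close>.\<close>

lemma good_squares:
  fixes K :: "(real \<times> real) set"
  assumes K: "compact K" and eta: "0 < \<eta>" and eps: "0 < \<epsilon>"
  shows "\<forall>\<^sub>F n in sequentially. \<exists>R\<in>sets borel. emeasure lborel R < ennreal \<epsilon> \<and>
    (\<forall>z\<in>K - R. emeasure lborel (dyad_square n z - K) < ennreal (\<eta> / 4 ^ n))"
proof -
  have Kb: "K \<in> sets borel" using K by (simp add: compact_imp_closed)
  obtain U where U: "open U" "K \<subseteq> U" "emeasure lborel (U - K) < ennreal (\<eta> * \<epsilon>)"
    using outer_regular_lborel[OF Kb, of "\<eta> * \<epsilon>"] eta eps by auto
  obtain d where d: "0 < d" "(\<Union>x\<in>K. ball x d) \<subseteq> U"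
    using compact_subset_open_imp_ball_epsilon_subset[OF K U(1,2)] .
  have "(\<lambda>n. 2 * (1 / 2) ^ n :: real) \<longlonglongrightarrow> 2 * 0" by (intro tendsto_mult tendsto_const LIMSEQ_power_zero) simp
  from order_tendstoD(2)[OF this, of d]
  have "\<forall>\<^sub>F n in sequentially. 2 * (1 / 2) ^ n < d" using d by simp
  then show ?thesis
  proof (rule eventually_mono)
    fix n :: nat assume n: "2 * (1 / 2) ^ n < d"
    have sq: "dyad_square n z \<subseteq> U" if "z \<in> K" for z
    proof
      fix w assume w: "w \<in> dyad_square n z"
      have "dist z w \<le> \<bar>fst w - fst z\<bar> + \<bar>snd w - snd z\<bar>"
        using real_sqrt_sum_squares_triangle_ineq sqrt_sum_squares_le_sum_abs[of "fst w - fst z" "snd w - snd z"]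
        by (simp add: dist_prod_def dist_real_def power2_commute)
      also have "\<dots> \<le> 1 / 2 ^ n + 1 / 2 ^ n" using w by (intro add_mono dyad_dist) (auto simp: dyad_square_def)
      also have "\<dots> < d" using n by (simp add: power_one_over)
      finally have "w \<in> ball z d" by simp
      then show "w \<in> U" using d(2) that by blast
    qed
    \<comment> \<open>The squares of one level are the fibres of \<open>p\<close>, hence disjoint
      and countable in number.\<close>
    define p where "p z = (\<lfloor>2 ^ n * fst z\<rfloor>, \<lfloor>2 ^ n * snd z\<rfloor>)" for z :: "real \<times> real"
    have psq: "dyad_square n z = p -` {p z}" for z by (auto simp: dyad_square_def dyad_def p_def)
    define bad where "bad z \<longleftrightarrow> \<not> emeasure lborel (dyad_square n z - K) < ennreal (\<eta> / 4 ^ n)" for z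
    define J where "J = p ` {z \<in> K. bad z}"
    define R where "R = (\<Union>j\<in>J. p -` {j})"
    have Jc: "countable J" by (rule countable_subset[of _ UNIV]) auto
    have Q: "p -` {j} \<in> sets borel" "p -` {j} \<subseteq> U" "ennreal \<eta> * emeasure lborel (p -` {j}) \<le> emeasure lborel (p -` {j} - K)"
      if "j \<in> J" for j
    proof -
      obtain z where z: "z \<in> K" "bad z" "j = p z" using \<open>j \<in> J\<close> unfolding J_def by blast
      have eq: "p -` {j} = dyad_square n z" using psq z by simp
      show "p -` {j} \<in> sets borel" "p -` {j} \<subseteq> U" unfolding eq using sq z by auto
      show "ennreal \<eta> * emeasure lborel (p -` {j}) \<le> emeasure lborel (p -` {j} - K)"
        unfolding eq emeasure_dyad_square using z(2) eta
        by (simp add: bad_def not_less ennreal_mult'[symmetric])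
    qed
    have Rb: "R \<in> sets borel" unfolding R_def using Jc Q by (intro sets.countable_UN') auto
    have disj: "disjoint_family_on (\<lambda>j. p -` {j}) J" "disjoint_family_on (\<lambda>j. p -` {j} - K) J"
      by (auto simp: disjoint_family_on_def)
    have "ennreal \<eta> * emeasure lborel R = ennreal \<eta> * (\<integral>\<^sup>+j. emeasure lborel (p -` {j}) \<partial>count_space J)"
      unfolding R_def using Jc Q disj by (subst emeasure_UN_countable) auto
    also have "\<dots> = (\<integral>\<^sup>+j. ennreal \<eta> * emeasure lborel (p -` {j}) \<partial>count_space J)"
      by (rule nn_integral_cmult[symmetric]) simp
    also have "\<dots> \<le> (\<integral>\<^sup>+j. emeasure lborel (p -` {j} - K) \<partial>count_space J)"
      using Q by (intro nn_integral_mono) auto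
    also have "\<dots> = emeasure lborel (\<Union>j\<in>J. p -` {j} - K)"
      using Jc Q disj Kb by (subst emeasure_UN_countable) auto
    also have "\<dots> \<le> emeasure lborel (U - K)"
    proof (rule emeasure_mono)
      show "(\<Union>j\<in>J. p -` {j} - K) \<subseteq> U - K" using Q(2) by blast
      show "U - K \<in> sets lborel" using U(1) Kb by simp
    qed
    also have "\<dots> < ennreal \<eta> * ennreal \<epsilon>" using U eta eps by (simp add: ennreal_mult')
    finally have Rs: "emeasure lborel R < ennreal \<epsilon>"
      by (meson mult_left_mono not_less zero_le)
    have "emeasure lborel (dyad_square n z - K) < ennreal (\<eta> / 4 ^ n)" if "z \<in> K - R" for z
    proof (rule ccontr)
      assume "\<not> ?thesis"
      then have "p z \<in> J" using that unfolding J_def bad_def by blast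
      then show False using that unfolding R_def by blast
    qed
    then show "\<exists>R\<in>sets borel. emeasure lborel R < ennreal \<epsilon> \<and>
      (\<forall>z\<in>K - R. emeasure lborel (dyad_square n z - K) < ennreal (\<eta> / 4 ^ n))"
      using Rb Rs by blast
  qed
qed

section \<open>Random choice of finitely many points\<close>

lemma nn_integral_le_scaled:
  assumes s: "sets \<mu> = sets \<nu>" and le: "\<And>S. S \<in> sets \<nu> \<Longrightarrow> emeasure \<mu> S \<le> c * emeasure \<nu> S"
    and f: "f \<in> borel_measurable \<nu>"
  shows "(\<integral>\<^sup>+x. f x \<partial>\<mu>) \<le> c * (\<integral>\<^sup>+x. f x \<partial>\<nu>)"
proof -
  have "\<mu> \<le> density \<nu> (\<lambda>_. c)"
    using s le by (subst le_measure) (auto simp: emeasure_density_const)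
  then have "(\<integral>\<^sup>+x. f x \<partial>\<mu>) \<le> (\<integral>\<^sup>+x. f x \<partial>density \<nu> (\<lambda>_. c))"
    using s by (intro nn_integral_mono_measure) auto
  also have "\<dots> = c * (\<integral>\<^sup>+x. f x \<partial>\<nu>)"
    using f by (simp add: nn_integral_density nn_integral_cmult)
  finally show ?thesis .
qed

text \<open>The first coordinate of one pair and the second of an independent one have densities at
  most \<open>c\<close>, so by Fubini their joint law has density at most \<open>c * c\<close>,
  however strongly the coordinates within a pair depend on each other.\<close>

lemma cross_measure_le:
  fixes \<mu> \<nu> :: "(real \<times> real) measure"
  assumes p: "prob_space \<mu>" "prob_space \<nu>" and s: "sets \<mu> = sets borel" "sets \<nu> = sets borel"
    and mu: "\<And>S. S \<in> sets borel \<Longrightarrow> emeasure \<mu> (S \<times> UNIV) \<le> c * emeasure lborel S"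
    and nu: "\<And>S. S \<in> sets borel \<Longrightarrow> emeasure \<nu> (UNIV \<times> S) \<le> c * emeasure lborel S"
    and F: "F \<in> sets borel"
  shows "emeasure (\<mu> \<Otimes>\<^sub>M \<nu>) {w. (fst (fst w), snd (snd w)) \<in> F} \<le> c * c * emeasure lborel F"
proof -
  interpret n: prob_space \<nu> by (rule p)
  have s2: "sets (\<mu> \<Otimes>\<^sub>M \<nu>) = sets borel"
    using sets_pair_measure_cong[OF s] unfolding borel_prod .
  have m: "(\<lambda>w :: (real \<times> real) \<times> (real \<times> real). (fst (fst w), snd (snd w))) \<in> borel_measurable borel"
    by (intro borel_measurable_continuous_onI continuous_intros)
  have set: "{w. (fst (fst w), snd (snd w)) \<in> F} \<in> sets (\<mu> \<Otimes>\<^sub>M \<nu>)"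
    using measurable_sets[OF m F] unfolding s2 by (simp add: vimage_def)
  define g where "g x = emeasure lborel (Pair x -` F)" for x
  have Fl: "F \<in> sets (lborel \<Otimes>\<^sub>M lborel)" unfolding lborel_prod using F by simp
  have g: "g \<in> borel_measurable borel"
    unfolding g_def using lborel.measurable_emeasure_Pair[OF Fl] by simp
  have fst: "fst \<in> measurable \<mu> borel"
    unfolding measurable_cong_sets[OF s(1) refl] by (intro borel_measurable_continuous_onI continuous_intros)
  have "emeasure (\<mu> \<Otimes>\<^sub>M \<nu>) {w. (fst (fst w), snd (snd w)) \<in> F} =
      (\<integral>\<^sup>+p. emeasure \<nu> (Pair p -` {w. (fst (fst w), snd (snd w)) \<in> F}) \<partial>\<mu>)"
    by (rule n.emeasure_pair_measure_alt[OF set])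
  also have "\<dots> \<le> (\<integral>\<^sup>+p. c * g (fst p) \<partial>\<mu>)"
  proof (rule nn_integral_mono)
    fix p :: "real \<times> real"
    have eq: "Pair p -` {w. (fst (fst w), snd (snd w)) \<in> F} = UNIV \<times> (Pair (fst p) -` F)" by auto
    have "Pair (fst p) -` F \<in> sets borel" using sets_Pair1[OF Fl, of "fst p"] by simp
    then show "emeasure \<nu> (Pair p -` {w. (fst (fst w), snd (snd w)) \<in> F}) \<le> c * g (fst p)"
      unfolding g_def eq by (rule nu)
  qed
  also have "\<dots> = c * (\<integral>\<^sup>+p. g (fst p) \<partial>\<mu>)"
    by (intro nn_integral_cmult measurable_compose[OF fst g])
  also have "(\<integral>\<^sup>+p. g (fst p) \<partial>\<mu>) = (\<integral>\<^sup>+x. g x \<partial>distr \<mu> borel fst)"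
    using g fst by (subst nn_integral_distr) auto
  also have "\<dots> \<le> c * (\<integral>\<^sup>+x. g x \<partial>lborel)"
  proof (rule nn_integral_le_scaled)
    fix S :: "real set" assume S: "S \<in> sets lborel"
    have "fst -` S \<inter> space \<mu> = S \<times> (UNIV :: real set)"
      using sets_eq_imp_space_eq[OF s(1)] by auto
    then show "emeasure (distr \<mu> borel fst) S \<le> c * emeasure lborel S"
      using S fst mu by (simp add: emeasure_distr)
  qed (use g in auto)
  also have "(\<integral>\<^sup>+x. g x \<partial>lborel) = emeasure lborel F"
    using lborel.emeasure_pair_measure_alt[OF Fl] unfolding lborel_prod g_def by simp
  finally show ?thesis by (simp add: mult.assoc mult_left_mono)
qed

text \<open>Union bound for independent points \<open>\<omega> u\<close> with laws
  \<open>M u\<close>. The sets \<open>D u\<close> constrain a single point and are measured by its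
  law; the sets \<open>F u v\<close> mix coordinates of two points, where Lebesgue measure controls
  the probability.\<close>

lemma exists_configuration:
  fixes M :: "'i \<Rightarrow> (real \<times> real) measure"
  assumes U: "finite U" and p: "\<And>u. prob_space (M u)" and s: "\<And>u. sets (M u) = sets borel"
    and mu: "\<And>u S. S \<in> sets borel \<Longrightarrow> emeasure (M u) (S \<times> UNIV) \<le> c * emeasure lborel S"
    and nu: "\<And>u S. S \<in> sets borel \<Longrightarrow> emeasure (M u) (UNIV \<times> S) \<le> c * emeasure lborel S"
    and D: "\<And>u. D u \<in> sets borel" and F: "\<And>u v. F u v \<in> sets borel"
    and sum: "(\<Sum>u\<in>U. emeasure (M u) (D u)) + (\<Sum>u\<in>U. \<Sum>v\<in>U - {u}. c * c * emeasure lborel (F u v)) < 1"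
  obtains \<omega> where "\<And>u. u \<in> U \<Longrightarrow> \<omega> u \<notin> D u"
    "\<And>u v. u \<in> U \<Longrightarrow> v \<in> U \<Longrightarrow> u \<noteq> v \<Longrightarrow> (fst (\<omega> u), snd (\<omega> v)) \<notin> F u v"
proof -
  interpret product_prob_space M U using p by (rule product_prob_spaceI)
  let ?P = "PiM U M"
  define X where "X u = {\<omega> \<in> space ?P. \<omega> u \<in> D u}" for u
  define Y where "Y u v = {\<omega> \<in> space ?P. (fst (\<omega> u), snd (\<omega> v)) \<in> F u v}" for u v
  have comp: "(\<lambda>\<omega>. \<omega> u) \<in> measurable ?P (M u)" if "u \<in> U" for u
    using that by (rule measurable_component_singleton)
  have X: "X u \<in> sets ?P" "emeasure ?P (X u) = emeasure (M u) (D u)" if "u \<in> U" for u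
  proof -
    have DM: "D u \<in> sets (M u)" using D s by simp
    have eq: "(\<lambda>\<omega>. \<omega> u) -` D u \<inter> space ?P = X u" by (auto simp: X_def)
    show "X u \<in> sets ?P" using measurable_sets[OF comp[OF that] DM] unfolding eq .
    have "emeasure (distr ?P (M u) (\<lambda>\<omega>. \<omega> u)) (D u) = emeasure ?P (X u)"
      using emeasure_distr[OF comp[OF that] DM] unfolding eq .
    then show "emeasure ?P (X u) = emeasure (M u) (D u)"
      using distr_PiM_component[of U M u] p that by simp
  qed
  have Y: "Y u v \<in> sets ?P" "emeasure ?P (Y u v) \<le> c * c * emeasure lborel (F u v)"
    if uv: "u \<in> U" "v \<in> U" "u \<noteq> v" for u v
  proof -
    have pm: "(\<lambda>\<omega>. (\<omega> u, \<omega> v)) \<in> measurable ?P (M u \<Otimes>\<^sub>M M v)"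
      using comp uv by (intro measurable_Pair) auto
    \<comment> \<open>Independence of two coordinates: their joint law agrees with the product
      measure on rectangles, so \<open>cross_measure_le\<close> applies.\<close>
    have d: "M u \<Otimes>\<^sub>M M v = distr ?P (M u \<Otimes>\<^sub>M M v) (\<lambda>\<omega>. (\<omega> u, \<omega> v))"
    proof (rule pair_measure_eqI)
      show "sigma_finite_measure (M u)" "sigma_finite_measure (M v)"
        using p by (simp_all add: prob_space_imp_sigma_finite)
      fix A B assume A: "A \<in> sets (M u)" and B: "B \<in> sets (M v)"
      have "(\<lambda>\<omega>. (\<omega> u, \<omega> v)) -` (A \<times> B) \<inter> space ?P =
          {\<omega> \<in> space ?P. \<forall>i\<in>{u, v}. \<omega> i \<in> (if i = u then A else B)}"
        using uv by auto
      then have "emeasure (distr ?P (M u \<Otimes>\<^sub>M M v) (\<lambda>\<omega>. (\<omega> u, \<omega> v))) (A \<times> B) =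
          emeasure ?P {\<omega> \<in> space ?P. \<forall>i\<in>{u, v}. \<omega> i \<in> (if i = u then A else B)}"
        using A B by (subst emeasure_distr[OF pm]) auto
      also have "\<dots> = (\<Prod>i\<in>{u, v}. emeasure (M i) (if i = u then A else B))"
        using uv A B by (intro emeasure_PiM_Collect) auto
      also have "\<dots> = emeasure (M u) A * emeasure (M v) B" using uv by simp
      finally show "emeasure (M u) A * emeasure (M v) B =
          emeasure (distr ?P (M u \<Otimes>\<^sub>M M v) (\<lambda>\<omega>. (\<omega> u, \<omega> v))) (A \<times> B)" ..
    qed simp
    let ?Z = "{w. (fst (fst w), snd (snd w)) \<in> F u v}"
    have s2: "sets (M u \<Otimes>\<^sub>M M v) = sets borel"
      using sets_pair_measure_cong[OF s s] unfolding borel_prod .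
    have m: "(\<lambda>w :: (real \<times> real) \<times> (real \<times> real). (fst (fst w), snd (snd w))) \<in> borel_measurable borel"
      by (intro borel_measurable_continuous_onI continuous_intros)
    have Z: "?Z \<in> sets (M u \<Otimes>\<^sub>M M v)"
      using measurable_sets[OF m F] unfolding s2 by (simp add: vimage_def)
    have eq: "(\<lambda>\<omega>. (\<omega> u, \<omega> v)) -` ?Z \<inter> space ?P = Y u v" by (auto simp: Y_def)
    show "Y u v \<in> sets ?P" using measurable_sets[OF pm Z] unfolding eq .
    have "emeasure ?P (Y u v) = emeasure (distr ?P (M u \<Otimes>\<^sub>M M v) (\<lambda>\<omega>. (\<omega> u, \<omega> v))) ?Z"
      using emeasure_distr[OF pm Z] unfolding eq by simp
    also have "\<dots> = emeasure (M u \<Otimes>\<^sub>M M v) ?Z" using d by simp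
    also have "\<dots> \<le> c * c * emeasure lborel (F u v)"
      by (rule cross_measure_le[OF p p s s mu nu F])
    finally show "emeasure ?P (Y u v) \<le> c * c * emeasure lborel (F u v)" .
  qed
  let ?N = "(\<Union>u\<in>U. X u) \<union> (\<Union>u\<in>U. \<Union>v\<in>U - {u}. Y u v)"
  have XN: "(\<Union>u\<in>U. X u) \<in> sets ?P" using U X by (intro sets.finite_UN) auto
  have YN: "(\<Union>v\<in>U - {u}. Y u v) \<in> sets ?P" if "u \<in> U" for u
    using U that by (intro sets.finite_UN Y(1)) auto
  have YN2: "(\<Union>u\<in>U. \<Union>v\<in>U - {u}. Y u v) \<in> sets ?P"
    by (rule sets.finite_UN[OF U YN])
  have "emeasure ?P ?N \<le> emeasure ?P (\<Union>u\<in>U. X u) + emeasure ?P (\<Union>u\<in>U. \<Union>v\<in>U - {u}. Y u v)"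
    using XN YN2 by (rule emeasure_subadditive)
  also have "\<dots> \<le> (\<Sum>u\<in>U. emeasure (M u) (D u)) + (\<Sum>u\<in>U. \<Sum>v\<in>U - {u}. c * c * emeasure lborel (F u v))"
  proof (rule add_mono)
    have "emeasure ?P (\<Union>u\<in>U. X u) \<le> (\<Sum>u\<in>U. emeasure ?P (X u))"
      using U X by (intro emeasure_subadditive_finite) auto
    then show "emeasure ?P (\<Union>u\<in>U. X u) \<le> (\<Sum>u\<in>U. emeasure (M u) (D u))" using X by simp
    have "emeasure ?P (\<Union>u\<in>U. \<Union>v\<in>U - {u}. Y u v) \<le> (\<Sum>u\<in>U. emeasure ?P (\<Union>v\<in>U - {u}. Y u v))"
      using U YN by (intro emeasure_subadditive_finite) auto
    also have "\<dots> \<le> (\<Sum>u\<in>U. \<Sum>v\<in>U - {u}. c * c * emeasure lborel (F u v))"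
    proof (rule sum_mono)
      fix u assume u: "u \<in> U"
      have "emeasure ?P (\<Union>v\<in>U - {u}. Y u v) \<le> (\<Sum>v\<in>U - {u}. emeasure ?P (Y u v))"
        using U u by (intro emeasure_subadditive_finite) (auto intro!: Y(1))
      also have "\<dots> \<le> (\<Sum>v\<in>U - {u}. c * c * emeasure lborel (F u v))"
        using u by (intro sum_mono Y(2)) auto
      finally show "emeasure ?P (\<Union>v\<in>U - {u}. Y u v) \<le> (\<Sum>v\<in>U - {u}. c * c * emeasure lborel (F u v))" .
    qed
    finally show "emeasure ?P (\<Union>u\<in>U. \<Union>v\<in>U - {u}. Y u v) \<le> (\<Sum>u\<in>U. \<Sum>v\<in>U - {u}. c * c * emeasure lborel (F u v))" .
  qed
  also have "\<dots> < 1" by (rule sum)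
  finally have lt: "emeasure ?P ?N < 1" .
  have "\<not> space ?P \<subseteq> ?N"
  proof
    assume "space ?P \<subseteq> ?N"
    then have "emeasure ?P (space ?P) \<le> emeasure ?P ?N"
      using XN YN2 by (intro emeasure_mono sets.Un)
    then show False using lt P.emeasure_space_1 by simp
  qed
  then obtain \<omega> where w: "\<omega> \<in> space ?P" "\<omega> \<notin> ?N" unfolding subset_iff not_all not_imp by (elim exE conjE)
  show ?thesis
  proof (rule that[of \<omega>])
    show "\<omega> u \<notin> D u" if "u \<in> U" for u using w that by (auto simp: X_def)
    fix u v assume "u \<in> U" "v \<in> U" "u \<noteq> v"
    then have "\<omega> \<notin> Y u v" using w(2) by blast
    then show "(fst (\<omega> u), snd (\<omega> v)) \<notin> F u v" using w(1) by (simp add: Y_def)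
  qed
qed

lemma uniform_marginal_le:
  fixes E :: "(real \<times> real) set"
  assumes E: "compact E" "0 < measure lborel E" and k: "0 \<le> k"
    and S: "S \<in> sets borel"
  shows "(\<And>x. measure lborel (Pair x -` E) \<le> k * measure lborel E) \<Longrightarrow>
      emeasure (uniform_measure lborel E) (S \<times> UNIV) \<le> ennreal k * emeasure lborel S"
    and "(\<And>y. measure lborel ((\<lambda>x. (x, y)) -` E) \<le> k * measure lborel E) \<Longrightarrow>
      emeasure (uniform_measure lborel E) (UNIV \<times> S) \<le> ennreal k * emeasure lborel S"
proof -
  let ?m = "measure lborel E"
  have Ef: "emeasure lborel E = ennreal ?m"
    using emeasure_compact_finite[OF E(1)] by (intro emeasure_eq_ennreal_measure) auto
  have Eb: "E \<in> sets borel" using E by (simp add: compact_imp_closed)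
  \<comment> \<open>Compact sections have finite measure, so the bounds on the real-valued
    \<open>measure\<close> carry over to \<open>emeasure\<close>.\<close>
  have cx: "compact (Pair x -` E)" for x
  proof -
    have "Pair x -` E = snd ` (E \<inter> {x} \<times> UNIV)" by force
    moreover have "compact (E \<inter> {x} \<times> UNIV)" using E by (intro compact_Int_closed closed_Times) auto
    ultimately show ?thesis by (simp add: compact_continuous_image continuous_on_snd)
  qed
  have cy: "compact ((\<lambda>x. (x, y)) -` E)" for y
  proof -
    have "(\<lambda>x. (x, y)) -` E = fst ` (E \<inter> UNIV \<times> {y})" by force
    moreover have "compact (E \<inter> UNIV \<times> {y})" using E by (intro compact_Int_closed closed_Times) auto
    ultimately show ?thesis by (simp add: compact_continuous_image continuous_on_fst)
  qed
  have fin: "emeasure lborel B = ennreal (measure lborel B)" if "compact B" for B :: "real set"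
    using emeasure_compact_finite[OF that] by (intro emeasure_eq_ennreal_measure) auto
  have quot: "emeasure (uniform_measure lborel E) T \<le> ennreal k * emeasure lborel S"
    if T: "T \<in> sets borel" "emeasure lborel (E \<inter> T) \<le> ennreal (k * ?m) * emeasure lborel S" for T
  proof -
    have "emeasure (uniform_measure lborel E) T = emeasure lborel (E \<inter> T) / ennreal ?m"
      using T Eb Ef by simp
    also have "\<dots> \<le> (ennreal (k * ?m) * emeasure lborel S) / ennreal ?m"
      using T by (intro divide_right_mono_ennreal)
    also have "\<dots> = ennreal k * emeasure lborel S"
    proof -
      have "ennreal (k * ?m) * emeasure lborel S = (ennreal k * emeasure lborel S) * ennreal ?m"
        using k by (simp add: ennreal_mult mult_ac)
      then show ?thesis using E by (simp add: ennreal_mult_divide_eq)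
    qed
    finally show ?thesis .
  qed
  show "emeasure (uniform_measure lborel E) (S \<times> UNIV) \<le> ennreal k * emeasure lborel S"
    if le: "\<And>x. measure lborel (Pair x -` E) \<le> k * ?m"
  proof (rule quot)
    have T: "E \<inter> S \<times> UNIV \<in> sets (lborel \<Otimes>\<^sub>M lborel)"
      unfolding lborel_prod using Eb S by (simp add: borel_Times sets.Int)
    have "emeasure lborel (E \<inter> S \<times> UNIV) = (\<integral>\<^sup>+x. emeasure lborel (Pair x -` (E \<inter> S \<times> UNIV)) \<partial>lborel)"
      using lborel.emeasure_pair_measure_alt[OF T] unfolding lborel_prod .
    also have "\<dots> \<le> (\<integral>\<^sup>+x. ennreal (k * ?m) * indicator S x \<partial>lborel)"
    proof (rule nn_integral_mono)
      fix x
      have "Pair x -` (E \<inter> S \<times> UNIV) = (if x \<in> S then Pair x -` E else {})" by auto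
      then show "emeasure lborel (Pair x -` (E \<inter> S \<times> UNIV)) \<le> ennreal (k * ?m) * indicator S x"
        using fin[OF cx[of x]] le[of x] by (simp add: ennreal_leI)
    qed
    also have "\<dots> = ennreal (k * ?m) * emeasure lborel S" using S by (simp add: nn_integral_cmult)
    finally show "emeasure lborel (E \<inter> S \<times> UNIV) \<le> ennreal (k * ?m) * emeasure lborel S" .
  qed (use S in \<open>simp add: borel_Times\<close>)
  show "emeasure (uniform_measure lborel E) (UNIV \<times> S) \<le> ennreal k * emeasure lborel S"
    if le: "\<And>y. measure lborel ((\<lambda>x. (x, y)) -` E) \<le> k * ?m"
  proof (rule quot)
    have T: "E \<inter> UNIV \<times> S \<in> sets (lborel \<Otimes>\<^sub>M lborel)"
      unfolding lborel_prod using Eb S by (simp add: borel_Times sets.Int)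
    have "emeasure lborel (E \<inter> UNIV \<times> S) = (\<integral>\<^sup>+y. emeasure lborel ((\<lambda>x. (x, y)) -` (E \<inter> UNIV \<times> S)) \<partial>lborel)"
      using lborel_pair.emeasure_pair_measure_alt2[OF T] unfolding lborel_prod .
    also have "\<dots> \<le> (\<integral>\<^sup>+y. ennreal (k * ?m) * indicator S y \<partial>lborel)"
    proof (rule nn_integral_mono)
      fix y
      have "(\<lambda>x. (x, y)) -` (E \<inter> UNIV \<times> S) = (if y \<in> S then (\<lambda>x. (x, y)) -` E else {})" by auto
      then show "emeasure lborel ((\<lambda>x. (x, y)) -` (E \<inter> UNIV \<times> S)) \<le> ennreal (k * ?m) * indicator S y"
        using fin[OF cy[of y]] le[of y] by (simp add: ennreal_leI)
    qed
    also have "\<dots> = ennreal (k * ?m) * emeasure lborel S" using S by (simp add: nn_integral_cmult)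
    finally show "emeasure lborel (E \<inter> UNIV \<times> S) \<le> ennreal (k * ?m) * emeasure lborel S" .
  qed (use S in \<open>simp add: borel_Times\<close>)
qed

section \<open>One level of the binary tree\<close>

definition sibling :: "nat \<Rightarrow> nat" where
  "sibling u = (if even u then Suc u else u - 1)"

lemma sibling:
  "sibling (sibling u) = u" "sibling u div 2 = u div 2" "sibling u \<noteq> u"
  "u < 2 * m \<Longrightarrow> sibling u < 2 * m" "u div 2 = v div 2 \<Longrightarrow> v = u \<or> v = sibling u"
  unfolding sibling_def by presburger+

text \<open>Made for the union bound in \<open>tree_extend\<close>: two exceptional sets of this
  relative area, weighted by the squared density bound, have probability at most
  \<open>1 / (16 * 4 ^ k)\<close> per pair, and the at most \<open>4 * 4 ^ k\<close> pairs
  contribute 1/4.\<close>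

definition tolerance :: "real \<Rightarrow> nat \<Rightarrow> real" where
  "tolerance C k = 1 / (32 * 4 ^ k * C\<^sup>2)"

text \<open>At level \<open>k\<close> the tree consists of points \<open>a s\<close> and \<open>b t\<close> with \<open>s, t < 2 ^ k\<close>. The compact
  set \<open>K s t\<close> contains the pair \<open>(a s, b t)\<close> and fills most of the dyadic square around it; it is
  passed on to the next level except at the pairs of distinct children of one node, where
  it is chosen anew.\<close>

definition tree_level ::
    "real \<Rightarrow> (real \<times> real) set \<Rightarrow> (real \<times> real) set \<Rightarrow> nat \<Rightarrow>
     nat \<times> (nat \<Rightarrow> real) \<times> (nat \<Rightarrow> real) \<times> (nat \<Rightarrow> nat \<Rightarrow> (real \<times> real) set) \<Rightarrow> bool" where
  "tree_level C W F k = (\<lambda>(n, a, b, K). k \<le> n \<and> (\<forall>s<2 ^ k. a s \<in> {0..<1} \<and> b s \<in> {0..<1}) \<and>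
     (\<forall>s<2 ^ k. \<forall>t<2 ^ k. compact (K s t) \<and> K s t \<subseteq> (if s = t then W else F) \<and> (a s, b t) \<in> K s t \<and>
        emeasure lborel (dyad_square n (a s, b t) - K s t) < ennreal (tolerance C k / 4 ^ n)))"

definition tree_refines ::
    "nat \<Rightarrow> nat \<times> (nat \<Rightarrow> real) \<times> (nat \<Rightarrow> real) \<times> (nat \<Rightarrow> nat \<Rightarrow> (real \<times> real) set) \<Rightarrow>
     nat \<times> (nat \<Rightarrow> real) \<times> (nat \<Rightarrow> real) \<times> (nat \<Rightarrow> nat \<Rightarrow> (real \<times> real) set) \<Rightarrow> bool" where
  "tree_refines k = (\<lambda>(n, a, b, K) (n', a', b', K').
     (\<forall>u<2 ^ Suc k. a' u \<in> dyad n (a (u div 2)) \<and> b' u \<in> dyad n (b (u div 2))) \<and>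
     (\<forall>u<2 ^ Suc k. \<forall>v<2 ^ Suc k. u = v \<or> u div 2 \<noteq> v div 2 \<longrightarrow> K' u v = K (u div 2) (v div 2)))"

text \<open>The children of node \<open>s\<close> are \<open>2 * s\<close> and
  \<open>2 * s + 1\<close>. For each child \<open>u\<close> one point \<open>\<omega> u\<close> is
  drawn uniformly from a subset \<open>E s\<close> of \<open>F\<close> inside the square of the
  diagonal pair of \<open>s\<close>. It supplies the first coordinate of \<open>u\<close> and the
  second coordinate of the sibling of \<open>u\<close>, so crosswise pairs lie in \<open>E s\<close>
  by construction. Every other pair, including the diagonal ones, combines two independent points
  and stays in the inherited set \<open>K\<close> with high probability.\<close>

lemma tree_extend:
  assumes spread: "spreading C F" and C: "0 < C" and inv: "tree_level C W F k \<sigma>"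
  shows "\<exists>\<sigma>'. tree_level C W F (Suc k) \<sigma>' \<and> tree_refines k \<sigma> \<sigma>'"
proof -
  obtain n a b K where sigma: "\<sigma> = (n, a, b, K)" by (metis prod_cases4)
  define m :: nat where "m = 2 ^ k"
  have m: "0 < m" "2 ^ Suc k = 2 * m" by (simp_all add: m_def)
  have nk: "k \<le> n" and ab: "\<And>s. s < m \<Longrightarrow> a s \<in> {0..<1} \<and> b s \<in> {0..<1}"
    and K: "\<And>s t. s < m \<Longrightarrow> t < m \<Longrightarrow> compact (K s t)"
      "\<And>s t. s < m \<Longrightarrow> t < m \<Longrightarrow> K s t \<subseteq> (if s = t then W else F)"
      "\<And>s t. s < m \<Longrightarrow> t < m \<Longrightarrow> emeasure lborel (dyad_square n (a s, b t) - K s t) < ennreal (tolerance C k / 4 ^ n)"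
    using inv unfolding sigma tree_level_def m_def by auto
  \<comment> \<open>Both sides have measure \<open>1 / 2 ^ n\<close>, whence the factor
    \<open>2 ^ n\<close> in the bound on the sections.\<close>
  have "\<forall>s\<in>{..<m}. \<exists>E. compact E \<and> E \<subseteq> F \<inter> dyad_square n (a s, b s) \<and> 0 < measure lborel E \<and>
        (\<forall>x. measure lborel (Pair x -` E) \<le> C * 2 ^ n * measure lborel E) \<and>
        (\<forall>y. measure lborel ((\<lambda>x. (x, y)) -` E) \<le> C * 2 ^ n * measure lborel E)"
  proof
    fix s assume "s \<in> {..<m}"
    then have "a s \<in> {0..<1}" "b s \<in> {0..<1}" using ab by auto
    moreover have "{0..<1} \<subseteq> {0..1::real}" by auto
    ultimately have "dyad n (a s) \<subseteq> {0..1}" "dyad n (b s) \<subseteq> {0..1}"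
      using dyad_subset order_trans by blast+
    then show "\<exists>E. compact E \<and> E \<subseteq> F \<inter> dyad_square n (a s, b s) \<and> 0 < measure lborel E \<and>
        (\<forall>x. measure lborel (Pair x -` E) \<le> C * 2 ^ n * measure lborel E) \<and>
        (\<forall>y. measure lborel ((\<lambda>x. (x, y)) -` E) \<le> C * 2 ^ n * measure lborel E)"
      using spread[unfolded spreading_def, rule_format, of "dyad n (a s)" "dyad n (b s)"]
      unfolding dyad_square_def measure_dyad by (simp add: mult_ac)
  qed
  from bchoice[OF this] obtain E where E0: "\<forall>s\<in>{..<m}. compact (E s) \<and>
        E s \<subseteq> F \<inter> dyad_square n (a s, b s) \<and> 0 < measure lborel (E s) \<and>
        (\<forall>x. measure lborel (Pair x -` E s) \<le> C * 2 ^ n * measure lborel (E s)) \<and>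
        (\<forall>y. measure lborel ((\<lambda>x. (x, y)) -` E s) \<le> C * 2 ^ n * measure lborel (E s))" ..
  then have E: "compact (E s)" "E s \<subseteq> F" "E s \<subseteq> dyad_square n (a s, b s)" "0 < measure lborel (E s)"
    "measure lborel (Pair x -` E s) \<le> C * 2 ^ n * measure lborel (E s)"
    "measure lborel ((\<lambda>x. (x, y)) -` E s) \<le> C * 2 ^ n * measure lborel (E s)" if "s < m" for s x y
    using that by simp_all
  define \<eta> where "\<eta> = tolerance C k"
  have eta: "0 < \<eta>" "C * C * (2 * \<eta>) = 1 / (16 * 4 ^ k)"
    using C by (auto simp: \<eta>_def tolerance_def power2_eq_square)
  have eta': "0 < tolerance C (Suc k)" using C by (simp add: tolerance_def)
  let ?U = "{..<2 * m}"
  define K' where "K' u v = (if v = sibling u then E (u div 2) else K (u div 2) (v div 2))" for u v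
  \<comment> \<open>The exceptional set of a sibling pair is weighed by the uniform law on
    \<open>E\<close>, so its size is relative to \<open>E\<close>; elsewhere it may be as large as
    the portion of the square known to be missing from \<open>K\<close>.\<close>
  define eps where "eps u v = (if v = sibling u then measure lborel (E (u div 2)) / (4 * 2 ^ k) else \<eta> / 4 ^ n)" for u v
  have K': "compact (K' u v)" "0 < eps u v" if "u < 2 * m" "v < 2 * m" for u v
    using that E K eta by (auto simp: K'_def eps_def less_mult_imp_div_less)
  define good where "good n' u v R \<longleftrightarrow> R \<in> sets borel \<and> emeasure lborel R < ennreal (eps u v) \<and>
    (\<forall>z\<in>K' u v - R. emeasure lborel (dyad_square n' z - K' u v) < ennreal (tolerance C (Suc k) / 4 ^ n'))" for n' u v R
  have "\<forall>\<^sub>F n' in sequentially. \<forall>u\<in>?U. \<forall>v\<in>?U. \<exists>R. good n' u v R"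
  proof (intro eventually_ball_finite ballI)
    fix u v assume "u \<in> ?U" "v \<in> ?U"
    then have "compact (K' u v)" "0 < eps u v" using K' by auto
    from good_squares[OF this(1) eta' this(2)]
    show "\<forall>\<^sub>F n' in sequentially. \<exists>R. good n' u v R"
      unfolding good_def by (rule eventually_mono) blast
  qed auto
  then have "\<forall>\<^sub>F n' in sequentially. Suc k \<le> n' \<and> (\<forall>u\<in>?U. \<forall>v\<in>?U. \<exists>R. good n' u v R)"
    by (intro eventually_conj eventually_ge_at_top)
  \<comment> \<open>One scale serves all pairs, because \<open>good_squares\<close> holds at all
    large scales.\<close>
  then obtain n' where n': "Suc k \<le> n'" "\<And>u v. u < 2 * m \<Longrightarrow> v < 2 * m \<Longrightarrow> \<exists>R. good n' u v R"
    unfolding eventually_sequentially by auto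
  \<comment> \<open>The value outside the range, like the index modulo \<open>m\<close> in
    \<open>e\<close> below, is there because \<open>exists_configuration\<close> asks for measurable
    sets and probability laws at all indices.\<close>
  define R where "R u v = (if u < 2 * m \<and> v < 2 * m then SOME R. good n' u v R else {})" for u v
  have good: "good n' u v (R u v)" if "u < 2 * m" "v < 2 * m" for u v
    using someI_ex[OF n'(2)[OF that]] that by (simp add: R_def)
  have Rb: "R u v \<in> sets borel" for u v
    using good[of u v] unfolding good_def by (cases "u < 2 * m \<and> v < 2 * m") (auto simp: R_def)
  define e where "e u = E ((u div 2) mod m)" for u
  have e_eq: "e u = E (u div 2)" if "u < 2 * m" for u
    using that by (simp add: e_def less_mult_imp_div_less)
  have e: "compact (e u)" "0 < measure lborel (e u)" for u
    unfolding e_def using E m by simp_all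
  have ef: "emeasure lborel (e u) = ennreal (measure lborel (e u))" for u
    using emeasure_compact_finite[OF e(1)[of u]] by (intro emeasure_eq_ennreal_measure) auto
  have eb: "e u \<in> sets borel" for u using e by (simp add: compact_imp_closed)
  define M where "M u = uniform_measure lborel (e u)" for u
  define c where "c = ennreal (C * 2 ^ n)"
  define D where "D u = - e u \<union> R u (sibling u)" for u
  \<comment> \<open>The second coordinate of \<open>\<omega> v\<close> becomes
    \<open>b' (sibling v)\<close>. The pair formed from \<open>\<omega> u\<close> and
    \<open>\<omega> v\<close> must therefore lie in \<open>K' u (sibling v)\<close>, which is
    inherited for \<open>u \<noteq> v\<close>, and avoid \<open>R u (sibling v)\<close>.\<close>
  define P where "P u v = (if u < 2 * m \<and> v < 2 * m
    then (dyad_square n (a (u div 2), b (v div 2)) - K (u div 2) (v div 2)) \<union> R u (sibling v) else {})" for u v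
  have Pb: "P u v \<in> sets borel" for u v
  proof -
    have "K (u div 2) (v div 2) \<in> sets borel" if "u < 2 * m" "v < 2 * m"
      using that K(1)[of "u div 2" "v div 2"] by (auto simp: less_mult_imp_div_less compact_imp_closed)
    then show ?thesis using Rb by (auto simp: P_def)
  qed
  have "(\<Sum>u\<in>?U. emeasure (M u) (D u)) + (\<Sum>u\<in>?U. \<Sum>v\<in>?U - {u}. c * c * emeasure lborel (P u v))
      \<le> of_nat (2 * m) * ennreal (1 / (4 * 2 ^ k)) + of_nat (2 * m) * (of_nat (2 * m) * ennreal (1 / (16 * 4 ^ k)))"
  proof (intro add_mono)
    have "emeasure (M u) (D u) \<le> ennreal (1 / (4 * 2 ^ k))" if u: "u < 2 * m" for u
    proof -
      have "emeasure (M u) (D u) = emeasure lborel (e u \<inter> D u) / emeasure lborel (e u)"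
        unfolding M_def using eb Rb by (intro emeasure_uniform_measure) (auto simp: D_def)
      also have "\<dots> \<le> ennreal (measure lborel (e u) / (4 * 2 ^ k)) / emeasure lborel (e u)"
      proof (rule divide_right_mono_ennreal)
        have "emeasure lborel (e u \<inter> D u) \<le> emeasure lborel (R u (sibling u))"
          using Rb by (intro emeasure_mono) (auto simp: D_def)
        also have "\<dots> \<le> ennreal (measure lborel (e u) / (4 * 2 ^ k))"
          using good[OF u sibling(4)[OF u]] e_eq[OF u]
          by (simp add: good_def eps_def order.strict_implies_order)
        finally show "emeasure lborel (e u \<inter> D u) \<le> ennreal (measure lborel (e u) / (4 * 2 ^ k))" .
      qed
      also have "\<dots> = ennreal (1 / (4 * 2 ^ k))"
        unfolding ef using e(2)[of u] by (simp add: divide_ennreal)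
      finally show ?thesis .
    qed
    then show "(\<Sum>u\<in>?U. emeasure (M u) (D u)) \<le> of_nat (2 * m) * ennreal (1 / (4 * 2 ^ k))"
      using sum_bounded_above[of ?U "\<lambda>u. emeasure (M u) (D u)" "ennreal (1 / (4 * 2 ^ k))"] by simp
    have "c * c * emeasure lborel (P u v) \<le> ennreal (1 / (16 * 4 ^ k))"
      if uv: "u < 2 * m" "v < 2 * m" "u \<noteq> v" for u v
    proof -
      have st: "u div 2 < m" "v div 2 < m" using uv by (auto simp: less_mult_imp_div_less)
      have Kb: "K (u div 2) (v div 2) \<in> sets borel" using K(1)[OF st] by (simp add: compact_imp_closed)
      have "sibling v \<noteq> sibling u" using uv sibling(1) by metis
      then have "emeasure lborel (R u (sibling v)) \<le> ennreal (\<eta> / 4 ^ n)"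
        using good[OF uv(1) sibling(4)[OF uv(2)]]
        by (simp add: good_def eps_def order.strict_implies_order)
      moreover have "emeasure lborel (dyad_square n (a (u div 2), b (v div 2)) - K (u div 2) (v div 2)) \<le> ennreal (\<eta> / 4 ^ n)"
        using K(3)[OF st] by (simp add: \<eta>_def order.strict_implies_order)
      moreover have "emeasure lborel (P u v) \<le>
          emeasure lborel (dyad_square n (a (u div 2), b (v div 2)) - K (u div 2) (v div 2)) + emeasure lborel (R u (sibling v))"
        unfolding P_def using uv Kb Rb by (simp add: emeasure_subadditive)
      ultimately have "emeasure lborel (P u v) \<le> ennreal (\<eta> / 4 ^ n) + ennreal (\<eta> / 4 ^ n)"
        by (meson add_mono order_trans)
      also have "\<dots> = ennreal (2 * \<eta> / 4 ^ n)" using eta by (simp add: ennreal_plus[symmetric])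
      finally have "c * c * emeasure lborel (P u v) \<le> c * c * ennreal (2 * \<eta> / 4 ^ n)" by (rule mult_left_mono) simp
      also have "\<dots> = ennreal ((C * 2 ^ n) * (C * 2 ^ n) * (2 * \<eta> / 4 ^ n))"
        unfolding c_def using C eta by (simp add: ennreal_mult[symmetric])
      \<comment> \<open>The squared density bound cancels the area \<open>1 / 4 ^ n\<close> of a
        dyadic square, so the estimate is independent of the scale.\<close>
      also have "(C * 2 ^ n) * (C * 2 ^ n) * (2 * \<eta> / 4 ^ n) = C * C * (2 * \<eta>)"
      proof -
        have "(4::real) ^ n = 2 ^ n * 2 ^ n" by (simp add: power_mult_distrib[symmetric])
        then show ?thesis by simp
      qed
      finally show ?thesis unfolding eta(2) .
    qed
    note pair = this
    show "(\<Sum>u\<in>?U. \<Sum>v\<in>?U - {u}. c * c * emeasure lborel (P u v)) \<le>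
        of_nat (2 * m) * (of_nat (2 * m) * ennreal (1 / (16 * 4 ^ k)))"
    proof -
      have "(\<Sum>v\<in>?U - {u}. c * c * emeasure lborel (P u v)) \<le> of_nat (2 * m) * ennreal (1 / (16 * 4 ^ k))"
        if u: "u \<in> ?U" for u
      proof -
        have "(\<Sum>v\<in>?U - {u}. c * c * emeasure lborel (P u v)) \<le> of_nat (card (?U - {u})) * ennreal (1 / (16 * 4 ^ k))"
          using pair u by (intro sum_bounded_above) auto
        also have "\<dots> \<le> of_nat (2 * m) * ennreal (1 / (16 * 4 ^ k))"
          using card_mono[of ?U "?U - {u}"] by (intro mult_right_mono of_nat_mono) auto
        finally show ?thesis .
      qed
      from sum_bounded_above[of ?U, OF this] show ?thesis by simp
    qed
  qed
  also have "\<dots> = ennreal (2 * 2 ^ k * (1 / (4 * 2 ^ k)) + 2 * 2 ^ k * (2 * 2 ^ k * (1 / (16 * 4 ^ k))))"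
  proof -
    have "of_nat (2 * m) = ennreal (2 * 2 ^ k)"
      unfolding m_def ennreal_of_nat_eq_real_of_nat by (metis of_nat_mult of_nat_numeral of_nat_power)
    moreover have "ennreal x * ennreal y + ennreal x * (ennreal x * ennreal z) = ennreal (x * y + x * (x * z))"
      if "0 \<le> x" "0 \<le> y" "0 \<le> z" for x y z
      using that by (simp add: ennreal_mult)
    ultimately show ?thesis by (simp only: zero_le_numeral zero_le_power zero_le_mult_iff zero_le_divide_iff zero_le_one simp_thms)
  qed
  \<comment> \<open>The single points contribute 1/2 and the pairs 1/4.\<close>
  also have "2 * 2 ^ k * (1 / (4 * 2 ^ k)) + 2 * 2 ^ k * (2 * 2 ^ k * (1 / (16 * 4 ^ k))) = (3 / 4 :: real)"
  proof -
    have "(4::real) ^ k = 2 ^ k * 2 ^ k" by (simp add: power_mult_distrib[symmetric])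
    then show ?thesis by simp
  qed
  also have "ennreal (3 / 4) < 1" by (simp add: ennreal_less_one_iff)
  finally have total: "(\<Sum>u\<in>?U. emeasure (M u) (D u)) + (\<Sum>u\<in>?U. \<Sum>v\<in>?U - {u}. c * c * emeasure lborel (P u v)) < 1" .
  obtain \<omega> where om: "\<And>u. u \<in> ?U \<Longrightarrow> \<omega> u \<notin> D u"
    "\<And>u v. u \<in> ?U \<Longrightarrow> v \<in> ?U \<Longrightarrow> u \<noteq> v \<Longrightarrow> (fst (\<omega> u), snd (\<omega> v)) \<notin> P u v"
  proof (rule exists_configuration[of ?U M c D P])
    show "prob_space (M u)" for u
      unfolding M_def using ef[of u] e(2)[of u] by (intro prob_space_uniform_measure) auto
    show "emeasure (M u) (S \<times> UNIV) \<le> c * emeasure lborel S" if "S \<in> sets borel" for u S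
      unfolding M_def c_def
    proof (rule uniform_marginal_le(1)[OF e _ that])
      show "measure lborel (Pair x -` e u) \<le> C * 2 ^ n * measure lborel (e u)" for x
        unfolding e_def by (rule E(5)) (use m in simp)
    qed (use C in simp)
    show "emeasure (M u) (UNIV \<times> S) \<le> c * emeasure lborel S" if "S \<in> sets borel" for u S
      unfolding M_def c_def
    proof (rule uniform_marginal_le(2)[OF e _ that])
      show "measure lborel ((\<lambda>x. (x, y)) -` e u) \<le> C * 2 ^ n * measure lborel (e u)" for y
        unfolding e_def by (rule E(6)) (use m in simp)
    qed (use C in simp)
    show "D u \<in> sets borel" for u unfolding D_def using eb Rb by auto
  qed (use Pb total in \<open>auto simp: M_def\<close>)
  define a' where "a' u = fst (\<omega> u)" for u
  define b' where "b' u = snd (\<omega> (sibling u))" for u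
  have omE: "\<omega> u \<in> E (u div 2)" "\<omega> u \<notin> R u (sibling u)" if "u < 2 * m" for u
    using om(1)[of u] that e_eq[OF that] by (auto simp: D_def)
  have omd: "fst (\<omega> u) \<in> dyad n (a (u div 2))" "snd (\<omega> u) \<in> dyad n (b (u div 2))" if "u < 2 * m" for u
    using omE(1)[OF that] E(3)[of "u div 2"] that by (auto simp: dyad_square_def less_mult_imp_div_less)
  have a'd: "a' u \<in> dyad n (a (u div 2))" and b'd: "b' u \<in> dyad n (b (u div 2))" if "u < 2 * m" for u
    using omd(1)[OF that] omd(2)[OF sibling(4)[OF that]] unfolding a'_def b'_def sibling(2) by auto
  have mem: "(a' u, b' v) \<in> K' u v - R u v" if uv: "u < 2 * m" "v < 2 * m" for u v
  proof (cases "v = sibling u")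
    case True
    then show ?thesis using omE[OF uv(1)] by (simp add: a'_def b'_def sibling K'_def)
  next
    case False
    then have "u \<noteq> sibling v" using sibling(1) by metis
    with om(2)[of u "sibling v"] uv sibling(4)[OF uv(2)]
    have "(a' u, b' v) \<notin> P u (sibling v)" unfolding a'_def b'_def by auto
    moreover have "(a' u, b' v) \<in> dyad_square n (a (u div 2), b (v div 2))"
      using a'd[OF uv(1)] b'd[OF uv(2)] by (simp add: dyad_square_def)
    ultimately show ?thesis
      using uv sibling(4)[OF uv(2)] False by (simp add: P_def sibling K'_def)
  qed
  have "tree_level C W F (Suc k) (n', a', b', K')"
    unfolding tree_level_def prod.case m(2)
  proof (intro conjI allI impI)
    show "Suc k \<le> n'" by (rule n'(1))
  next
    fix u assume u: "u < 2 * m"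
    then have "u div 2 < m" by (simp add: less_mult_imp_div_less)
    with ab have "dyad n (a (u div 2)) \<subseteq> {0..<1}" "dyad n (b (u div 2)) \<subseteq> {0..<1}"
      using dyad_subset by blast+
    then show "a' u \<in> {0..<1}" "b' u \<in> {0..<1}" using a'd[OF u] b'd[OF u] by blast+
  next
    fix u v assume uv: "u < 2 * m" "v < 2 * m"
    have st: "u div 2 < m" "v div 2 < m" using uv by (auto simp: less_mult_imp_div_less)
    show "compact (K' u v)" using K'(1)[OF uv] .
    show "(a' u, b' v) \<in> K' u v" using mem[OF uv] by blast
    show "emeasure lborel (dyad_square n' (a' u, b' v) - K' u v) < ennreal (tolerance C (Suc k) / 4 ^ n')"
      using good[OF uv] mem[OF uv] unfolding good_def by blast
    show "K' u v \<subseteq> (if u = v then W else F)"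
    proof (cases "v = sibling u")
      case True
      then show ?thesis using sibling(3)[of u] E(2)[OF st(1)] by (auto simp: K'_def)
    next
      case False
      \<comment> \<open>Apart from siblings, nodes with the same parent are equal, so an inherited
        set keeps its prescribed region, \<open>W\<close> on the diagonal and \<open>F\<close> off
        it.\<close>
      then have "u div 2 = v div 2 \<longleftrightarrow> u = v" using sibling(5)[of u v] by auto
      then show ?thesis using False K(2)[OF st] by (simp add: K'_def)
    qed
  qed
  moreover have "tree_refines k \<sigma> (n', a', b', K')"
    unfolding tree_refines_def sigma prod.case m(2)
  proof (intro conjI allI impI)
    fix u v assume "u < 2 * m" "v < 2 * m" "u = v \<or> u div 2 \<noteq> v div 2"
    then have "v \<noteq> sibling u" using sibling(2,3) by metis
    then show "K' u v = K (u div 2) (v div 2)" by (simp add: K'_def)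
  qed (use a'd b'd in auto)
  ultimately show ?thesis by blast
qed

lemma convergent_of_geometric_steps:
  fixes s :: "nat \<Rightarrow> real"
  assumes "\<And>k. \<bar>s (Suc k) - s k\<bar> \<le> 1 / 2 ^ k"
  shows "convergent s"
proof -
  have "summable (\<lambda>k. s (Suc k) - s k)"
  proof (rule summable_comparison_test'[of "\<lambda>k. (1 / 2) ^ k" 0])
    show "summable (\<lambda>k. (1 / 2 :: real) ^ k)" by (rule summable_geometric) simp
  qed (use assms in \<open>simp add: power_one_over\<close>)
  then have "convergent (\<lambda>n. s n - s 0)"
    unfolding summable_iff_convergent sum_lessThan_telescope .
  then have "convergent (\<lambda>n. (s n - s 0) + s 0)" by (intro convergent_add convergent_const)
  then show ?thesis by simp
qed

text \<open>Iterates \<open>tree_extend\<close>, starting from a point whose dyadic square is almost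
  filled by a compact part of \<open>W\<close>; the branches are indexed by the binary digits of
  \<open>t\<close>.\<close>

lemma perfect_family:
  assumes spread: "spreading C F" and C: "0 < C"
    and W: "W \<in> sets lebesgue" "W \<subseteq> {0..<1} \<times> {0..<1}" "0 < measure lebesgue W"
  shows "\<exists>x. \<exists>y\<in>borel_measurable borel. (\<forall>t\<in>{0..<1::real}. (x t, y t) \<in> W) \<and>
    (\<forall>t\<in>{0..<1}. \<forall>t'\<in>{0..<1}. t \<noteq> t' \<longrightarrow> (x t, y t') \<in> F)"
proof -
  have Wsq: "W \<subseteq> unit_square" using W(2) by force
  have Wm: "W \<in> lmeasurable" using W(1) Wsq by (rule fmeasurable_subset_unit_square)
  obtain K0 where K0: "closed K0" "K0 \<subseteq> W" "W - K0 \<in> lmeasurable"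
    "emeasure lebesgue (W - K0) < ennreal (measure lebesgue W)"
    using sets_lebesgue_inner_closed[OF W(1,3)] .
  have "bounded unit_square" by (intro bounded_Times) auto
  then have K0c: "compact K0"
    using K0 Wsq unfolding compact_eq_bounded_closed by (meson bounded_subset order_trans)
  have K0m: "K0 \<in> lmeasurable" using K0c by (rule lmeasurable_compact)
  have "measure lebesgue (W - K0) < measure lebesgue W"
    using K0(3,4) W(3) by (simp add: emeasure_eq_measure2 ennreal_less_iff)
  moreover have "measure lebesgue W = measure lebesgue K0 + measure lebesgue (W - K0)"
    using measure_Un2[OF K0m Wm] K0(2) by (simp add: Un_absorb1)
  ultimately have K0p: "0 < measure lborel K0" using K0(1) by simp
  have K0e: "emeasure lborel K0 = ennreal (measure lborel K0)"
    using emeasure_compact_finite[OF K0c] by (intro emeasure_eq_ennreal_measure) auto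
  have tol: "0 < tolerance C 0" using C by (simp add: tolerance_def)
  obtain n R where R: "R \<in> sets borel" "emeasure lborel R < ennreal (measure lborel K0)"
    "\<And>z. z \<in> K0 - R \<Longrightarrow> emeasure lborel (dyad_square n z - K0) < ennreal (tolerance C 0 / 4 ^ n)"
    using good_squares[OF K0c tol K0p] unfolding eventually_sequentially by blast
  have "\<not> K0 \<subseteq> R"
  proof
    assume "K0 \<subseteq> R"
    then have "emeasure lborel K0 \<le> emeasure lborel R" using R(1) by (intro emeasure_mono) auto
    then show False using R(2) K0e by simp
  qed
  then obtain z where z: "z \<in> K0 - R" by blast
  have z01: "fst z \<in> {0..<1}" "snd z \<in> {0..<1}" using z K0(2) W(2) by auto
  have base: "tree_level C W F 0 (n, \<lambda>_. fst z, \<lambda>_. snd z, \<lambda>_ _. K0)"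
    unfolding tree_level_def prod.case using z01 z K0c K0(2) R(3)[OF z] by auto
  have "\<exists>f. \<forall>k. tree_level C W F k (f k) \<and> tree_refines k (f k) (f (Suc k))"
    by (rule dependent_nat_choice) (use base tree_extend[OF spread C] in blast)+
  then obtain f where f: "\<And>k. tree_level C W F k (f k)" "\<And>k. tree_refines k (f k) (f (Suc k))" by blast
  define n where "n k = fst (f k)" for k
  define a where "a k = fst (snd (f k))" for k
  define b where "b k = fst (snd (snd (f k)))" for k
  define K where "K k = snd (snd (snd (f k)))" for k
  have fk: "f k = (n k, a k, b k, K k)" for k by (simp add: n_def a_def b_def K_def)
  have level: "k \<le> n k" "s < 2 ^ k \<Longrightarrow> t < 2 ^ k \<Longrightarrow> compact (K k s t)"
    "s < 2 ^ k \<Longrightarrow> t < 2 ^ k \<Longrightarrow> K k s t \<subseteq> (if s = t then W else F)"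
    "s < 2 ^ k \<Longrightarrow> t < 2 ^ k \<Longrightarrow> (a k s, b k t) \<in> K k s t" for k s t
    using f(1)[of k] unfolding fk tree_level_def prod.case by blast+
  have refine: "u < 2 ^ Suc k \<Longrightarrow> a (Suc k) u \<in> dyad (n k) (a k (u div 2))"
    "u < 2 ^ Suc k \<Longrightarrow> b (Suc k) u \<in> dyad (n k) (b k (u div 2))"
    "u < 2 ^ Suc k \<Longrightarrow> v < 2 ^ Suc k \<Longrightarrow> u = v \<or> u div 2 \<noteq> v div 2 \<Longrightarrow>
      K (Suc k) u v = K k (u div 2) (v div 2)" for k u v
    using f(2)[of k] unfolding fk tree_refines_def prod.case by blast+
  define idx where "idx k t = nat \<lfloor>2 ^ k * t\<rfloor>" for k and t :: real
  have idx_less: "idx k t < 2 ^ k" if "t \<in> {0..<1}" for k t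
  proof -
    have "\<lfloor>2 ^ k * t\<rfloor> < 2 ^ k" using that by (simp add: floor_less_iff)
    then show ?thesis unfolding idx_def by (simp add: nat_less_iff)
  qed
  have idx_div: "idx (Suc k) t div 2 = idx k t" if "t \<in> {0..<1}" for k t
  proof -
    have "\<lfloor>2 ^ Suc k * t\<rfloor> div 2 = \<lfloor>2 ^ Suc k * t / 2\<rfloor>"
      using floor_divide_real_eq_div[of 2 "2 ^ Suc k * t"] by simp
    also have "\<dots> = \<lfloor>2 ^ k * t\<rfloor>" by simp
    finally have "nat (\<lfloor>2 ^ Suc k * t\<rfloor> div 2) = nat \<lfloor>2 ^ k * t\<rfloor>" by simp
    then show ?thesis unfolding idx_def by (simp add: nat_div_distrib)
  qed
  \<comment> \<open>The condition \<open>k \<le> n k\<close> in \<open>tree_level\<close> makes the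
    moves along a branch geometrically small.\<close>
  have step: "1 / 2 ^ n k \<le> (1 / 2 ^ k :: real)" for k
    using level(1)[of k] by (simp add: divide_left_mono)
  have conva: "convergent (\<lambda>k. a k (idx k t))" and convb: "convergent (\<lambda>k. b k (idx k t))"
    if t: "t \<in> {0..<1}" for t
  proof -
    have "a (Suc k) (idx (Suc k) t) \<in> dyad (n k) (a k (idx k t))"
      "b (Suc k) (idx (Suc k) t) \<in> dyad (n k) (b k (idx k t))" for k
      using refine(1,2)[OF idx_less[OF t, of "Suc k"]] unfolding idx_div[OF t] by blast+
    then have "\<bar>a (Suc k) (idx (Suc k) t) - a k (idx k t)\<bar> \<le> 1 / 2 ^ k"
      "\<bar>b (Suc k) (idx (Suc k) t) - b k (idx k t)\<bar> \<le> 1 / 2 ^ k" for k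
      using dyad_dist step order_trans by blast+
    then show "convergent (\<lambda>k. a k (idx k t))" "convergent (\<lambda>k. b k (idx k t))"
      by (auto intro: convergent_of_geometric_steps)
  qed
  define x where "x t = lim (\<lambda>k. a k (idx k t))" for t
  define y where "y t = lim (\<lambda>k. b k (idx k t))" for t
  \<comment> \<open>On the diagonal the compact set is inherited from the root for ever; off it, the
    set is kept from any level at which the branches have separated. Being closed, it contains the
    limit.\<close>
  have limit: "(x t, y t') \<in> K j (idx j t) (idx j t')"
    if t: "t \<in> {0..<1}" "t' \<in> {0..<1}" and j: "t = t' \<or> idx j t \<noteq> idx j t'" for t t' j
  proof -
    have const: "(t = t' \<or> idx k t \<noteq> idx k t') \<and> K k (idx k t) (idx k t') = K j (idx j t) (idx j t')"
      if "j \<le> k" for k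
      using that
    proof (induction k rule: dec_induct)
      case (step k)
      have "t = t' \<or> idx (Suc k) t \<noteq> idx (Suc k) t'"
        using step.IH idx_div[OF t(1), of k] idx_div[OF t(2), of k] by metis
      moreover have "K (Suc k) (idx (Suc k) t) (idx (Suc k) t') = K k (idx k t) (idx k t')"
        using refine(3)[OF idx_less[OF t(1), of "Suc k"] idx_less[OF t(2), of "Suc k"]] step.IH
        unfolding idx_div[OF t(1)] idx_div[OF t(2)] by blast
      ultimately show ?case using step.IH by simp
    qed (use j in simp)
    have "closed (K j (idx j t) (idx j t'))"
      using level(2)[OF idx_less[OF t(1)] idx_less[OF t(2)]] by (rule compact_imp_closed)
    moreover have "\<forall>\<^sub>F k in sequentially. (a k (idx k t), b k (idx k t')) \<in> K j (idx j t) (idx j t')"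
      unfolding eventually_sequentially
    proof (intro exI[of _ j] allI impI)
      fix k assume "j \<le> k"
      then show "(a k (idx k t), b k (idx k t')) \<in> K j (idx j t) (idx j t')"
        using const level(4)[OF idx_less[OF t(1)] idx_less[OF t(2)]] by metis
    qed
    moreover have "(\<lambda>k. (a k (idx k t), b k (idx k t'))) \<longlonglongrightarrow> (x t, y t')"
      unfolding x_def y_def using conva[OF t(1)] convb[OF t(2)]
      by (intro tendsto_Pair) (auto simp: convergent_LIMSEQ_iff)
    ultimately show ?thesis by (rule Lim_in_closed_set[OF _ _ sequentially_bot])
  qed
  have sep: "\<exists>j. idx j t \<noteq> idx j t'" if t: "t \<in> {0..<1}" "t' \<in> {0..<1}" "t \<noteq> t'" for t t'
  proof (rule ccontr)
    assume "\<not> ?thesis"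
    then have "nat \<lfloor>2 ^ j * t\<rfloor> = nat \<lfloor>2 ^ j * t'\<rfloor>" for j unfolding idx_def by blast
    \<comment> \<open>\<open>nat\<close> loses nothing here, both points being nonnegative.\<close>
    then have "\<lfloor>2 ^ j * t'\<rfloor> = \<lfloor>2 ^ j * t\<rfloor>" for j using t by (auto simp: nat_eq_iff2)
    then have "\<bar>t' - t\<bar> \<le> 1 / 2 ^ j" for j by (intro dyad_dist) (simp add: dyad_def)
    moreover obtain j where "(1 / 2) ^ j < \<bar>t' - t\<bar>"
      using real_arch_pow_inv[of "\<bar>t' - t\<bar>" "1 / 2"] t(3) by auto
    ultimately show False by (metis not_less power_one_over)
  qed
  show ?thesis
  proof (intro exI[of _ x] bexI[of _ y] conjI ballI impI)
    \<comment> \<open>\<open>lim\<close> gives a Borel function on the whole line, although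
      convergence is known on \<open>{0..<1}\<close> only.\<close>
    have "(\<lambda>t. b k (idx k t)) \<in> borel_measurable borel" for k
    proof -
      have "(\<lambda>t :: real. \<lfloor>2 ^ k * t\<rfloor>) \<in> measurable borel (count_space UNIV)" by measurable
      then show ?thesis unfolding idx_def
        by (rule measurable_compose[where g = "\<lambda>i. b k (nat i)"]) simp
    qed
    then show "y \<in> borel_measurable borel" unfolding y_def by (rule borel_measurable_lim_metric)
    show "(x t, y t) \<in> W" if t: "t \<in> {0..<1}" for t
    proof -
      have "(x t, y t) \<in> K 0 (idx 0 t) (idx 0 t)" using limit[OF t t, of 0] by simp
      then show ?thesis using level(3)[OF idx_less[OF t] idx_less[OF t], of 0] by auto
    qed
    fix t t' :: real assume t: "t \<in> {0..<1}" "t' \<in> {0..<1}" "t \<noteq> t'"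
    then obtain j where j: "idx j t \<noteq> idx j t'" using sep by blast
    then have "(x t, y t') \<in> K j (idx j t) (idx j t')" using limit[OF t(1,2)] by blast
    then show "(x t, y t') \<in> F" using level(3)[OF idx_less[OF t(1)] idx_less[OF t(2)], of j] j by auto
  qed
qed

section \<open>The theorem\<close>

text \<open>Vitali's set: one representative from each class modulo the rationals. Its rational
  translates are disjoint and cover the interval, which excludes measure zero, while arbitrarily
  many of them fit into \<open>{0..2}\<close>, which excludes positive measure.\<close>

lemma exists_nonmeasurable: "\<exists>V \<subseteq> {0..<1::real}. V \<notin> sets lebesgue"
proof -
  define c where "c x = (SOME z. z \<in> {0..<1} \<and> x - z \<in> \<rat>)" for x :: real
  have c: "c x \<in> {0..<1}" "x - c x \<in> \<rat>" if "x \<in> {0..<1}" for x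
  proof -
    have "\<exists>z. z \<in> {0..<1} \<and> x - z \<in> \<rat>" using that by (intro exI[of _ x]) auto
    from someI_ex[OF this] show "c x \<in> {0..<1}" "x - c x \<in> \<rat>" unfolding c_def by auto
  qed
  \<comment> \<open>Equivalent points get the same representative because the predicates under
    \<open>SOME\<close> coincide.\<close>
  have c_eq: "c x = c x'" if "x - x' \<in> \<rat>" for x x'
  proof -
    have "x - z \<in> \<rat> \<longleftrightarrow> x' - z \<in> \<rat>" for z
      using Rats_diff[OF _ that, of "x - z"] Rats_add[OF that, of "x' - z"] by auto
    then show ?thesis unfolding c_def by presburger
  qed
  define V where "V = c ` {0..<1}"
  have V: "V \<subseteq> {0..<1}" using c by (auto simp: V_def)
  define T where "T q = (+) q ` V" for q :: real
  have disj: "T q \<inter> T q' = {}" if q: "q \<in> \<rat>" "q' \<in> \<rat>" "q \<noteq> q'" for q q'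
  proof (rule ccontr)
    assume "T q \<inter> T q' \<noteq> {}"
    then obtain w where "w \<in> (+) q ` V" "w \<in> (+) q' ` V" unfolding T_def by blast
    then obtain v v' where v: "v \<in> V" "v' \<in> V" "q + v = q' + v'" by (metis imageE)
    then obtain x x' where x: "x \<in> {0..<1}" "x' \<in> {0..<1}" "q + c x = q' + c x'"
      unfolding V_def by blast
    have "x - x' = (x - c x) - (x' - c x') + (q' - q)" using x(3) by simp
    also have "\<dots> \<in> \<rat>" 
      by (rule Rats_add[OF Rats_diff[OF c(2)[OF x(1)] c(2)[OF x(2)]] Rats_diff[OF q(2,1)]])
    finally have "c x = c x'" by (rule c_eq)
    then show False using x(3) q(3) by simp
  qed
  have "V \<notin> sets lebesgue"
  proof
    assume Vs: "V \<in> sets lebesgue"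
    have VI: "V \<subseteq> {0..1}" using V by force
    then have Vm: "V \<in> lmeasurable" using Vs by (rule fmeasurable_subset_unit[rotated])
    have T: "T q \<in> lmeasurable" "measure lebesgue (T q) = measure lebesgue V" for q
      unfolding T_def using Vm by (auto simp: measurable_translation measure_translation)
    show False
    proof (cases "measure lebesgue V = 0")
      case True
      have "T q \<in> null_sets lebesgue" for q
        using T[of q] True by (auto simp: null_sets_def emeasure_eq_measure2 fmeasurableD)
      then have "(\<Union>q\<in>\<rat>. T q) \<in> null_sets lebesgue"
        by (intro null_sets_UN' countable_rat)
      moreover have "{0..<1} \<subseteq> (\<Union>q\<in>\<rat>. T q)"
      proof
        fix x :: real assume x: "x \<in> {0..<1}"
        then have "x \<in> T (x - c x)" unfolding T_def V_def by force
        then show "x \<in> (\<Union>q\<in>\<rat>. T q)" using c(2)[OF x] by blast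
      qed
      ultimately have "{0..<1::real} \<in> null_sets lebesgue" by (rule null_sets_completion_subset[rotated])
      then show False by (simp add: null_sets_def)
    next
      case False
      then have pos: "0 < measure lebesgue V" by (simp add: zero_less_measure_iff)
      obtain N :: nat where N: "2 / measure lebesgue V < real N" using reals_Archimedean2 by blast
      \<comment> \<open>Any sequence of distinct rationals in the unit interval would serve; it
        keeps the translates of \<open>V\<close> inside \<open>{0..2}\<close>.\<close>
      define q where "q i = 1 / real (Suc i)" for i
      have q: "q i \<in> \<rat>" "0 \<le> q i" "q i \<le> 1" for i by (auto simp: q_def)
      have "real N * measure lebesgue V = (\<Sum>i<N. measure lebesgue (T (q i)))" using T by simp
      also have "\<dots> = measure lebesgue (\<Union>i<N. T (q i))"
      proof (rule measure_finite_Union[symmetric])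
        show "disjoint_family_on (\<lambda>i. T (q i)) {..<N}"
          unfolding disjoint_family_on_def
        proof (intro ballI impI)
          fix i j :: nat assume "i \<noteq> j"
          then have "q i \<noteq> q j" by (simp add: q_def)
          then show "T (q i) \<inter> T (q j) = {}" using disj q by blast
        qed
        show "emeasure lebesgue (T (q i)) \<noteq> \<infinity>" for i
          using fmeasurableD2[OF T(1)] by (simp add: infinity_ennreal_def)
      qed (use T in \<open>auto simp: fmeasurableD\<close>)
      also have "\<dots> \<le> measure lebesgue {0..2::real}"
      proof (rule measure_mono_fmeasurable)
        show "(\<Union>i<N. T (q i)) \<subseteq> {0..2}"
        proof
          fix w assume "w \<in> (\<Union>i<N. T (q i))"
          then obtain i v where "w = q i + v" "v \<in> V" unfolding T_def by blast
          then show "w \<in> {0..2}" using q(2,3)[of i] VI by fastforce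
        qed
        show "(\<Union>i<N. T (q i)) \<in> sets lebesgue" using T by (intro sets.finite_UN) (auto simp: fmeasurableD)
      qed simp
      finally have "real N * measure lebesgue V \<le> 2" by simp
      then show False using N pos by (simp add: field_simps)
    qed
  qed
  then show ?thesis using V by blast
qed

text \<open>The second side of a basic open box around \<open>p\<close> works, since points on the
  same vertical line as \<open>p\<close> have their first coordinate in the first side.\<close>

lemma openin_separating:
  assumes cont: "continuous_map (subtopology (prod_topology T T) X) euclideanreal H"
    and top: "X \<subseteq> topspace T \<times> topspace T" and p: "p \<in> X" "H p < c"
  obtains V where "openin T V" "snd p \<in> V"
    "\<And>q. q \<in> X \<Longrightarrow> fst q = fst p \<Longrightarrow> snd q \<in> V \<Longrightarrow> H q < c"
proof -
  have "openin (subtopology (prod_topology T T) X)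
      {z \<in> topspace (subtopology (prod_topology T T) X). H z \<in> {..<c}}"
    by (rule openin_continuous_map_preimage[OF cont]) simp
  moreover have "topspace (subtopology (prod_topology T T) X) = X" using top by auto
  ultimately have "openin (subtopology (prod_topology T T) X) {z \<in> X. H z \<in> {..<c}}" by metis
  then obtain Q where Q: "openin (prod_topology T T) Q" "{z \<in> X. H z \<in> {..<c}} = Q \<inter> X"
    unfolding openin_subtopology by blast
  have "(fst p, snd p) \<in> Q" using Q(2) p by auto
  from Q(1)[unfolded openin_prod_topology_alt, rule_format, OF this]
  obtain U V where UV: "openin T V" "fst p \<in> U" "snd p \<in> V" "U \<times> V \<subseteq> Q" by blast
  show ?thesis
  proof (rule that[OF UV(1,3)])
    fix q assume q: "q \<in> X" "fst q = fst p" "snd q \<in> V"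
    then have "q \<in> U \<times> V" using UV(2) by (simp add: mem_Times_iff)
    then have "q \<in> Q \<inter> X" using UV(4) q(1) by blast
    then show "H q < c" unfolding Q(2)[symmetric] by simp
  qed
qed

lemma not_ae_continuous_weakly_isomorphic_G:
  assumes H: "graphon H" and w: "weakly_isomorphic H G" and top: "topspace T = {0..1}"
    and borel: "\<And>S. openin T S \<Longrightarrow> S \<in> sets borel"
  shows "\<not> ae_continuous T H"
proof
  assume "ae_continuous T H"
  then obtain X where X: "X \<subseteq> unit_square" "X \<in> sets lebesgue" "emeasure lebesgue X = 1"
    and cont: "continuous_map (subtopology (prod_topology T T) X) euclideanreal H"
    unfolding ae_continuous_def by blast
  let ?c = "127 / 128 :: real"
  define low where "low = {z \<in> unit_square. H z < ?c}"
  define high where "high = {z \<in> unit_square. ?c < H z}"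
  have Hm: "H \<in> borel_measurable (lebesgue_on unit_square)" using graphon_measurable[OF H] by blast
  have low: "low \<in> sets lebesgue"
    using measurable_sets[OF Hm, of "{..<?c}"] unfolding low_def
    by (simp add: vimage_def Int_def conj_commute sets_restrict_space_iff fmeasurableD[OF unit_square_lmeasurable(1)])
  have high: "high \<in> sets lebesgue"
    using measurable_sets[OF Hm, of "{?c<..}"] unfolding high_def
    by (simp add: vimage_def Int_def conj_commute sets_restrict_space_iff fmeasurableD[OF unit_square_lmeasurable(1)])
  have X_null: "unit_square - X \<in> null_sets lebesgue"
  proof (rule null_setsI)
    have "emeasure lebesgue unit_square = 1"
      using unit_square_lmeasurable by (simp add: emeasure_eq_measure2)
    then show "emeasure lebesgue (unit_square - X) = 0"
      using X by (subst emeasure_Diff) (auto simp: fmeasurableD[OF unit_square_lmeasurable(1)])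
    show "unit_square - X \<in> sets lebesgue"
      using X fmeasurableD[OF unit_square_lmeasurable(1)] by (intro sets.Diff)
  qed
  \<comment> \<open>The half-open dyadic squares of the tree stay inside the unit square only for
    points of \<open>{0..<1}\<close>; the edges thus given up are null.\<close>
  have edge: "{1} \<times> {0..1} \<union> {0..1} \<times> {1::real} \<in> null_sets (lebesgue :: (real \<times> real) measure)"
    using lebesgue_Times[of "{1::real}" "{0..1::real}"] lebesgue_Times[of "{0..1::real}" "{1::real}"]
    by (intro null_sets.Un) (auto simp: null_sets_def)
  define W where "W = X \<inter> ({0..<1} \<times> {0..<1}) \<inter> low"
  define F where "F = X \<inter> high"
  have "spreading 48 F"
  proof (rule spreading_black[OF H w])
    show "F \<in> sets lebesgue" unfolding F_def using X(2) high by (rule sets.Int)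
    have "high - F \<subseteq> unit_square - X" by (auto simp: F_def high_def)
    then show "{z \<in> unit_square. ?c < H z} - F \<in> null_sets lebesgue"
      unfolding high_def[symmetric] using X_null by (rule null_sets_completion_subset)
  qed
  have W: "W \<in> sets lebesgue"
    unfolding W_def using X(2) low by (intro sets.Int lebesgue_Times(1)) auto
  have W01: "W \<subseteq> {0..<1} \<times> {0..<1}" by (auto simp: W_def)
  have "0 < measure lebesgue W"
  proof (rule ccontr)
    assume "\<not> ?thesis"
    then have "measure lebesgue W = 0" by (simp add: zero_less_measure_iff)
    moreover have "W \<in> lmeasurable"
      using W by (rule fmeasurable_subset_unit_square) (auto simp: W_def low_def)
    ultimately have "W \<in> null_sets lebesgue" using W by (auto simp: null_sets_def emeasure_eq_measure2)
    then have "W \<union> (unit_square - X) \<union> ({1} \<times> {0..1} \<union> {0..1} \<times> {1}) \<in> null_sets lebesgue"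
      by (rule null_sets.Un[OF null_sets.Un[OF _ X_null] edge])
    moreover have "low \<subseteq> W \<union> (unit_square - X) \<union> ({1} \<times> {0..1} \<union> {0..1} \<times> {1})"
      by (auto simp: W_def low_def)
    ultimately have "low \<in> null_sets lebesgue" by (rule null_sets_completion_subset[rotated])
    then have "measure lebesgue low = 0" by (simp add: null_sets_def measure_def)
    then show False using measure_white_pos[OF H w] unfolding low_def by simp
  qed
  from perfect_family[OF \<open>spreading 48 F\<close> zero_less_numeral W W01 this]
  obtain x y where y: "y \<in> borel_measurable borel"
    and "\<forall>t\<in>{0..<1::real}. (x t, y t) \<in> W" "\<forall>t\<in>{0..<1}. \<forall>t'\<in>{0..<1}. t \<noteq> t' \<longrightarrow> (x t, y t') \<in> F"
    by blast
  then have xy: "\<And>t. t \<in> {0..<1} \<Longrightarrow> (x t, y t) \<in> W"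
      "\<And>t t'. t \<in> {0..<1} \<Longrightarrow> t' \<in> {0..<1} \<Longrightarrow> t \<noteq> t' \<Longrightarrow> (x t, y t') \<in> F"
    by simp_all
  have "\<exists>U. openin T U \<and> y t \<in> U \<and> (\<forall>t'\<in>{0..<1}. t' \<noteq> t \<longrightarrow> y t' \<notin> U)"
    if t: "t \<in> {0..<1}" for t
  proof -
    have p: "(x t, y t) \<in> X" "H (x t, y t) < ?c" using xy(1)[OF t] by (auto simp: W_def low_def)
    obtain U where U: "openin T U" "snd (x t, y t) \<in> U"
      "\<And>q. q \<in> X \<Longrightarrow> fst q = fst (x t, y t) \<Longrightarrow> snd q \<in> U \<Longrightarrow> H q < ?c"
      by (rule openin_separating[OF cont _ p]) (use X top in auto)
    have "y t' \<notin> U" if "t' \<in> {0..<1}" "t' \<noteq> t" for t'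
    proof
      assume "y t' \<in> U"
      moreover have "(x t, y t') \<in> X" "?c < H (x t, y t')"
        using xy(2)[OF t that(1)] that(2) by (auto simp: F_def high_def)
      ultimately show False using U(3)[of "(x t, y t')"] by simp
    qed
    then show ?thesis using U by auto
  qed
  then have "\<forall>t\<in>{0..<1}. \<exists>U. openin T U \<and> y t \<in> U \<and> (\<forall>t'\<in>{0..<1}. t' \<noteq> t \<longrightarrow> y t' \<notin> U)"
    by blast
  from bchoice[OF this] obtain U where
    "\<forall>t\<in>{0..<1}. openin T (U t) \<and> y t \<in> U t \<and> (\<forall>t'\<in>{0..<1}. t' \<noteq> t \<longrightarrow> y t' \<notin> U t)" ..
  then have U: "\<And>t. t \<in> {0..<1} \<Longrightarrow> openin T (U t)" "\<And>t. t \<in> {0..<1} \<Longrightarrow> y t \<in> U t"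
    "\<And>t t'. t \<in> {0..<1} \<Longrightarrow> t' \<in> {0..<1} \<Longrightarrow> t' \<noteq> t \<Longrightarrow> y t' \<notin> U t"
    by simp_all
  obtain V where V: "V \<subseteq> {0..<1::real}" "V \<notin> sets lebesgue" using exists_nonmeasurable by blast
  \<comment> \<open>The union may be uncountable. It is Borel by the hypothesis on the topology, and
    its preimage under \<open>y\<close> is exactly \<open>V\<close> because \<open>U t\<close>
    contains no other point of the family.\<close>
  have "openin T (\<Union>t\<in>V. U t)" using U(1) V(1) by (intro openin_Union) auto
  then have "y -` (\<Union>t\<in>V. U t) \<inter> space borel \<in> sets borel"
    using measurable_sets[OF y borel] by blast
  then have "y -` (\<Union>t\<in>V. U t) \<inter> {0..<1} \<in> sets borel" by auto
  moreover have "y -` (\<Union>t\<in>V. U t) \<inter> {0..<1} = V"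
  proof (intro equalityI subsetI)
    fix t assume "t \<in> y -` (\<Union>t\<in>V. U t) \<inter> {0..<1}"
    then obtain s where "s \<in> V" "y t \<in> U s" "t \<in> {0..<1}" by blast
    then show "t \<in> V" using U(3)[of s t] V(1) by blast
  next
    fix t assume "t \<in> V"
    then show "t \<in> y -` (\<Union>t\<in>V. U t) \<inter> {0..<1}" using U(2) V(1) by blast
  qed
  ultimately show False using V(2) by simp
qed

theorem theorem6p3:
  shows "graphon G \<and> random_free G \<and> (\<exists>k. computable_d1_name G k) \<and>
    (\<forall>(H :: real \<times> real \<Rightarrow> real) (T :: real topology).
       graphon H \<longrightarrow>
       weakly_isomorphic H G \<longrightarrow>
       topspace T = {0..1} \<longrightarrow>
       (\<forall>S. openin T S \<longrightarrow> S \<in> sets borel) \<longrightarrow>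
       \<not> ae_continuous T H)"
  using graphon_G random_free_G computable_d1_name_stage_code not_ae_continuous_weakly_isomorphic_G
  by blast

end
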